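(* Let $n\ge0$ and let $\Gamma_0\in\mathbf L(\mathfrak M,\mathfrak N),\Gamma_1,\dots,\Gamma_{2n+1}$ be a choice sequence. Suppose $\mathfrak D_{\Gamma_{2n+1}}\ne\{0\}$ and $\mathfrak D_{\Gamma^*_{2n+1}}\ne\{0\}$. Then the formula $$\Theta(z)=\Theta_n^{(0)}(z)+C_n(z)\mathcal E(z)\left(I_{\mathfrak D_{\Gamma_{2n+1}}}-A_n(z)\mathcal E(z)\right)^{-1}B_n(z),\quad z\in\mathbb D,\qquad( * )$$ gives a one-to-one correspondence between all functions $\mathcal E\in\mathbf S(\mathfrak D_{\Gamma_{2n+1}},\mathfrak D_{\Gamma^*_{2n+1}})$ and all functions $\Theta\in\mathbf S(\mathfrak M,\mathfrak N)$ having the given choice sequence $\Gamma_0,\Gamma_1,\dots,\Gamma_{2n+1}$ as their first $2n+2$ Schur parameters. Moreover, the Schur parameters of the function $\Theta$ given by $( * )$ are $$\Gamma_0,\Gamma_1,\dots,\Gamma_{2n+1},\gamma_0^{(\mathcal E)},\gamma_1^{(\mathcal E)},\dots,$$ where $\gamma_0^{(\mathcal E)}\in\mathbf L(\mathfrak D_{\Gamma_{2n+1}},\mathfrak D_{\Gamma^*_{2n+1}}),\gamma_1^{(\mathcal E)},\dots$ are the Schur parameters of $\mathcal E$. Here, with $R(z)=(I_{\mathcal K_n}-z\mathcal S_{n,0})^{-1}$, $$\begin{aligned}\Theta^{(0)}_n(z)&=\Gamma_0+zD_{\Gamma_0^*}\begin{bmatrix}\Gamma_1&D_{\Gamma_1^*}\end{bmatrix}\left(P_{\mathcal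 H_1}R(z)\upharpoonright\mathfrak D_{\Gamma_0}\right)D_{\Gamma_0},\\ A_n(z)&=z\begin{bmatrix}D_{\Gamma_{2n+1}}&-\Gamma^*_{2n+1}\end{bmatrix}\left(P_{\mathcal H_{n+1}}R(z)\upharpoonright\mathfrak D_{\Gamma^*_{2n+1}}\right),\\ B_n(z)&=z\begin{bmatrix}D_{\Gamma_{2n+1}}&-\Gamma^*_{2n+1}\end{bmatrix}\left(P_{\mathcal H_{n+1}}R(z)\upharpoonright\mathfrak D_{\Gamma_0}\right)D_{\Gamma_0},\\ C_n(z)&=zD_{\Gamma_0^*}\begin{bmatrix}\Gamma_1&D_{\Gamma_1^*}\end{bmatrix}\left(P_{\mathcal H_1}R(z)\upharpoonright\mathfrak D_{\Gamma^*_{2n+1}}\right).\end{aligned}$$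
   Context: All Hilbert spaces are complex (infinite-dimensional ones are separable). $\mathbf L(H_1,H_2)$ denotes the bounded operators; $P_L$ is the orthogonal projection onto a subspace $L$ (regarded as a map into $L$), $X\upharpoonright L$ is restriction. For a contraction $T$: $D_T=(I-T^*T)^{1/2}$, $\mathfrak D_T=\overline{\operatorname{ran}}\,D_T$. $\mathbf S(\mathfrak M,\mathfrak N)$ is the Schur class: holomorphic $\Theta:\mathbb D\to\mathbf L(\mathfrak M,\mathfrak N)$ with $\|\Theta(z)\|\le1$. A choice sequence consists of contractions $\Gamma_0\in\mathbf L(\mathfrak M,\mathfrak N)$, $\Gamma_k\in\mathbf L(\mathfrak D_{\Gamma_{k-1}},\mathfrak D_{\Gamma_{k-1}^*})$, $k\ge1$. Schur parameters of $\Theta\in\mathbf S(\mathfrak M,\mathfrak N)$: $\Theta_0=\Theta$, $\Gamma_k=\Theta_k(0)$, and $\Theta_{k+1}\in\mathbf S(\mathfrak D_{\Gamma_k},\mathfrak D_{\Gamma_k^*})$ is the unique function with $\Theta_k(z)=\Gamma_k+zD_{\Gamma_k^*}\Theta_{k+1}(z)(I+z\Gamma_k^*\Theta_{k+1}(z))^{-1}D_{\Gamma_k}$, $z\in\mathbb D$. (The map from functions to their Schur parameters is a bijection from $\mathbf S(\mathfrak M,\mathfrak N)$ onto the set of choice sequences.) Elementary rotations, for $k\ge1$, are the unitary operators $$\mathbf J_{\Gamma_k}=\begin{bmatrix}\Gamma_k&D_{\Gamma_k^*}\\ D_{\Gamma_k}&-\Gamma_k^*\end{bmatrix}:\mathfrak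 D_{\Gamma_{k-1}}\oplus\mathfrak D_{\Gamma_k^*}\to\mathfrak D_{\Gamma_{k-1}^*}\oplus\mathfrak D_{\Gamma_k}.$$ Put $\mathcal H_k=\mathfrak D_{\Gamma_{2k-2}}\oplus\mathfrak D_{\Gamma^*_{2k-1}}$, $\widetilde{\mathcal H}_k=\mathfrak D_{\Gamma^*_{2k-2}}\oplus\mathfrak D_{\Gamma_{2k-1}}$ ($1\le k\le n+1$), $\mathcal K_n=\bigoplus_{k=1}^{n+1}\mathcal H_k$, $\widetilde{\mathcal K}_n=\bigoplus_{k=1}^{n+1}\widetilde{\mathcal H}_k$. The operator $\mathcal S_{n,0}$ on $\mathcal K_n$ is $\mathcal S_{n,0}=\mathcal W_{n,0}\mathcal V_n$, where $\mathcal V_n=\bigoplus_{k=1}^{n+1}\mathbf J_{\Gamma_{2k-1}}:\mathcal K_n\to\widetilde{\mathcal K}_n$ and $\mathcal W_{n,0}=-\Gamma_0^*\oplus\bigoplus_{k=1}^n\mathbf J_{\Gamma_{2k}}\oplus0$ maps $\widetilde{\mathcal K}_n=\mathfrak D_{\Gamma_0^*}\oplus\bigoplus_{k=1}^n(\mathfrak D_{\Gamma_{2k-1}}\oplus\mathfrak D_{\Gamma_{2k}^*})\oplus\mathfrak D_{\Gamma_{2n+1}}$ to $\mathcal K_n=\mathfrak D_{\Gamma_0}\oplus\bigoplus_{k=1}^n(\mathfrak D_{\Gamma_{2k-1}^*}\oplus\mathfrak D_{\Gamma_{2k}})\oplus\mathfrak D_{\Gamma_{2n+1}^*}$. The rows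 $\begin{bmatrix}\Gamma_1&D_{\Gamma_1^*}\end{bmatrix}$ and $\begin{bmatrix}D_{\Gamma_{2n+1}}&-\Gamma^*_{2n+1}\end{bmatrix}$ act from $\mathcal H_1$ to $\mathfrak D_{\Gamma_0^*}$ and from $\mathcal H_{n+1}$ to $\mathfrak D_{\Gamma_{2n+1}}$, respectively. *)

theory Defs
  imports "HOL-Analysis.Analysis"
begin

section \<open>Complex Hilbert spaces\<close>

text \<open>The inner product is linear in its first argument.\<close>

class chilbert_space = banach +
  fixes scaleC :: "complex \<Rightarrow> 'a \<Rightarrow> 'a" (infixr "*\<^sub>C" 75)
    and cinner :: "'a \<Rightarrow> 'a \<Rightarrow> complex"
  assumes scaleC_add_right: "c *\<^sub>C (x + y) = c *\<^sub>C x + c *\<^sub>C y"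
    and scaleC_add_left: "(c + d) *\<^sub>C x = c *\<^sub>C x + d *\<^sub>C x"
    and scaleC_scaleC: "c *\<^sub>C d *\<^sub>C x = (c * d) *\<^sub>C x"
    and scaleC_of_real: "complex_of_real r *\<^sub>C x = r *\<^sub>R x"
    and cinner_commute: "cinner x y = cnj (cinner y x)"
    and cinner_add_left: "cinner (x + y) z = cinner x z + cinner y z"
    and cinner_scaleC_left: "cinner (c *\<^sub>C x) y = c * cinner x y"
    and cinner_self_eq_norm: "cinner x x = complex_of_real ((norm x)\<^sup>2)"

instantiation complex :: chilbert_space
begin

definition scaleC_complex :: "complex \<Rightarrow> complex \<Rightarrow> complex" where
  "scaleC_complex c x = c * x"

definition cinner_complex :: "complex \<Rightarrow> complex \<Rightarrow> complex" where
  "cinner_complex x y = x * cnj y"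

instance
  by standard
    (auto simp: scaleC_complex_def cinner_complex_def algebra_simps scaleR_conv_of_real
      complex_norm_square simp flip: of_real_power)

end

text \<open>The product type carries the norm of the orthogonal direct sum.\<close>

instantiation prod :: (chilbert_space, chilbert_space) chilbert_space
begin

definition scaleC_prod :: "complex \<Rightarrow> 'a \<times> 'b \<Rightarrow> 'a \<times> 'b" where
  "scaleC_prod c x = (c *\<^sub>C fst x, c *\<^sub>C snd x)"

definition cinner_prod :: "'a \<times> 'b \<Rightarrow> 'a \<times> 'b \<Rightarrow> complex" where
  "cinner_prod x y = cinner (fst x) (fst y) + cinner (snd x) (snd y)"

instance
proof
  fix x y :: "'a \<times> 'b"
  show "cinner x y = cnj (cinner y x)"
    by (simp add: cinner_prod_def flip: cinner_commute)
  show "cinner x x = complex_of_real ((norm x)\<^sup>2)"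
    by (simp add: cinner_prod_def norm_prod_def cinner_self_eq_norm)
qed (auto simp: scaleC_prod_def cinner_prod_def scaleC_add_right scaleC_add_left scaleC_scaleC
      scaleC_of_real cinner_add_left cinner_scaleC_left prod_eq_iff algebra_simps)

end

section \<open>Operators between closed subspaces\<close>

text \<open>
  All spaces between which the operators of a choice sequence act are closed subspaces of two fixed
  Hilbert spaces. An operator from the closed subspace \<open>L\<close> to the closed subspace \<open>L'\<close> is represented
  by its extension by zero on the orthogonal complement of \<open>L\<close>. The adjoint of the extension is
  the extension of the adjoint, and the identity of \<open>L\<close> is represented by the orthogonal projection
  onto \<open>L\<close>.
\<close>

definition bounded_ops :: "'a::chilbert_space set \<Rightarrow> 'b::chilbert_space set \<Rightarrow> ('a \<Rightarrow> 'b) set" where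
  "bounded_ops L L' = {T. bounded_linear T \<and> (\<forall>c x. T (c *\<^sub>C x) = c *\<^sub>C T x) \<and> range T \<subseteq> L' \<and>
     (\<forall>x. (\<forall>u\<in>L. cinner x u = 0) \<longrightarrow> T x = 0)}"

definition contractions :: "'a::chilbert_space set \<Rightarrow> 'b::chilbert_space set \<Rightarrow> ('a \<Rightarrow> 'b) set" where
  "contractions L L' = {T \<in> bounded_ops L L'. onorm T \<le> 1}"

definition adj :: "('a::chilbert_space \<Rightarrow> 'b::chilbert_space) \<Rightarrow> 'b \<Rightarrow> 'a" where
  "adj T = (THE S. \<forall>x y. cinner (T x) y = cinner x (S y))"

definition orth_proj :: "'a::chilbert_space set \<Rightarrow> 'a \<Rightarrow> 'a" where
  "orth_proj L x = (THE y. y \<in> L \<and> (\<forall>u\<in>L. cinner (x - y) u = 0))"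

definition positive_op :: "('a::chilbert_space \<Rightarrow> 'a) \<Rightarrow> bool" where
  "positive_op T \<longleftrightarrow> T \<in> bounded_ops UNIV UNIV \<and> (\<forall>x. cinner (T x) x \<in> \<real>\<^sub>\<ge>\<^sub>0)"

definition sqrt_op :: "('a::chilbert_space \<Rightarrow> 'a) \<Rightarrow> 'a \<Rightarrow> 'a" where
  "sqrt_op A = (THE B. positive_op B \<and> B \<circ> B = A)"

text \<open>
  For a contraction \<open>T\<close> defined on \<open>L\<close>, the defect operator and the defect space of \<open>T\<close>. For the
  adjoint of \<open>T\<close>, the first argument has to be the target space of \<open>T\<close>.
\<close>

definition defect_op :: "'a::chilbert_space set \<Rightarrow> ('a \<Rightarrow> 'b::chilbert_space) \<Rightarrow> 'a \<Rightarrow> 'a" where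
  "defect_op L T = sqrt_op (\<lambda>x. orth_proj L x - adj T (T x))"

definition defect_space :: "'a::chilbert_space set \<Rightarrow> ('a \<Rightarrow> 'b::chilbert_space) \<Rightarrow> 'a set" where
  "defect_space L T = closure (range (defect_op L T))"

section \<open>The Schur class and Schur parameters\<close>

definition op_holomorphic :: "(complex \<Rightarrow> 'a::chilbert_space \<Rightarrow> 'b::chilbert_space) \<Rightarrow> bool" where
  "op_holomorphic \<Theta> \<longleftrightarrow> (\<forall>z\<in>ball 0 1. \<exists>F\<in>bounded_ops UNIV UNIV.
     ((\<lambda>w. onorm (\<lambda>x. (1 / (w - z)) *\<^sub>C (\<Theta> w x - \<Theta> z x) - F x)) \<longlongrightarrow> 0) (at z))"

text \<open>Functions on the disk are extensional, so that equality in HOL is equality on the disk.\<close>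

definition schur_class ::
    "'a::chilbert_space set \<Rightarrow> 'b::chilbert_space set \<Rightarrow> (complex \<Rightarrow> 'a \<Rightarrow> 'b) set" where
  "schur_class L L' = {\<Theta> \<in> ball 0 1 \<rightarrow>\<^sub>E contractions L L'. op_holomorphic \<Theta>}"

text \<open>
  Inverses of operators on a subspace \<open>V\<close> are written with \<^const>\<open>inv_into\<close> \<open>V\<close>; by the bounded
  inverse theorem a bijective bounded operator on a Hilbert space has a bounded inverse.
\<close>

definition schur_next :: "'a::chilbert_space set \<Rightarrow> 'b::chilbert_space set \<Rightarrow>
    (complex \<Rightarrow> 'a \<Rightarrow> 'b) \<Rightarrow> complex \<Rightarrow> 'a \<Rightarrow> 'b" where
  "schur_next L L' \<Theta> = (let G = \<Theta> 0; D = defect_space L G; D' = defect_space L' (adj G) in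
     (THE \<Psi>. \<Psi> \<in> schur_class D D' \<and>
        (\<forall>z\<in>ball 0 1. \<forall>x. \<Theta> z x = G x + z *\<^sub>C defect_op L' (adj G)
           (\<Psi> z (inv_into D (\<lambda>u. u + z *\<^sub>C adj G (\<Psi> z u)) (defect_op L G x))))))"

primrec schur_fun :: "'a::chilbert_space set \<Rightarrow> 'b::chilbert_space set \<Rightarrow>
    (complex \<Rightarrow> 'a \<Rightarrow> 'b) \<Rightarrow> nat \<Rightarrow> complex \<Rightarrow> 'a \<Rightarrow> 'b" where
  "schur_fun L L' \<Theta> 0 = \<Theta>"
| "schur_fun L L' \<Theta> (Suc k) =
     schur_fun (defect_space L (\<Theta> 0)) (defect_space L' (adj (\<Theta> 0))) (schur_next L L' \<Theta>) k"

definition schur_param :: "'a::chilbert_space set \<Rightarrow> 'b::chilbert_space set \<Rightarrow>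
    (complex \<Rightarrow> 'a \<Rightarrow> 'b) \<Rightarrow> nat \<Rightarrow> 'a \<Rightarrow> 'b" where
  "schur_param L L' \<Theta> k = schur_fun L L' \<Theta> k 0"

section \<open>Choice sequences\<close>

text \<open>
  \<open>dom_space \<Gamma> k\<close> and \<open>cod_space \<Gamma> k\<close> are the spaces between which \<open>\<Gamma> k\<close> acts. The types
  \<open>'m\<close> and \<open>'n\<close> themselves are the spaces between which \<open>\<Gamma> 0\<close> acts.
\<close>

primrec dom_space :: "(nat \<Rightarrow> 'm::chilbert_space \<Rightarrow> 'n::chilbert_space) \<Rightarrow> nat \<Rightarrow> 'm set" where
  "dom_space \<Gamma> 0 = UNIV"
| "dom_space \<Gamma> (Suc k) = defect_space (dom_space \<Gamma> k) (\<Gamma> k)"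

primrec cod_space :: "(nat \<Rightarrow> 'm::chilbert_space \<Rightarrow> 'n::chilbert_space) \<Rightarrow> nat \<Rightarrow> 'n set" where
  "cod_space \<Gamma> 0 = UNIV"
| "cod_space \<Gamma> (Suc k) = defect_space (cod_space \<Gamma> k) (adj (\<Gamma> k))"

definition choice_sequence_upto ::
    "nat \<Rightarrow> (nat \<Rightarrow> 'm::chilbert_space \<Rightarrow> 'n::chilbert_space) \<Rightarrow> bool" where
  "choice_sequence_upto N \<Gamma> \<longleftrightarrow> (\<forall>k\<le>N. \<Gamma> k \<in> contractions (dom_space \<Gamma> k) (cod_space \<Gamma> k))"

definition Dop :: "(nat \<Rightarrow> 'm::chilbert_space \<Rightarrow> 'n::chilbert_space) \<Rightarrow> nat \<Rightarrow> 'm \<Rightarrow> 'm" where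
  "Dop \<Gamma> k = defect_op (dom_space \<Gamma> k) (\<Gamma> k)"

definition Dop_adj :: "(nat \<Rightarrow> 'm::chilbert_space \<Rightarrow> 'n::chilbert_space) \<Rightarrow> nat \<Rightarrow> 'n \<Rightarrow> 'n" where
  "Dop_adj \<Gamma> k = defect_op (cod_space \<Gamma> k) (adj (\<Gamma> k))"

definition Dsp :: "(nat \<Rightarrow> 'm::chilbert_space \<Rightarrow> 'n::chilbert_space) \<Rightarrow> nat \<Rightarrow> 'm set" where
  "Dsp \<Gamma> k = defect_space (dom_space \<Gamma> k) (\<Gamma> k)"

definition Dsp_adj :: "(nat \<Rightarrow> 'm::chilbert_space \<Rightarrow> 'n::chilbert_space) \<Rightarrow> nat \<Rightarrow> 'n set" where
  "Dsp_adj \<Gamma> k = defect_space (cod_space \<Gamma> k) (adj (\<Gamma> k))"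

section \<open>The block operators\<close>

text \<open>The rows of the elementary rotation \<open>J\<close> of \<open>\<Gamma> k\<close>.\<close>

definition row1 :: "(nat \<Rightarrow> 'm::chilbert_space \<Rightarrow> 'n::chilbert_space) \<Rightarrow> nat \<Rightarrow> 'm \<times> 'n \<Rightarrow> 'n" where
  "row1 \<Gamma> k = (\<lambda>(x, y). \<Gamma> k x + Dop_adj \<Gamma> k y)"

definition row2 :: "(nat \<Rightarrow> 'm::chilbert_space \<Rightarrow> 'n::chilbert_space) \<Rightarrow> nat \<Rightarrow> 'm \<times> 'n \<Rightarrow> 'm" where
  "row2 \<Gamma> k = (\<lambda>(x, y). Dop \<Gamma> k x - adj (\<Gamma> k) y)"

definition rotation ::
    "(nat \<Rightarrow> 'm::chilbert_space \<Rightarrow> 'n::chilbert_space) \<Rightarrow> nat \<Rightarrow> 'm \<times> 'n \<Rightarrow> 'n \<times> 'm" where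
  "rotation \<Gamma> k h = (row1 \<Gamma> k h, row2 \<Gamma> k h)"

text \<open>
  Elements of the direct sum over \<open>1 \<le> k \<le> n + 1\<close> are functions on the natural numbers that vanish
  outside \<open>{1..n + 1}\<close>; the component with index \<open>k\<close> is a pair.
\<close>

definition Hsp :: "(nat \<Rightarrow> 'm::chilbert_space \<Rightarrow> 'n::chilbert_space) \<Rightarrow> nat \<Rightarrow> ('m \<times> 'n) set" where
  "Hsp \<Gamma> k = Dsp \<Gamma> (2 * k - 2) \<times> Dsp_adj \<Gamma> (2 * k - 1)"

definition Ksp ::
    "nat \<Rightarrow> (nat \<Rightarrow> 'm::chilbert_space \<Rightarrow> 'n::chilbert_space) \<Rightarrow> (nat \<Rightarrow> 'm \<times> 'n) set" where
  "Ksp n \<Gamma> = {h. (\<forall>k\<in>{1..n + 1}. h k \<in> Hsp \<Gamma> k) \<and> (\<forall>k. k \<notin> {1..n + 1} \<longrightarrow> h k = 0)}"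

definition incl :: "nat \<Rightarrow> 'c::zero \<Rightarrow> nat \<Rightarrow> 'c" where
  "incl k v = (\<lambda>_. 0)(k := v)"

definition Vop :: "nat \<Rightarrow> (nat \<Rightarrow> 'm::chilbert_space \<Rightarrow> 'n::chilbert_space) \<Rightarrow>
    (nat \<Rightarrow> 'm \<times> 'n) \<Rightarrow> nat \<Rightarrow> 'n \<times> 'm" where
  "Vop n \<Gamma> h k = (if k \<in> {1..n + 1} then rotation \<Gamma> (2 * k - 1) (h k) else 0)"

text \<open>
  The direct sum of \<open>- adj (\<Gamma> 0)\<close>, of the rotations of \<open>\<Gamma> (2 * k)\<close> for \<open>1 \<le> k \<le> n\<close>, and of \<open>0\<close>
  refers to a regrouping of the summands that is shifted by one place: the rotation of \<open>\<Gamma> (2 * k)\<close>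
  acts on the second component of the \<open>k\<close>-th pair and the first component of the \<open>(k + 1)\<close>-st pair,
  and its values occupy the same two places.
\<close>

definition Wop :: "nat \<Rightarrow> (nat \<Rightarrow> 'm::chilbert_space \<Rightarrow> 'n::chilbert_space) \<Rightarrow>
    (nat \<Rightarrow> 'n \<times> 'm) \<Rightarrow> nat \<Rightarrow> 'm \<times> 'n" where
  "Wop n \<Gamma> g k = (if k \<in> {1..n + 1} then
      (if k = 1 then - adj (\<Gamma> 0) (fst (g 1))
       else snd (rotation \<Gamma> (2 * (k - 1)) (snd (g (k - 1)), fst (g k))),
       if k = n + 1 then 0
       else fst (rotation \<Gamma> (2 * k) (snd (g k), fst (g (k + 1)))))
     else 0)"

definition Sop :: "nat \<Rightarrow> (nat \<Rightarrow> 'm::chilbert_space \<Rightarrow> 'n::chilbert_space) \<Rightarrow>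
    (nat \<Rightarrow> 'm \<times> 'n) \<Rightarrow> nat \<Rightarrow> 'm \<times> 'n" where
  "Sop n \<Gamma> h = Wop n \<Gamma> (Vop n \<Gamma> h)"

definition id_minus_zS :: "nat \<Rightarrow> (nat \<Rightarrow> 'm::chilbert_space \<Rightarrow> 'n::chilbert_space) \<Rightarrow> complex \<Rightarrow>
    (nat \<Rightarrow> 'm \<times> 'n) \<Rightarrow> nat \<Rightarrow> 'm \<times> 'n" where
  "id_minus_zS n \<Gamma> z h = (\<lambda>k. h k - z *\<^sub>C Sop n \<Gamma> h k)"

definition resolvent :: "nat \<Rightarrow> (nat \<Rightarrow> 'm::chilbert_space \<Rightarrow> 'n::chilbert_space) \<Rightarrow> complex \<Rightarrow>
    (nat \<Rightarrow> 'm \<times> 'n) \<Rightarrow> nat \<Rightarrow> 'm \<times> 'n" where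
  "resolvent n \<Gamma> z = inv_into (Ksp n \<Gamma>) (id_minus_zS n \<Gamma> z)"

text \<open>
  The defect space of \<open>\<Gamma> 0\<close> is the first summand of component \<open>1\<close>, that of
  \<open>adj (\<Gamma> (2 * n + 1))\<close> is the second summand of component \<open>n + 1\<close>.
\<close>

definition Theta0 :: "nat \<Rightarrow> (nat \<Rightarrow> 'm::chilbert_space \<Rightarrow> 'n::chilbert_space) \<Rightarrow> complex \<Rightarrow>
    'm \<Rightarrow> 'n" where
  "Theta0 n \<Gamma> z x = \<Gamma> 0 x +
     z *\<^sub>C Dop_adj \<Gamma> 0 (row1 \<Gamma> 1 (resolvent n \<Gamma> z (incl 1 (Dop \<Gamma> 0 x, 0)) 1))"

definition Aop :: "nat \<Rightarrow> (nat \<Rightarrow> 'm::chilbert_space \<Rightarrow> 'n::chilbert_space) \<Rightarrow> complex \<Rightarrow>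
    'n \<Rightarrow> 'm" where
  "Aop n \<Gamma> z y = z *\<^sub>C row2 \<Gamma> (2 * n + 1) (resolvent n \<Gamma> z (incl (n + 1) (0, y)) (n + 1))"

definition Bop :: "nat \<Rightarrow> (nat \<Rightarrow> 'm::chilbert_space \<Rightarrow> 'n::chilbert_space) \<Rightarrow> complex \<Rightarrow>
    'm \<Rightarrow> 'm" where
  "Bop n \<Gamma> z x = z *\<^sub>C row2 \<Gamma> (2 * n + 1) (resolvent n \<Gamma> z (incl 1 (Dop \<Gamma> 0 x, 0)) (n + 1))"

definition Cop :: "nat \<Rightarrow> (nat \<Rightarrow> 'm::chilbert_space \<Rightarrow> 'n::chilbert_space) \<Rightarrow> complex \<Rightarrow>
    'n \<Rightarrow> 'n" where
  "Cop n \<Gamma> z y = z *\<^sub>C Dop_adj \<Gamma> 0 (row1 \<Gamma> 1 (resolvent n \<Gamma> z (incl (n + 1) (0, y)) 1))"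

end

(*
  The Schur step Psi |-> Gamma_k + z D' Psi (I + z Gamma_k^* Psi)^-1 D is a bijection from the Schur
  class of the defect spaces of Gamma_k onto the Schur functions with value Gamma_k at 0, so 2n+2
  steps give a bijection onto the Schur functions with the prescribed parameters, and the remaining
  parameters are those of the innermost function. Unwinding the steps at a fixed point z yields a
  chain of elementary rotations linked by z; after rescaling by powers of z it is the equation
  (I - z S) h = f for the block operator S, which identifies the iterated step with the
  linear-fractional formula.

  Surjectivity of one step: the Schwarz lemma applies once Theta(z) - Theta(0) = D' X(z) D with X
  bounded. For r Theta, r < 1, the defect operators are bounded below and X exists trivially; the
  Schwarz lemma then gives |X(z)| <= |z| / (1 - |z|), independently of r, so that X exists
  for Theta itself.
*)
theory Submission
  imports Defs "HOL-Complex_Analysis.Conformal_Mappings"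
begin

section \<open>Inner products\<close>

text \<open>The obstacle is that the range of a defect operator need not be closed, so D and D' have
  no bounded inverses and X cannot be obtained by dividing. It is produced instead by a Riesz
  argument from a bound on the sesquilinear form of \<Theta>(z) - T, T = \<Theta>(0), and equations
  are cancelled only through injectivity on the defect spaces. The bound independent of r arises as
  follows. If \<Theta>(z) - T = D' X D, the rotation of T makes Y = X (I - adj T X)^-1 a
  contraction, whatever the size of X. As Y(0) = 0, the Schwarz lemma gives |Y(z)| <= |z|, and X = Y
  (I - adj T X) turns this into |X| <= |z| (1 + |X|). Invertibility of I - adj T X is not
  perturbative, since X may be large; it uses the same estimate once more for the adjoints. The
  block operator is controlled by the energy balance of its rotations: S is a contraction, so R(z)
  exists, and the energy that S loses at its last place gives |A(z)| <= |z|, so that the inverse in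
  the formula exists as well.\<close>

lemma norm_scaleC: "norm (c *\<^sub>C x) = cmod c * norm (x::'a::chilbert_space)"
proof -
  have "complex_of_real ((norm (c *\<^sub>C x))\<^sup>2) = cinner (c *\<^sub>C x) (c *\<^sub>C x)"
    by (simp add: cinner_self_eq_norm)
  also have "\<dots> = c * cnj (c * cinner x x)"
    by (metis cinner_commute cinner_scaleC_left)
  also have "\<dots> = complex_of_real ((cmod c * norm x)\<^sup>2)"
    by (simp add: cinner_self_eq_norm power_mult_distrib complex_norm_square flip: of_real_power)
  finally have "(norm (c *\<^sub>C x))\<^sup>2 = (cmod c * norm x)\<^sup>2"
    using of_real_eq_iff by blast
  then show ?thesis
    by (metis mult_nonneg_nonneg norm_ge_zero power2_eq_imp_eq)
qed

lemma cinner_add_right: "cinner x (y + z) = cinner x y + cinner x (z::'a::chilbert_space)"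
  by (metis cinner_add_left cinner_commute complex_cnj_add)

lemma cinner_scaleC_right: "cinner x (c *\<^sub>C y) = cnj c * cinner x (y::'a::chilbert_space)"
  by (metis cinner_commute cinner_scaleC_left complex_cnj_mult)

lemma scaleR_scaleC: "r *\<^sub>R x = complex_of_real r *\<^sub>C (x::'a::chilbert_space)"
  by (simp add: scaleC_of_real)

lemma scaleC_one [simp]: "1 *\<^sub>C x = (x::'a::chilbert_space)"
  using scaleC_of_real[of 1 x] by simp

lemma Re_cinner_self: "Re (cinner x x) = (norm (x::'a::chilbert_space))\<^sup>2"
  by (simp add: cinner_self_eq_norm)

lemma norm_add_sq: "(norm (x + y))\<^sup>2 = (norm x)\<^sup>2 + 2 * Re (cinner x y) + (norm (y::'a::chilbert_space))\<^sup>2"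
proof -
  have "Re (cinner y x) = Re (cinner x y)"
    by (metis cinner_commute cnj.simps(1))
  then show ?thesis
    by (simp add: Re_cinner_self[symmetric] cinner_add_left cinner_add_right)
qed

lemma cauchy_schwarz: "cmod (cinner x y) \<le> norm x * norm (y::'a::chilbert_space)"
proof (cases "y = 0")
  case True
  then have "cinner x y = 0"
    by (metis add_cancel_left_left cinner_add_right)
  then show ?thesis by simp
next
  case False
  \<comment> \<open>The minimiser of \<open>norm (x + c *\<^sub>C y)\<close> over complex
    \<open>c\<close>.\<close>
  define c where "c = - cinner x y / complex_of_real ((norm y)\<^sup>2)"
  have "0 \<le> (norm (x + c *\<^sub>C y))\<^sup>2" by simp
  also have "\<dots> = (norm x)\<^sup>2 + 2 * Re (cnj c * cinner x y) + (cmod c * norm y)\<^sup>2"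
    by (simp add: norm_add_sq cinner_scaleC_right norm_scaleC)
  also have "cnj c * cinner x y = - complex_of_real ((cmod (cinner x y))\<^sup>2 / (norm y)\<^sup>2)"
    using complex_norm_square[of "cinner x y"] by (simp add: c_def mult.commute)
  also have "(cmod c * norm y)\<^sup>2 = (cmod (cinner x y))\<^sup>2 / (norm y)\<^sup>2"
    using False by (simp add: c_def norm_divide norm_power power_mult_distrib power_divide)
      (simp add: field_simps power2_eq_square power4_eq_xxxx)
  finally have "(cmod (cinner x y))\<^sup>2 / (norm y)\<^sup>2 \<le> (norm x)\<^sup>2"
    by simp
  then have "(cmod (cinner x y))\<^sup>2 \<le> (norm x * norm y)\<^sup>2"
    using False by (simp add: field_simps power_mult_distrib)
  then show ?thesis
    by (rule power2_le_imp_le) simp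
qed

lemma bounded_bilinear_cinner: "bounded_bilinear (cinner :: 'a::chilbert_space \<Rightarrow> 'a \<Rightarrow> complex)"
proof
  show "\<exists>K. \<forall>a b::'a. cmod (cinner a b) \<le> norm a * norm b * K"
    by (rule exI[of _ 1]) (simp add: cauchy_schwarz)
qed (simp_all add: cinner_add_left cinner_add_right cinner_scaleC_left cinner_scaleC_right
    scaleR_conv_of_real flip: scaleC_of_real[where 'a='a])

lemma bounded_bilinear_scaleC: "bounded_bilinear (scaleC :: complex \<Rightarrow> 'a::chilbert_space \<Rightarrow> 'a)"
proof
  show "\<exists>K. \<forall>a (b::'a). norm (a *\<^sub>C b) \<le> norm a * norm b * K"
    by (rule exI[of _ 1]) (simp add: norm_scaleC)
qed (simp_all add: scaleC_add_right scaleC_add_left scaleC_scaleC scaleR_conv_of_real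
    mult.commute flip: scaleC_of_real[where 'a='a])

interpretation cinner: bounded_bilinear "cinner :: 'a::chilbert_space \<Rightarrow> 'a \<Rightarrow> complex"
  by (rule bounded_bilinear_cinner)

interpretation scaleC: bounded_bilinear "scaleC :: complex \<Rightarrow> 'a::chilbert_space \<Rightarrow> 'a"
  by (rule bounded_bilinear_scaleC)

lemmas cinner_simps [simp] = cinner.add_left cinner.add_right cinner.diff_left cinner.diff_right
  cinner.zero_left cinner.zero_right cinner.minus_left cinner.minus_right cinner_scaleC_left
  cinner_scaleC_right scaleC.zero_left scaleC.zero_right

lemma norm_diff_sq: "(norm (x - y))\<^sup>2 = (norm x)\<^sup>2 - 2 * Re (cinner x y) + (norm (y::'a::chilbert_space))\<^sup>2"
  using norm_add_sq[of x "- y"] by simp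

lemma cinner_self_zero: "cinner x x = 0 \<longleftrightarrow> x = (0::'a::chilbert_space)"
  by (simp add: cinner_self_eq_norm)

lemma cinner_ext: "(\<And>y. cinner x y = cinner x' y) \<Longrightarrow> x = (x'::'a::chilbert_space)"
  using cinner_self_zero[of "x - x'"] by simp

lemma cinner_zero_sym: "cinner x y = 0 \<Longrightarrow> cinner y x = (0::complex)"
  by (metis cinner_commute complex_cnj_zero)

lemma norm_le_cinner:
  assumes "\<And>y. cmod (cinner x y) \<le> K * norm y" "0 \<le> K"
  shows "norm (x::'a::chilbert_space) \<le> K"
proof (cases "x = 0")
  case False
  have "(norm x)\<^sup>2 \<le> K * norm x"
    using assms(1)[of x] by (simp add: cinner_self_eq_norm norm_power)
  then show ?thesis using False by (simp add: power2_eq_square)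
qed (use assms in simp)

section \<open>Closed complex subspaces\<close>

definition csub :: "'a::chilbert_space set \<Rightarrow> bool" where
  "csub L \<longleftrightarrow> closed L \<and> 0 \<in> L \<and> (\<forall>x\<in>L. \<forall>y\<in>L. x + y \<in> L) \<and> (\<forall>c. \<forall>x\<in>L. c *\<^sub>C x \<in> L)"

lemma csub_closed: "csub L \<Longrightarrow> closed L"
  and csub_0: "csub L \<Longrightarrow> 0 \<in> L"
  and csub_add: "csub L \<Longrightarrow> x \<in> L \<Longrightarrow> y \<in> L \<Longrightarrow> x + y \<in> L"
  and csub_scaleC: "csub L \<Longrightarrow> x \<in> L \<Longrightarrow> c *\<^sub>C x \<in> L"
  by (auto simp: csub_def)

lemma csub_uminus: "csub L \<Longrightarrow> x \<in> L \<Longrightarrow> - x \<in> L"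
  using csub_scaleC[of L x "-1"] by (simp add: scaleC.minus_left)

lemma csub_diff: "csub L \<Longrightarrow> x \<in> L \<Longrightarrow> y \<in> L \<Longrightarrow> x - y \<in> L"
  using csub_add[of L x "-y"] by (simp add: csub_uminus)

lemma csub_UNIV: "csub UNIV"
  by (simp add: csub_def)

lemma csub_lim: "csub L \<Longrightarrow> (\<And>n. f n \<in> L) \<Longrightarrow> f \<longlonglongrightarrow> x \<Longrightarrow> x \<in> L"
  by (meson csub_closed closed_sequentially)

section \<open>The Riesz representation theorem\<close>

text \<open>The representing vector is the limit of \<open>D y\<^sub>n\<close> along a minimising sequence of
  \<open>\<parallel>D y\<parallel>\<^sup>2 - 2 Re f y\<close>; the subspace \<open>D ` S\<close> need not be closed and \<open>D\<close> need not be injective.\<close>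

lemma riesz_factor:
  fixes D :: "'a::chilbert_space \<Rightarrow> 'b::chilbert_space" and f :: "'a \<Rightarrow> complex"
  assumes S: "0 \<in> S" "\<And>x y. x \<in> S \<Longrightarrow> y \<in> S \<Longrightarrow> x + y \<in> S" "\<And>c x. x \<in> S \<Longrightarrow> c *\<^sub>C x \<in> S"
    and D: "\<And>x y. x \<in> S \<Longrightarrow> y \<in> S \<Longrightarrow> D (x + y) = D x + D y"
      "\<And>c x. x \<in> S \<Longrightarrow> D (c *\<^sub>C x) = c *\<^sub>C D x"
    and f: "\<And>x y. x \<in> S \<Longrightarrow> y \<in> S \<Longrightarrow> f (x + y) = f x + f y"
      "\<And>c x. x \<in> S \<Longrightarrow> f (c *\<^sub>C x) = c * f x"
    and K: "0 \<le> K" "\<And>y. y \<in> S \<Longrightarrow> cmod (f y) \<le> K * norm (D y)"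
  shows "\<exists>v\<in>closure (D ` S). norm v \<le> K \<and> (\<forall>y\<in>S. f y = cinner (D y) v)"
proof -
  define J where "J y = (norm (D y))\<^sup>2 - 2 * Re (f y)" for y
  have J_below: "- K\<^sup>2 \<le> J y" if "y \<in> S" for y
  proof -
    have "Re (f y) \<le> K * norm (D y)"
      using K(2)[OF that] complex_Re_le_cmod[of "f y"] by linarith
    moreover have "0 \<le> (norm (D y) - K)\<^sup>2" by simp
    ultimately show ?thesis
      by (simp add: J_def power2_diff mult.commute)
  qed
  define m where "m = (INF y\<in>S. J y)"
  have bdd: "bdd_below (J ` S)" using J_below by (meson bdd_belowI2)
  have m_le: "m \<le> J y" if "y \<in> S" for y
    unfolding m_def using bdd that by (rule cINF_lower)
  have "\<exists>y\<in>S. J y < m + inverse (real (Suc n))" for n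
  proof (rule ccontr)
    assume "\<not> ?thesis"
    then have "m + inverse (real (Suc n)) \<le> m"
      unfolding m_def using S(1) by (intro cINF_greatest) (auto simp: not_less)
    then show False by (metis add_le_same_cancel1 inverse_positive_iff_positive not_le of_nat_0_less_iff zero_less_Suc)
  qed
  then obtain s where s: "\<And>n. s n \<in> S" "\<And>n. J (s n) < m + inverse (real (Suc n))"
    by metis
  have expand: "J (y + c *\<^sub>C x) = J y + 2 * Re (cnj c * cinner (D y) (D x) - c * f x) + (cmod c)\<^sup>2 * (norm (D x))\<^sup>2"
    if "x \<in> S" "y \<in> S" for x y c
    using that by (simp add: J_def D f S norm_add_sq norm_scaleC power_mult_distrib algebra_simps)
  \<comment> \<open>\<open>m\<close> is below \<open>J\<close> at the midpoint of \<open>s i\<close>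
    and \<open>s j\<close>; the parallelogram law then bounds the distance of their images under
    \<open>D\<close>. Nothing is claimed about convergence of \<open>s\<close> itself.\<close>
  have close: "(norm (D (s i) - D (s j)))\<^sup>2 \<le> 2 * inverse (real (Suc i)) + 2 * inverse (real (Suc j))" for i j
  proof -
    let ?h = "complex_of_real (1/2)"
    have "m \<le> J (?h *\<^sub>C (s i + s j))" using s S by (intro m_le) auto
    also have "J (?h *\<^sub>C (s i + s j)) = (norm (D (s i) + D (s j)))\<^sup>2 / 4 - Re (f (s i) + f (s j))"
      using s S by (simp only: J_def D f S norm_scaleC) (simp add: power_divide algebra_simps)
    finally have "4 * m \<le> (norm (D (s i) + D (s j)))\<^sup>2 - 4 * Re (f (s i) + f (s j))" by simp
    moreover have "(norm (D (s i) + D (s j)))\<^sup>2 + (norm (D (s i) - D (s j)))\<^sup>2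
        = 2 * (norm (D (s i)))\<^sup>2 + 2 * (norm (D (s j)))\<^sup>2"
      by (simp add: norm_add_sq norm_diff_sq)
    ultimately show ?thesis
      using s(2)[of i] s(2)[of j] unfolding J_def by simp
  qed
  have "Cauchy (\<lambda>n. D (s n))"
  proof (rule CauchyI)
    fix e :: real assume "0 < e"
    then obtain N where N: "inverse (real (Suc N)) < e\<^sup>2 / 4"
      using reals_Archimedean[of "e\<^sup>2 / 4"] by auto
    have "norm (D (s i) - D (s j)) < e" if "N \<le> i" "N \<le> j" for i j
    proof -
      have "inverse (real (Suc i)) \<le> inverse (real (Suc N))" "inverse (real (Suc j)) \<le> inverse (real (Suc N))"
        using that by (auto intro!: le_imp_inverse_le)
      then have "(norm (D (s i) - D (s j)))\<^sup>2 < e\<^sup>2"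
        using close[of i j] N by linarith
      then show ?thesis using \<open>0 < e\<close> by (simp add: power2_less_imp_less)
    qed
    then show "\<exists>M. \<forall>i\<ge>M. \<forall>j\<ge>M. norm (D (s i) - D (s j)) < e" by blast
  qed
  then obtain v where v: "(\<lambda>n. D (s n)) \<longlonglongrightarrow> v"
    using Cauchy_convergent convergent_def by blast
  have "v \<in> closure (D ` S)"
    using v s(1) by (meson closure_sequential imageI)
  moreover have rep: "f y = cinner (D y) v" if y: "y \<in> S" for y
  proof -
    \<comment> \<open>First-order optimality in the direction \<open>c *\<^sub>C y\<close>. It is
      derived along the sequence and passed to the limit, since \<open>v\<close> need not lie in the
      image of \<open>D\<close>, so that \<open>J\<close> cannot be evaluated at a
      minimiser.\<close>
    have ineq: "0 \<le> 2 * Re (cnj c * cinner v (D y) - c * f y) + (cmod c)\<^sup>2 * (norm (D y))\<^sup>2" for c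
    proof -
      have "- inverse (real (Suc n)) \<le> 2 * Re (cnj c * cinner (D (s n)) (D y) - c * f y) + (cmod c)\<^sup>2 * (norm (D y))\<^sup>2" for n
      proof -
        have "m \<le> J (s n + c *\<^sub>C y)" by (intro m_le S s y)
        then show ?thesis using s(2)[of n] expand[OF y s(1), of n c] by linarith
      qed
      moreover have "(\<lambda>n. 2 * Re (cnj c * cinner (D (s n)) (D y) - c * f y) + (cmod c)\<^sup>2 * (norm (D y))\<^sup>2)
          \<longlonglongrightarrow> 2 * Re (cnj c * cinner v (D y) - c * f y) + (cmod c)\<^sup>2 * (norm (D y))\<^sup>2"
        by (intro tendsto_intros cinner.tendsto v)
      moreover have "(\<lambda>n. - inverse (real (Suc n))) \<longlonglongrightarrow> 0"
        using tendsto_minus[OF LIMSEQ_inverse_real_of_nat] by simp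
      ultimately show ?thesis by (meson LIMSEQ_le)
    qed
    define w where "w = cinner (D y) v - f y"
    define M where "M = (norm (D y))\<^sup>2"
    have real_part: "0 \<le> 2 * Re (c * w) + (cmod c)\<^sup>2 * M" for c
    proof -
      have "cnj c * cinner v (D y) = cnj (c * cinner (D y) v)"
        by (metis cinner_commute complex_cnj_mult)
      then have "Re (cnj c * cinner v (D y)) = Re (c * cinner (D y) v)" by (metis cnj.simps(1))
      moreover have "c * w = c * cinner (D y) v - c * f y" by (simp add: w_def algebra_simps)
      ultimately have "Re (cnj c * cinner v (D y) - c * f y) = Re (c * w)" by simp
      then show ?thesis using ineq[of c] by (simp add: M_def)
    qed
    have "w = 0"
    proof (rule ccontr)
      assume "w \<noteq> 0"
      have M0: "0 \<le> M" by (simp add: M_def)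
      \<comment> \<open>With \<open>t * M < 1\<close> and \<open>c = - t * cnj w\<close> the linear
        term dominates the quadratic one in \<open>real_part\<close>, whose right-hand side is then
        negative unless \<open>w = 0\<close>.\<close>
      define t where "t = 1 / (M + 1)"
      have t: "t > 0" "t * M < 1" using M0 by (auto simp: t_def)
      have "0 \<le> 2 * Re ((- complex_of_real t * cnj w) * w) + (cmod (- complex_of_real t * cnj w))\<^sup>2 * M"
        by (rule real_part)
      also have "(- complex_of_real t * cnj w) * w = - complex_of_real (t * (cmod w)\<^sup>2)"
        using complex_norm_square[of w] by (simp add: mult.commute)
      also have "(cmod (- complex_of_real t * cnj w))\<^sup>2 = t\<^sup>2 * (cmod w)\<^sup>2"
        by (simp add: norm_mult power_mult_distrib)
      finally have "2 * (t * (cmod w)\<^sup>2) \<le> t\<^sup>2 * (cmod w)\<^sup>2 * M" by simp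
      also have "\<dots> = (t * (cmod w)\<^sup>2) * (t * M)" by (simp add: power2_eq_square)
      finally have "2 \<le> t * M" using t \<open>w \<noteq> 0\<close> by simp
      then show False using t by simp
    qed
    then show ?thesis by (simp add: w_def)
  qed
  moreover have "norm v \<le> K"
  proof -
    have "cmod (cinner (D (s n)) v) \<le> K * norm (D (s n))" for n
      using K(2)[OF s(1)] rep[OF s(1)] by metis
    moreover have "(\<lambda>n. cmod (cinner (D (s n)) v)) \<longlonglongrightarrow> cmod (cinner v v)"
      by (intro tendsto_intros cinner.tendsto v)
    moreover have "(\<lambda>n. K * norm (D (s n))) \<longlonglongrightarrow> K * norm v"
      by (intro tendsto_intros v)
    ultimately have "cmod (cinner v v) \<le> K * norm v" by (meson LIMSEQ_le)
    then have "norm v * norm v \<le> K * norm v"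
      by (simp add: cinner_self_eq_norm norm_power power2_eq_square norm_mult)
    then show ?thesis using K(1) by (cases "v = 0") auto
  qed
  ultimately show ?thesis by blast
qed

section \<open>Bounded operators, adjoints and projections\<close>

abbreviation bop :: "('a::chilbert_space \<Rightarrow> 'b::chilbert_space) \<Rightarrow> bool" where
  "bop T \<equiv> T \<in> bounded_ops UNIV UNIV"

text \<open>For \<open>L = UNIV\<close> the vanishing clause of \<open>bounded_ops\<close> only
  concerns vectors orthogonal to everything, that is \<open>0\<close>.\<close>

lemma bop_iff: "bop T \<longleftrightarrow> bounded_linear T \<and> (\<forall>c x. T (c *\<^sub>C x) = c *\<^sub>C T x)"
proof -
  have "T x = 0" if "bounded_linear T" "\<forall>u. cinner x u = 0" for x
    using that by (metis cinner_self_zero bounded_linear.linear linear_0)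
  then show ?thesis by (auto simp: bounded_ops_def)
qed

lemma bopI:
  assumes "\<And>x y. T (x + y) = T x + T y" "\<And>c x. T (c *\<^sub>C x) = c *\<^sub>C T x" "\<And>x. norm (T x) \<le> K * norm x"
  shows "bop T"
  unfolding bop_iff
proof
  show "bounded_linear T"
    by (rule bounded_linear_intro[where K = K]) (use assms in \<open>auto simp: scaleR_scaleC mult.commute\<close>)
qed (use assms in auto)

lemma bop_bl: "bop T \<Longrightarrow> bounded_linear T"
  by (simp add: bop_iff)

lemma bop_add: "bop T \<Longrightarrow> T (x + y) = T x + T y"
  and bop_diff: "bop T \<Longrightarrow> T (x - y) = T x - T y"
  and bop_0: "bop T \<Longrightarrow> T 0 = 0"
  and bop_scaleC: "bop T \<Longrightarrow> T (c *\<^sub>C x) = c *\<^sub>C T x"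
  using bop_bl[of T] by (auto simp: bop_iff linear_add linear_diff linear_neg linear_0 bounded_linear.linear)

lemma bop_tendsto: "bop T \<Longrightarrow> (f \<longlongrightarrow> a) F \<Longrightarrow> ((\<lambda>w. T (f w)) \<longlongrightarrow> T a) F"
  using bop_bl bounded_linear.tendsto by blast

lemma bop_bound: "bop T \<Longrightarrow> \<exists>K\<ge>0. \<forall>x. norm (T x) \<le> K * norm x"
  by (metis bop_bl bounded_linear.nonneg_bounded mult.commute)

lemma bop_compose: "bop S \<Longrightarrow> bop T \<Longrightarrow> bop (\<lambda>x. S (T x))"
  by (auto simp: bop_iff bounded_linear_compose)

lemma bop_sum: "bop S \<Longrightarrow> bop T \<Longrightarrow> bop (\<lambda>x. S x + T x)"
  by (auto simp: bop_iff bounded_linear_add scaleC_add_right)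

lemma bop_difference: "bop S \<Longrightarrow> bop T \<Longrightarrow> bop (\<lambda>x. S x - T x)"
  by (auto simp: bop_iff bounded_linear_sub scaleC.diff_right)

lemma bop_scale: "bop T \<Longrightarrow> bop (\<lambda>x. c *\<^sub>C T x)"
  by (auto simp: bop_iff bounded_linear_compose[OF scaleC.bounded_linear_right] scaleC_scaleC mult.commute)

lemma bop_ident: "bop (\<lambda>x. x)"
  by (simp add: bop_iff)

lemma bop_zero: "bop (\<lambda>x. 0)"
  by (simp add: bop_iff)

lemma bop_sub_closed: "bop T \<Longrightarrow> csub L \<Longrightarrow> (\<And>x. x \<in> M \<Longrightarrow> T x \<in> L) \<Longrightarrow> x \<in> closure M \<Longrightarrow> T x \<in> L"
proof -
  assume T: "bop T" and L: "csub L" and M: "\<And>x. x \<in> M \<Longrightarrow> T x \<in> L" and "x \<in> closure M"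
  then obtain f where "\<And>n. f n \<in> M" "f \<longlonglongrightarrow> x" by (auto simp: closure_sequential)
  then show ?thesis using csub_lim[OF L, of "\<lambda>n. T (f n)"] M bop_tendsto[OF T] by blast
qed

lemma csub_closure_range:
  assumes T: "bop T"
  shows "csub (closure (range T))"
  unfolding csub_def
proof (intro conjI ballI allI)
  show "0 \<in> closure (range T)"
    using bop_0[OF T] closure_subset by (metis rangeI subsetD)
  fix x y assume "x \<in> closure (range T)" "y \<in> closure (range T)"
  then obtain f g where f: "\<And>n. f n \<in> range T" "f \<longlonglongrightarrow> x" and g: "\<And>n. g n \<in> range T" "g \<longlonglongrightarrow> y"
    by (auto simp: closure_sequential)
  have "f n + g n \<in> range T" for n
    using f(1)[of n] g(1)[of n] by (auto simp flip: bop_add[OF T])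
  then show "x + y \<in> closure (range T)"
    using tendsto_add[OF f(2) g(2)]
    by (intro iffD2[OF closure_sequential] exI[of _ "\<lambda>n. f n + g n"]) auto
next
  fix c x assume "x \<in> closure (range T)"
  then obtain f where f: "\<And>n. f n \<in> range T" "f \<longlonglongrightarrow> x"
    by (auto simp: closure_sequential)
  have "c *\<^sub>C f n \<in> range T" for n
    using f(1)[of n] by (auto simp flip: bop_scaleC[OF T])
  moreover have "(\<lambda>n. c *\<^sub>C f n) \<longlonglongrightarrow> c *\<^sub>C x" by (intro scaleC.tendsto f tendsto_const)
  ultimately show "c *\<^sub>C x \<in> closure (range T)"
    by (intro iffD2[OF closure_sequential] exI[of _ "\<lambda>n. c *\<^sub>C f n"]) auto
qed simp

lemma adj_ex:
  assumes T: "bop T"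
  shows "\<exists>S. \<forall>x y. cinner (T x) y = cinner x (S y)"
proof -
  obtain K where K: "0 \<le> K" "\<And>x. norm (T x) \<le> K * norm x" using bop_bound[OF T] by blast
  have "\<exists>v\<in>closure ((\<lambda>x. x) ` UNIV). norm v \<le> K * norm y \<and> (\<forall>x\<in>UNIV. cinner (T x) y = cinner x v)" for y
  proof (rule riesz_factor)
    fix x
    show "cmod (cinner (T x) y) \<le> (K * norm y) * norm x"
      using cauchy_schwarz[of "T x" y] mult_right_mono[OF K(2)[of x], of "norm y"]
      by (simp add: mult_ac)
  qed (use K in \<open>auto simp: bop_add[OF T] bop_scaleC[OF T]\<close>)
  then show ?thesis by (simp del: closure_UNIV) metis
qed

text \<open>Existence comes from the Riesz lemma, uniqueness from nondegeneracy of the inner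
  product. This discharges the definite description in \<open>adj\<close>; every later fact about
  adjoints rests on this identity.\<close>

lemma cinner_adj: "bop T \<Longrightarrow> cinner (T x) y = cinner x (adj T y)"
proof -
  assume T: "bop T"
  have "\<exists>!S. \<forall>x y. cinner (T x) y = cinner x (S y)"
  proof (rule ex_ex1I[OF adj_ex[OF T]])
    fix S S' assume "\<forall>x y. cinner (T x) y = cinner x (S y)" "\<forall>x y. cinner (T x) y = cinner x (S' y)"
    then have "cinner x (S y) = cinner x (S' y)" for x y by metis
    then have "cinner (S y) x = cinner (S' y) x" for x y by (metis cinner_commute)
    then show "S = S'" using cinner_ext by blast
  qed
  from theI'[OF this] show ?thesis unfolding adj_def by blast
qed

lemma cinner_adj': "bop T \<Longrightarrow> cinner (adj T y) x = cinner y (T x)"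
  by (metis cinner_adj cinner_commute)

lemma adj_eqI:
  assumes "bop T" "\<And>x y. cinner (T x) y = cinner x (S y)"
  shows "adj T = S"
proof
  fix y
  have "cinner (adj T y) x = cinner (S y) x" for x
    by (metis assms cinner_adj cinner_commute)
  then show "adj T y = S y" by (rule cinner_ext)
qed

lemma adj_bound:
  assumes T: "bop T" and K: "0 \<le> K" "\<And>x. norm (T x) \<le> K * norm x"
  shows "norm (adj T y) \<le> K * norm y"
proof (rule norm_le_cinner)
  fix x
  have "cmod (cinner (adj T y) x) \<le> norm y * norm (T x)"
    by (simp add: cinner_adj'[OF T] cauchy_schwarz)
  also have "\<dots> \<le> norm y * (K * norm x)" by (intro mult_left_mono K) auto
  finally show "cmod (cinner (adj T y) x) \<le> K * norm y * norm x" by (simp add: mult_ac)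
qed (use K in auto)

lemma bop_adj: assumes T: "bop T" shows "bop (adj T)"
proof -
  obtain K where K: "0 \<le> K" "\<And>x. norm (T x) \<le> K * norm x" using bop_bound[OF T] by blast
  show ?thesis
  proof (rule bopI)
    show "adj T (x + y) = adj T x + adj T y" for x y
      by (rule cinner_ext) (simp add: cinner_adj'[OF T])
    show "adj T (c *\<^sub>C x) = c *\<^sub>C adj T x" for c x
      by (rule cinner_ext) (simp add: cinner_adj'[OF T])
  qed (rule adj_bound[OF T K])
qed

lemma adj_adj: "bop T \<Longrightarrow> adj (adj T) = T"
  by (rule adj_eqI[OF bop_adj]) (auto simp: cinner_adj')

text \<open>The Riesz lemma on \<open>S = L\<close> with \<open>D\<close> the identity, for the
  functional \<open>cinner y x\<close> of \<open>y\<close>: the representing vector lies in the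
  closure of \<open>L\<close>, hence in \<open>L\<close>.\<close>

lemma orth_proj_ex:
  assumes L: "csub L"
  shows "\<exists>y\<in>L. \<forall>u\<in>L. cinner (x - y) u = 0"
proof -
  have "\<exists>v\<in>closure ((\<lambda>x. x) ` L). norm v \<le> norm x \<and> (\<forall>y\<in>L. cinner y x = cinner y v)"
    by (rule riesz_factor)
      (use L cauchy_schwarz in \<open>auto simp: csub_add csub_scaleC csub_0 mult.commute\<close>)
  then obtain v where v: "v \<in> L" "\<forall>y\<in>L. cinner y x = cinner y v"
    using L by (auto simp: csub_closed)
  then have "cinner (x - v) u = 0" if "u \<in> L" for u
    using that by (metis cinner_commute cinner.diff_left right_minus_eq)
  then show ?thesis using v by blast
qed

lemma orth_proj:
  assumes L: "csub L"
  shows "orth_proj L x \<in> L" "\<And>u. u \<in> L \<Longrightarrow> cinner (x - orth_proj L x) u = 0"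
proof -
  have "\<exists>!y. y \<in> L \<and> (\<forall>u\<in>L. cinner (x - y) u = 0)"
  proof (rule ex_ex1I)
    show "\<exists>y. y \<in> L \<and> (\<forall>u\<in>L. cinner (x - y) u = 0)" using orth_proj_ex[OF L] by blast
    fix y y' assume y: "y \<in> L \<and> (\<forall>u\<in>L. cinner (x - y) u = 0)" and y': "y' \<in> L \<and> (\<forall>u\<in>L. cinner (x - y') u = 0)"
    have "y - y' \<in> L" using y y' csub_diff[OF L] by blast
    then have "cinner (x - y') (y - y') - cinner (x - y) (y - y') = 0" using y y' by simp
    moreover have "cinner (y - y') (y - y') = cinner (x - y') (y - y') - cinner (x - y) (y - y')"
      by (simp flip: cinner.diff_left del: cinner.diff_right)
    ultimately have "cinner (y - y') (y - y') = 0" by (simp only:)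
    then show "y = y'" by (simp only: cinner_self_zero right_minus_eq)
  qed
  from theI'[OF this] show "orth_proj L x \<in> L" "\<And>u. u \<in> L \<Longrightarrow> cinner (x - orth_proj L x) u = 0"
    unfolding orth_proj_def by blast+
qed

lemma orth_proj_eqI:
  assumes L: "csub L" and "y \<in> L" "\<And>u. u \<in> L \<Longrightarrow> cinner (x - y) u = 0"
  shows "orth_proj L x = y"
proof -
  have yL: "y - orth_proj L x \<in> L" using orth_proj[OF L] assms csub_diff by blast
  have "cinner (x - orth_proj L x) (y - orth_proj L x) - cinner (x - y) (y - orth_proj L x) = 0"
    using orth_proj(2)[OF L yL] assms(3)[OF yL] by simp
  moreover have "cinner (y - orth_proj L x) (y - orth_proj L x)
      = cinner (x - orth_proj L x) (y - orth_proj L x) - cinner (x - y) (y - orth_proj L x)"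
    by (simp flip: cinner.diff_left del: cinner.diff_right)
  ultimately have "cinner (y - orth_proj L x) (y - orth_proj L x) = 0" by (simp only:)
  then show ?thesis by (simp only: cinner_self_zero right_minus_eq)
qed

lemma orth_proj_id: "csub L \<Longrightarrow> x \<in> L \<Longrightarrow> orth_proj L x = x"
  by (rule orth_proj_eqI) auto

lemma orth_proj_cinner:
  assumes L: "csub L"
  shows "cinner (orth_proj L x) y = cinner x (orth_proj L y)"
proof -
  have "cinner (x - orth_proj L x) (orth_proj L y) = 0" "cinner (y - orth_proj L y) (orth_proj L x) = 0"
    by (intro orth_proj(2)[OF L] orth_proj(1)[OF L])+
  then have "cinner x (orth_proj L y) = cinner (orth_proj L x) (orth_proj L y)"
    "cinner y (orth_proj L x) = cinner (orth_proj L y) (orth_proj L x)" by simp_all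
  then show ?thesis by (metis cinner_commute)
qed

lemma orth_proj_pythagoras:
  assumes L: "csub L"
  shows "(norm x)\<^sup>2 = (norm (orth_proj L x))\<^sup>2 + (norm (x - orth_proj L x))\<^sup>2"
proof -
  have "cinner (x - orth_proj L x) (orth_proj L x) = 0" by (intro orth_proj[OF L])
  then have "(norm (x - orth_proj L x + orth_proj L x))\<^sup>2
      = (norm (x - orth_proj L x))\<^sup>2 + (norm (orth_proj L x))\<^sup>2"
    by (simp only: norm_add_sq) simp
  then show ?thesis by simp
qed

lemma orth_proj_norm: "csub L \<Longrightarrow> norm (orth_proj L x) \<le> norm x"
  using orth_proj_pythagoras[of L x] by (simp add: power2_le_imp_le)

lemma bop_orth_proj:
  assumes L: "csub L"
  shows "bop (orth_proj L)"
proof (rule bopI)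
  show "orth_proj L (x + y) = orth_proj L x + orth_proj L y" for x y
    by (rule cinner_ext) (simp add: orth_proj_cinner[OF L])
  show "orth_proj L (c *\<^sub>C x) = c *\<^sub>C orth_proj L x" for x c
    by (rule cinner_ext) (simp add: orth_proj_cinner[OF L])
  show "norm (orth_proj L x) \<le> 1 * norm x" for x by (simp add: orth_proj_norm[OF L])
qed

lemma orth_proj_zero: "csub L \<Longrightarrow> (\<And>u. u \<in> L \<Longrightarrow> cinner x u = 0) \<Longrightarrow> orth_proj L x = 0"
  by (rule orth_proj_eqI) (auto simp: csub_0)

text \<open>A closed subspace is its own double orthogonal complement: the residual
  \<open>x - orth_proj L x\<close> is orthogonal to \<open>L\<close>, hence to \<open>x\<close>,
  hence to itself. This locates the ranges of operators that are known only through their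
  adjoints.\<close>

lemma mem_csub_orth:
  assumes L: "csub L" and orth: "\<And>u. (\<And>v. v \<in> L \<Longrightarrow> cinner u v = 0) \<Longrightarrow> cinner x u = 0"
  shows "x \<in> L"
proof -
  let ?u = "x - orth_proj L x"
  have "cinner x ?u = 0" by (rule orth) (rule orth_proj(2)[OF L])
  moreover have "cinner (orth_proj L x) ?u = 0"
    using orth_proj[OF L] cinner_zero_sym by blast
  ultimately have "cinner ?u ?u = 0" by (metis cinner.diff_left diff_self)
  then have "x = orth_proj L x" by (simp only: cinner_self_zero right_minus_eq)
  then show ?thesis using orth_proj(1)[OF L] by metis
qed

text \<open>Vanishing on the complement of \<open>L\<close> is traded for invariance under
  precomposition with the projection, an equation that passes through compositions and
  limits.\<close>

lemma bounded_ops_iff: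
  assumes L: "csub L"
  shows "T \<in> bounded_ops L L' \<longleftrightarrow> bop T \<and> range T \<subseteq> L' \<and> (\<forall>x. T (orth_proj L x) = T x)"
proof
  assume T: "T \<in> bounded_ops L L'"
  then have "bop T" by (auto simp: bop_iff bounded_ops_def)
  moreover have "T (x - orth_proj L x) = 0" for x
    using T orth_proj(2)[OF L, of _ x] unfolding bounded_ops_def by blast
  ultimately show "bop T \<and> range T \<subseteq> L' \<and> (\<forall>x. T (orth_proj L x) = T x)"
    using T by (simp add: bop_diff bounded_ops_def)
next
  assume T: "bop T \<and> range T \<subseteq> L' \<and> (\<forall>x. T (orth_proj L x) = T x)"
  have "T x = 0" if "\<forall>u\<in>L. cinner x u = 0" for x
    using T that orth_proj_zero[OF L, of x] by (metis bop_0)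
  then show "T \<in> bounded_ops L L'" using T by (auto simp: bounded_ops_def bop_iff)
qed

lemma contractions_iff:
  assumes L: "csub L"
  shows "T \<in> contractions L L' \<longleftrightarrow> bop T \<and> range T \<subseteq> L' \<and> (\<forall>x. T (orth_proj L x) = T x) \<and> (\<forall>x. norm (T x) \<le> norm x)"
proof -
  have "onorm T \<le> 1 \<longleftrightarrow> (\<forall>x. norm (T x) \<le> norm x)" if "bop T"
  proof
    assume "onorm T \<le> 1"
    then show "\<forall>x. norm (T x) \<le> norm x"
      using onorm[OF bop_bl[OF that]] by (meson mult_left_le_one_le norm_ge_zero onorm_pos_le bop_bl that order_trans)
  next
    assume "\<forall>x. norm (T x) \<le> norm x" then show "onorm T \<le> 1" by (intro onorm_bound) auto
  qed
  then show ?thesis by (auto simp: contractions_def bounded_ops_iff[OF L])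
qed

text \<open>\<open>T\<close> kills the complement of \<open>L\<close>, so the range of
  \<open>adj T\<close> is orthogonal to that complement; the range of \<open>T\<close> lies in
  \<open>L'\<close>, so \<open>adj T\<close> ignores the complement of \<open>L'\<close>.\<close>

lemma adj_bounded_ops:
  assumes L: "csub L" and L': "csub L'" and T: "T \<in> bounded_ops L L'"
  shows "adj T \<in> bounded_ops L' L"
proof -
  have bT: "bop T" and TL: "\<And>x. T x \<in> L'" and TP: "\<And>x. T (orth_proj L x) = T x"
    using T by (auto simp: bounded_ops_iff[OF L])
  have "adj T y \<in> L" for y
  proof (rule mem_csub_orth[OF L])
    fix u assume "\<And>v. v \<in> L \<Longrightarrow> cinner u v = 0"
    then have "T u = 0" using TP[of u] orth_proj_zero[OF L, of u] bop_0[OF bT] by metis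
    then show "cinner (adj T y) u = 0" by (simp add: cinner_adj'[OF bT])
  qed
  moreover have "adj T (orth_proj L' y) = adj T y" for y
    by (rule cinner_ext) (simp add: cinner_adj'[OF bT] orth_proj_cinner[OF L'] orth_proj_id[OF L' TL])
  ultimately show ?thesis by (auto simp: bounded_ops_iff[OF L'] bop_adj[OF bT])
qed

lemma adj_contractions:
  assumes L: "csub L" and L': "csub L'" and T: "T \<in> contractions L L'"
  shows "adj T \<in> contractions L' L"
proof -
  have "T \<in> bounded_ops L L'" using T by (simp add: contractions_def)
  from adj_bounded_ops[OF L L' this] show ?thesis
    using T adj_bound[of T 1] by (auto simp: contractions_iff[OF L] contractions_iff[OF L'] bounded_ops_iff[OF L'])
qed

section \<open>Square roots and defect operators\<close>

text \<open>Solves \<open>Y = (C + Y\<^sup>2) / 2\<close>, so that \<open>(I - Y)\<^sup>2 = I - C\<close>. The iterates are polynomials in \<open>C\<close>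
  with nonnegative coefficients, hence their increments are dominated by those of the scalar
  iteration with \<open>C = 1\<close>.\<close>

primrec sqrt_iter :: "('a::chilbert_space \<Rightarrow> 'a) \<Rightarrow> nat \<Rightarrow> 'a \<Rightarrow> 'a" where
  "sqrt_iter C 0 = (\<lambda>x. 0)"
| "sqrt_iter C (Suc n) = (\<lambda>x. complex_of_real (1/2) *\<^sub>C (C x + sqrt_iter C n (sqrt_iter C n x)))"

primrec scalar_iter :: "nat \<Rightarrow> real" where
  "scalar_iter 0 = 0"
| "scalar_iter (Suc n) = (1 + (scalar_iter n)\<^sup>2) / 2"

definition sqrt_lim :: "('a::chilbert_space \<Rightarrow> 'a) \<Rightarrow> 'a \<Rightarrow> 'a" where
  "sqrt_lim C x = lim (\<lambda>n. sqrt_iter C n x)"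

lemma scalar_iter_bounds: "0 \<le> scalar_iter n" "scalar_iter n \<le> 1"
proof -
  have "0 \<le> scalar_iter n \<and> scalar_iter n \<le> 1"
  proof (induction n)
    case (Suc n)
    then have "(scalar_iter n)\<^sup>2 \<le> 1\<^sup>2" by (intro power_mono) auto
    then show ?case by (simp add: add_nonneg_nonneg)
  qed simp
  then show "0 \<le> scalar_iter n" "scalar_iter n \<le> 1" by blast+
qed

lemma scalar_iter_mono: "scalar_iter n \<le> scalar_iter (Suc n)"
proof -
  have "0 \<le> (scalar_iter n - 1)\<^sup>2" by simp
  then show ?thesis by (simp add: power2_diff field_simps)
qed

lemma bop_sqrt_iter: "bop C \<Longrightarrow> bop (sqrt_iter C n)"
proof (induction n)
  case (Suc n)
  then show ?case
    unfolding sqrt_iter.simps by (intro bop_scale bop_sum bop_compose[of "sqrt_iter C n" "sqrt_iter C n"])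
qed (simp add: bop_zero)

lemma sqrt_iter_intertwine:
  assumes "bop T" "\<And>x. T (C x) = C' (T x)"
  shows "T (sqrt_iter C n x) = sqrt_iter C' n (T x)"
  by (induction n arbitrary: x) (simp_all add: bop_0[OF assms(1)] bop_scaleC[OF assms(1)] bop_add[OF assms(1)] assms(2))

text \<open>An intertwining relation carries over to the polynomial iterates and from there to their
  limits. For a contraction \<open>T\<close> it yields the relation between the two defect
  operators; for \<open>T\<close> a positive square root it yields commutation with
  \<open>root\<close>, on which uniqueness rests.\<close>

lemma sqrt_lim_intertwine:
  assumes T: "bop T" and TC: "\<And>x. T (C x) = C' (T x)" and conv: "convergent (\<lambda>n. sqrt_iter C n x)"
  shows "T (sqrt_lim C x) = sqrt_lim C' (T x)"
proof -
  have "(\<lambda>n. T (sqrt_iter C n x)) \<longlonglongrightarrow> T (sqrt_lim C x)"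
    using conv T unfolding sqrt_lim_def convergent_LIMSEQ_iff by (rule bop_tendsto[rotated])
  then show ?thesis
    unfolding sqrt_iter_intertwine[of T C C', OF T TC] sqrt_lim_def[of C'] by (simp add: limI)
qed

locale self_adjoint_contraction =
  fixes C :: "'a::chilbert_space \<Rightarrow> 'a"
  assumes bop: "bop C" and self_adjoint: "\<And>x y. cinner (C x) y = cinner x (C y)"
    and contraction: "\<And>x. norm (C x) \<le> norm x"
begin

lemma iter_bop: "bop (sqrt_iter C n)"
  by (rule bop_sqrt_iter[OF bop])

lemma norm_iter: "norm (sqrt_iter C n x) \<le> scalar_iter n * norm x"
proof (induction n arbitrary: x)
  case (Suc n)
  have "norm (sqrt_iter C n (sqrt_iter C n x)) \<le> scalar_iter n * (scalar_iter n * norm x)"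
    using Suc[of "sqrt_iter C n x"] mult_left_mono[OF Suc[of x] scalar_iter_bounds(1)[of n]] by linarith
  then have "norm (C x + sqrt_iter C n (sqrt_iter C n x)) \<le> norm x + scalar_iter n * (scalar_iter n * norm x)"
    using contraction[of x] norm_triangle_ineq[of "C x" "sqrt_iter C n (sqrt_iter C n x)"] by linarith
  then show ?case by (simp add: norm_scaleC norm_divide power2_eq_square algebra_simps)
qed simp

lemma iter_commute: "sqrt_iter C n (sqrt_iter C m x) = sqrt_iter C m (sqrt_iter C n x)"
  by (rule sqrt_iter_intertwine[OF iter_bop]) (metis sqrt_iter_intertwine[OF bop])

text \<open>Consecutive iterates commute, so the difference of their squares is their sum applied to
  their difference; the scalar increments obey the same factorization with equality.\<close>

lemma norm_iter_step: "norm (sqrt_iter C (Suc n) x - sqrt_iter C n x) \<le> (scalar_iter (Suc n) - scalar_iter n) * norm x"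
proof (induction n arbitrary: x)
  case 0
  show ?case using contraction[of x] by (simp add: norm_scaleC norm_divide)
next
  case (Suc n)
  let ?Y = "sqrt_iter C (Suc n)" and ?Z = "sqrt_iter C n"
  let ?d = "?Y x - ?Z x" and ?y = "scalar_iter (Suc n)" and ?z = "scalar_iter n"
  have "?Y (?Y x) - ?Z (?Z x) = ?Y ?d + ?Z ?d"
    using iter_commute[of "Suc n" n x] by (simp only: bop_diff[OF iter_bop]) simp
  moreover have "sqrt_iter C (Suc (Suc n)) x - ?Y x
      = complex_of_real (1/2) *\<^sub>C (C x + ?Y (?Y x)) - complex_of_real (1/2) *\<^sub>C (C x + ?Z (?Z x))"
    by (simp only: sqrt_iter.simps)
  ultimately have "sqrt_iter C (Suc (Suc n)) x - ?Y x = complex_of_real (1/2) *\<^sub>C (?Y ?d + ?Z ?d)"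
    by (simp only: scaleC.diff_right[symmetric] add_diff_cancel_left)
  then have "norm (sqrt_iter C (Suc (Suc n)) x - ?Y x) = norm (?Y ?d + ?Z ?d) / 2"
    by (simp only: norm_scaleC) simp
  also have "\<dots> \<le> (?y * norm ?d + ?z * norm ?d) / 2"
    by (intro divide_right_mono order_trans[OF norm_triangle_ineq] add_mono norm_iter) simp
  also have "\<dots> = (?y + ?z) / 2 * norm ?d" by (simp add: algebra_simps)
  also have "\<dots> \<le> (?y + ?z) / 2 * ((?y - ?z) * norm x)"
    using scalar_iter_bounds(1)[of n] scalar_iter_bounds(1)[of "Suc n"] by (intro mult_left_mono Suc) simp
  also have "\<dots> = (?y\<^sup>2 - ?z\<^sup>2) / 2 * norm x"
  proof -
    have "(a + b) / 2 * ((a - b) * c) = (a\<^sup>2 - b\<^sup>2) / 2 * c" for a b c :: real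
      by (simp add: power2_eq_square algebra_simps)
    then show ?thesis .
  qed
  also have "(?y\<^sup>2 - ?z\<^sup>2) / 2 = scalar_iter (Suc (Suc n)) - ?y"
    by (simp only: scalar_iter.simps) (simp add: field_simps)
  finally show ?case .
qed

lemma norm_iter_diff:
  assumes "n \<le> m"
  shows "norm (sqrt_iter C m x - sqrt_iter C n x) \<le> (scalar_iter m - scalar_iter n) * norm x"
  using assms
proof (induction m rule: dec_induct)
  case (step m)
  have "norm (sqrt_iter C (Suc m) x - sqrt_iter C n x)
      \<le> norm (sqrt_iter C (Suc m) x - sqrt_iter C m x) + norm (sqrt_iter C m x - sqrt_iter C n x)"
    using norm_triangle_ineq[of "sqrt_iter C (Suc m) x - sqrt_iter C m x"] by (metis diff_add_cancel add_diff_eq)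
  also have "\<dots> \<le> (scalar_iter (Suc m) - scalar_iter m) * norm x + (scalar_iter m - scalar_iter n) * norm x"
    by (intro add_mono norm_iter_step step)
  finally show ?case by (simp only: algebra_simps)
qed simp

lemma scalar_Cauchy: "Cauchy scalar_iter"
proof -
  have "incseq scalar_iter" by (intro incseq_SucI scalar_iter_mono)
  moreover have "Bseq scalar_iter" by (rule BseqI'[of _ 1]) (simp add: scalar_iter_bounds)
  ultimately show ?thesis by (meson Bseq_monoseq_convergent convergent_Cauchy incseq_imp_monoseq)
qed

lemma iter_lim: "(\<lambda>n. sqrt_iter C n x) \<longlonglongrightarrow> sqrt_lim C x"
proof -
  have "Cauchy (\<lambda>n. sqrt_iter C n x)"
  proof (rule CauchyI)
    fix e :: real assume "0 < e"
    then obtain N where N: "\<And>m n. m \<ge> N \<Longrightarrow> n \<ge> N \<Longrightarrow> \<bar>scalar_iter m - scalar_iter n\<bar> < e / (norm x + 1)"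
      using CauchyD[OF scalar_Cauchy, of "e / (norm x + 1)"] by (auto simp: add_nonneg_pos)
    have *: "norm (sqrt_iter C m x - sqrt_iter C n x) < e" if "N \<le> n" "n \<le> m" for m n
    proof -
      have "norm (sqrt_iter C m x - sqrt_iter C n x) \<le> (scalar_iter m - scalar_iter n) * norm x"
        by (rule norm_iter_diff[OF that(2)])
      also have "\<dots> \<le> e / (norm x + 1) * norm x"
        using N[of m n] that by (intro mult_right_mono) auto
      also have "\<dots> < e"
        using \<open>0 < e\<close> norm_ge_zero[of x] by (simp add: divide_less_eq add_nonneg_pos less_not_sym)
      finally show ?thesis .
    qed
    show "\<exists>M. \<forall>m\<ge>M. \<forall>n\<ge>M. norm (sqrt_iter C m x - sqrt_iter C n x) < e"
      using * by (intro exI[of _ N] allI impI) (metis linorder_linear norm_minus_commute)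
  qed
  then show ?thesis
    unfolding sqrt_lim_def by (simp add: Cauchy_convergent_iff convergent_LIMSEQ_iff)
qed

lemma lim_norm: "norm (sqrt_lim C x) \<le> norm x"
proof (rule LIMSEQ_le_const2[OF tendsto_norm[OF iter_lim]])
  have "norm (sqrt_iter C n x) \<le> norm x" for n
    using norm_iter[of n x] mult_right_mono[OF scalar_iter_bounds(2)[of n], of "norm x"] by simp
  then show "\<exists>N. \<forall>n\<ge>N. norm (sqrt_iter C n x) \<le> norm x" by blast
qed

lemma bop_lim: "bop (sqrt_lim C)"
proof (rule bopI[where K = 1])
  show "sqrt_lim C (x + y) = sqrt_lim C x + sqrt_lim C y" for x y
    using tendsto_add[OF iter_lim[of x] iter_lim[of y]] iter_lim[of "x + y"]
    by (simp add: bop_add[OF iter_bop] LIMSEQ_unique)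
  show "sqrt_lim C (c *\<^sub>C x) = c *\<^sub>C sqrt_lim C x" for c x
    using scaleC.tendsto[OF tendsto_const iter_lim[of x], of c] iter_lim[of "c *\<^sub>C x"]
    by (simp add: bop_scaleC[OF iter_bop] LIMSEQ_unique)
qed (simp add: lim_norm)

text \<open>Strong convergence alone does not pass to squares. The iterates are uniformly
  contractive, so the error made by replacing the inner iterate by its limit tends to zero.\<close>

lemma lim_fixpoint: "sqrt_lim C x = complex_of_real (1/2) *\<^sub>C (C x + sqrt_lim C (sqrt_lim C x))"
proof -
  have "(\<lambda>n. sqrt_iter C n (sqrt_iter C n x - sqrt_lim C x)) \<longlonglongrightarrow> 0"
  proof (rule Lim_null_comparison)
    show "\<forall>\<^sub>F n in sequentially. norm (sqrt_iter C n (sqrt_iter C n x - sqrt_lim C x)) \<le> norm (sqrt_iter C n x - sqrt_lim C x)"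
      using norm_iter scalar_iter_bounds
      by (intro always_eventually allI) (meson mult_left_le_one_le norm_ge_zero order_trans)
    show "(\<lambda>n. norm (sqrt_iter C n x - sqrt_lim C x)) \<longlonglongrightarrow> 0"
      using iter_lim[of x] LIM_zero tendsto_norm_zero by blast
  qed
  from tendsto_add[OF this iter_lim[of "sqrt_lim C x"]]
  have "(\<lambda>n. sqrt_iter C n (sqrt_iter C n x)) \<longlonglongrightarrow> sqrt_lim C (sqrt_lim C x)"
    by (simp add: bop_diff[OF iter_bop])
  then have "(\<lambda>n. sqrt_iter C (Suc n) x) \<longlonglongrightarrow> complex_of_real (1/2) *\<^sub>C (C x + sqrt_lim C (sqrt_lim C x))"
    unfolding sqrt_iter.simps by (intro scaleC.tendsto tendsto_add tendsto_const)
  moreover have "(\<lambda>n. sqrt_iter C (Suc n) x) \<longlonglongrightarrow> sqrt_lim C x"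
    using iter_lim[of x] by (rule LIMSEQ_Suc)
  ultimately show ?thesis using LIMSEQ_unique by blast
qed

lemma lim_self_adjoint: "cinner (sqrt_lim C x) y = cinner x (sqrt_lim C y)"
proof -
  have "cinner (sqrt_iter C n x) y = cinner x (sqrt_iter C n y)" for n x y
    by (induction n arbitrary: x y) (simp_all add: self_adjoint)
  then show ?thesis
    using cinner.tendsto[OF iter_lim[of x] tendsto_const[of y]] cinner.tendsto[OF tendsto_const[of x] iter_lim[of y]]
    by (simp add: LIMSEQ_unique)
qed

definition root :: "'a \<Rightarrow> 'a" where
  "root x = x - sqrt_lim C x"

lemma bop_root: "bop root"
  unfolding root_def[abs_def] by (intro bop_difference bop_ident bop_lim)

lemma root_self_adjoint: "cinner (root x) y = cinner x (root y)"
  by (simp add: root_def lim_self_adjoint)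

lemma root_square: "root (root x) = x - C x"
proof -
  have "complex_of_real 2 *\<^sub>C sqrt_lim C x = C x + sqrt_lim C (sqrt_lim C x)"
    by (subst lim_fixpoint) (simp add: scaleC_scaleC)
  then have "sqrt_lim C x + sqrt_lim C x = C x + sqrt_lim C (sqrt_lim C x)"
    by (simp only: scaleC_of_real scaleR_2)
  then show ?thesis
    by (simp add: root_def bop_diff[OF bop_lim] algebra_simps)
qed

lemma positive_root: "positive_op root"
  unfolding positive_op_def
proof (intro conjI allI bop_root)
  fix x
  have "cinner (root x) x = cnj (cinner (root x) x)"
    by (metis cinner_commute root_self_adjoint)
  then have "Im (cinner (root x) x) = - Im (cinner (root x) x)" by (metis cnj.simps(2))
  then have "Im (cinner (root x) x) = 0" by linarith
  moreover have "Re (cinner (sqrt_lim C x) x) \<le> (norm x)\<^sup>2"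
    using cauchy_schwarz[of "sqrt_lim C x" x] complex_Re_le_cmod[of "cinner (sqrt_lim C x) x"]
      mult_right_mono[OF lim_norm[of x], of "norm x"] by (simp add: power2_eq_square)
  then have "0 \<le> Re (cinner (root x) x)" by (simp add: root_def Re_cinner_self)
  ultimately show "cinner (root x) x \<in> \<real>\<^sub>\<ge>\<^sub>0" by (simp add: complex_nonneg_Reals_iff)
qed

end

text \<open>Polarization: that the quadratic form is real at \<open>x + y\<close> and at
  \<open>x + \<i> *\<^sub>C y\<close> gives the imaginary and the real part of the identity.\<close>

lemma positive_op_self_adjoint:
  assumes B: "positive_op B"
  shows "cinner (B x) y = cinner x (B y)"
proof -
  have b: "bop B" and real: "Im (cinner (B x) x) = 0" for x
    using B by (auto simp: positive_op_def complex_nonneg_Reals_iff)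
  have "Im (cinner (B x) y + cinner (B y) x) = 0"
    using real[of "x + y"] real[of x] real[of y] by (simp add: bop_add[OF b])
  moreover have "Re (cinner (B y) x) = Re (cinner (B x) y)"
    using real[of "x + \<i> *\<^sub>C y"] real[of x] real[of y] by (simp add: bop_add[OF b] bop_scaleC[OF b])
  ultimately have "cinner (B x) y = cnj (cinner (B y) x)" by (simp add: complex_eq_iff)
  then show ?thesis using cinner_commute by metis
qed

text \<open>At \<open>y - s B y\<close> the form of \<open>B\<close> equals
  \<open>s * s * q - 2 * s * a\<close>, with \<open>a\<close> the squared norm of
  \<open>B y\<close>. For small positive \<open>s\<close> this is negative unless
  \<open>a = 0\<close>.\<close>

lemma positive_op_kernel:
  assumes B: "positive_op B" and null: "cinner (B y) y = 0"
  shows "B y = 0"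
proof -
  have b: "bop B" and pos: "0 \<le> Re (cinner (B x) x)" for x
    using B by (auto simp: positive_op_def complex_nonneg_Reals_iff)
  define a where "a = (norm (B y))\<^sup>2"
  define q where "q = Re (cinner (B (B y)) (B y))"
  have q: "0 \<le> q" and a: "0 \<le> a" using pos by (auto simp: q_def a_def)
  \<comment> \<open>Dividing by \<open>q + 1\<close> keeps \<open>s\<close> meaningful for
    \<open>q = 0\<close> and ensures \<open>s * q \<le> a\<close>.\<close>
  define s where "s = a / (q + 1)"
  have "0 \<le> Re (cinner (B (y + complex_of_real (- s) *\<^sub>C B y)) (y + complex_of_real (- s) *\<^sub>C B y))"
    by (rule pos)
  also have "\<dots> = s * s * q - 2 * s * a"
    using positive_op_self_adjoint[OF B, of "B y" y] null
    by (simp add: bop_add[OF b] bop_scaleC[OF b] q_def a_def Re_cinner_self cinner_self_eq_norm bop_diff[OF b] scaleC.minus_left) (simp add: algebra_simps)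
  finally have "2 * s * a \<le> s * s * q" by simp
  moreover have "s * q \<le> a" using q a by (simp add: s_def field_simps)
  then have "s * s * q \<le> s * a" using q a mult_left_mono[of "s * q" a s] by (simp add: s_def mult.assoc)
  ultimately have "s * a \<le> 0" by linarith
  then have "a * a \<le> 0" using q by (simp add: s_def divide_le_0_iff)
  then have "a = 0" using a by (metis mult_eq_0_iff order_antisym mult_nonneg_nonneg)
  then show ?thesis by (simp add: a_def)
qed

context self_adjoint_contraction
begin

text \<open>\<open>B\<close> commutes with \<open>C\<close>, hence with \<open>root\<close>, so
  \<open>root + B\<close> annihilates \<open>y = root x - B x\<close> because the squares agree.
  Both summands are positive, so each annihilates \<open>y\<close>, and then \<open>y\<close> is
  orthogonal to itself.\<close>

lemma root_unique:
  assumes B: "positive_op B" and sq: "\<And>x. B (B x) = x - C x"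
  shows "B = root"
proof
  fix x
  have b: "bop B" using B by (simp add: positive_op_def)
  have BC: "B (C x) = C (B x)" for x
  proof -
    have "B (x - C x) = B x - C (B x)" using sq[of "B x"] sq[of x] by simp
    then show ?thesis by (simp add: bop_diff[OF b])
  qed
  have comm: "B (root x) = root (B x)" for x
    using sqrt_lim_intertwine[of B C C, OF b BC, of x] iter_lim[of x]
    by (simp add: root_def bop_diff[OF b] convergentI)
  define y where "y = root x - B x"
  have "root y + B y = root (root x) - B (B x)"
    by (simp add: y_def bop_diff[OF b] bop_diff[OF bop_root] comm)
  then have "root y + B y = 0" by (simp add: sq root_square)
  then have "cinner (root y) y + cinner (B y) y = 0" by (simp flip: cinner.add_left)
  moreover have "cinner (root y) y \<in> \<real>\<^sub>\<ge>\<^sub>0" "cinner (B y) y \<in> \<real>\<^sub>\<ge>\<^sub>0"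
    using B positive_root by (auto simp: positive_op_def)
  ultimately have "cinner (root y) y = 0" "cinner (B y) y = 0"
    by (auto simp: complex_nonneg_Reals_iff complex_eq_iff)
  then have 0: "root y = 0" "B y = 0"
    using positive_op_kernel B positive_root by blast+
  have "cinner y y = cinner (root y) x - cinner (B y) x"
    unfolding root_self_adjoint positive_op_self_adjoint[OF B] by (simp add: y_def)
  then have "cinner y y = 0" unfolding 0 by simp
  then have "y = 0" by (simp only: cinner_self_zero)
  then show "B x = root x" by (simp add: y_def)
qed

lemma sqrt_op_eq_root: "sqrt_op (\<lambda>x. x - C x) = root"
  unfolding sqrt_op_def
proof (rule the_equality)
  show "positive_op root \<and> root \<circ> root = (\<lambda>x. x - C x)"
    using positive_root root_square by auto
  fix B assume "positive_op B \<and> B \<circ> B = (\<lambda>x. x - C x)"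
  then show "B = root" by (intro root_unique) (metis comp_apply)+
qed

end

section \<open>Defect operators of a contraction between closed subspaces\<close>

locale contraction_between =
  fixes L :: "'a::chilbert_space set" and L' :: "'b::chilbert_space set" and T :: "'a \<Rightarrow> 'b"
  assumes L: "csub L" and L': "csub L'" and T: "T \<in> contractions L L'"
begin

abbreviation "D \<equiv> defect_op L T"
abbreviation "D' \<equiv> defect_op L' (adj T)"
abbreviation "DS \<equiv> defect_space L T"
abbreviation "DS' \<equiv> defect_space L' (adj T)"

lemma bop: "bop T" and T_mem: "T x \<in> L'" and T_proj: "T (orth_proj L x) = T x"
  and T_norm: "norm (T x) \<le> norm x"
  using T by (auto simp: contractions_iff[OF L])

lemma adjoint: "contraction_between L' L (adj T)"
  by unfold_locales (auto intro: L L' T adj_contractions)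

lemma adj_adj_T: "adj (adj T) = T"
  by (rule adj_adj[OF bop])

text \<open>\<open>C\<close> acts as adj T T on \<open>L\<close> and as the identity on the
  complement of \<open>L\<close>. Thus I - C is the extension by zero of I - adj T T from
  \<open>L\<close>, written in the form required by the square root iteration.\<close>

abbreviation (input) "C \<equiv> \<lambda>x. x - (orth_proj L x - adj T (T x))"

text \<open>The part of \<open>x\<close> outside \<open>L\<close> is unchanged and orthogonal to
  \<open>adj T (T x)\<close>, so the norm bound reduces to the one for adj T T on the projection of
  \<open>x\<close>.\<close>

lemma C_self_adjoint_contraction: "self_adjoint_contraction C"
proof
  show "bop C"
    by (intro bop_difference bop_ident bop_orth_proj[OF L] bop_compose[of "adj T" T] bop_adj bop)
  show "cinner (C x) y = cinner x (C y)" for x y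
    by (simp add: orth_proj_cinner[OF L] cinner_adj'[OF bop] cinner_adj[OF bop])
  fix x
  let ?p = "orth_proj L x" and ?q = "adj T (T x)"
  have q: "?q \<in> L" "norm ?q \<le> norm ?p"
  proof -
    interpret a: contraction_between L' L "adj T" by (rule adjoint)
    show "?q \<in> L" by (rule a.T_mem)
    show "norm ?q \<le> norm ?p" using a.T_norm[of "T ?p"] T_norm[of ?p] by (simp add: T_proj)
  qed
  have "(norm (x - ?p + ?q))\<^sup>2 = (norm (x - ?p))\<^sup>2 + (norm ?q)\<^sup>2"
    unfolding norm_add_sq orth_proj(2)[OF L q(1)] by simp
  also have "\<dots> \<le> (norm (x - ?p))\<^sup>2 + (norm ?p)\<^sup>2" using q(2) by simp
  also have "\<dots> = (norm x)\<^sup>2" using orth_proj_pythagoras[OF L, of x] by simp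
  finally have "norm (x - ?p + ?q) \<le> norm x" by (rule power2_le_imp_le) simp
  then show "norm (C x) \<le> norm x" by (simp add: diff_diff_eq2 diff_add_eq)
qed

lemma defect_eq: "D = (\<lambda>x. x - sqrt_lim C x)"
proof -
  interpret c: self_adjoint_contraction C by (rule C_self_adjoint_contraction)
  show ?thesis using c.sqrt_op_eq_root by (simp add: defect_op_def c.root_def[abs_def])
qed

lemma bop_D: "bop D"
  and D_self_adjoint: "cinner (D x) y = cinner x (D y)"
  and D_square: "D (D x) = orth_proj L x - adj T (T x)"
proof -
  interpret c: self_adjoint_contraction C by (rule C_self_adjoint_contraction)
  have D: "D = c.root" by (simp add: defect_eq c.root_def[abs_def])
  show "bop D" "cinner (D x) y = cinner x (D y)" "D (D x) = orth_proj L x - adj T (T x)"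
    unfolding D using c.bop_root c.root_self_adjoint c.root_square by auto
qed

lemma norm_D: "(norm (D x))\<^sup>2 = (norm (orth_proj L x))\<^sup>2 - (norm (T x))\<^sup>2"
proof -
  have "complex_of_real ((norm (D x))\<^sup>2) = cinner (D (D x)) x"
    by (simp add: D_self_adjoint cinner_self_eq_norm)
  also have "\<dots> = cinner (orth_proj L (orth_proj L x)) x - cinner (T x) (T x)"
    by (simp add: D_square cinner_adj'[OF bop] orth_proj_id[OF L orth_proj(1)[OF L]])
  also have "\<dots> = cinner (orth_proj L x) (orth_proj L x) - cinner (T x) (T x)"
    by (simp only: orth_proj_cinner[OF L])
  finally have "complex_of_real ((norm (D x))\<^sup>2) = complex_of_real ((norm (orth_proj L x))\<^sup>2 - (norm (T x))\<^sup>2)"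
    by (simp add: cinner_self_eq_norm)
  then show ?thesis using of_real_eq_iff by blast
qed

lemma D_proj: "D (orth_proj L x) = D x"
proof -
  have "(norm (D (x - orth_proj L x)))\<^sup>2 = 0"
    unfolding norm_D by (simp add: bop_diff bop bop_orth_proj[OF L] T_proj orth_proj_id[OF L orth_proj(1)[OF L]])
  then show ?thesis by (simp add: bop_diff[OF bop_D])
qed

lemma D_mem: "D x \<in> L"
proof (rule mem_csub_orth[OF L])
  fix u assume "\<And>v. v \<in> L \<Longrightarrow> cinner u v = 0"
  then have "D u = 0" using D_proj[of u] orth_proj_zero[OF L, of u] bop_0[OF bop_D] by metis
  then show "cinner (D x) u = 0" by (simp add: D_self_adjoint)
qed

lemma D_mem_DS: "D x \<in> DS"
  unfolding defect_space_def by (rule subsetD[OF closure_subset]) simp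

lemma DS_subset: "DS \<subseteq> L"
  unfolding defect_space_def using D_mem by (intro closure_minimal csub_closed[OF L]) auto

lemma csub_DS: "csub DS"
  unfolding defect_space_def by (rule csub_closure_range[OF bop_D])

lemma norm_D_le: "norm (D x) \<le> norm x"
proof (rule power2_le_imp_le)
  show "(norm (D x))\<^sup>2 \<le> (norm x)\<^sup>2"
    using power_mono[OF orth_proj_norm[OF L, of x] norm_ge_zero, of 2] zero_le_power2[of "norm (T x)"]
    unfolding norm_D by linarith
qed simp

text \<open>Self-adjointness makes the kernel of \<open>D\<close> orthogonal to its range, hence to
  the closure \<open>DS\<close>. This is the substitute for a bounded inverse of
  \<open>D\<close>.\<close>

lemma D_injective: "u \<in> DS \<Longrightarrow> D u = 0 \<Longrightarrow> u = 0"
proof -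
  assume u: "u \<in> DS" "D u = 0"
  then obtain f where f: "\<And>n. f n \<in> range D" "f \<longlonglongrightarrow> u" by (auto simp: defect_space_def closure_sequential)
  have "cinner (f n) u = 0" for n using f(1)[of n] u(2) by (auto simp: D_self_adjoint)
  moreover have "(\<lambda>n. cinner (f n) u) \<longlonglongrightarrow> cinner u u" by (intro cinner.tendsto f tendsto_const)
  ultimately have "cinner u u = 0" by (simp add: LIMSEQ_const_iff)
  then show "u = 0" by (simp only: cinner_self_zero)
qed

text \<open>\<open>T\<close> intertwines the operators \<open>C\<close> belonging to
  \<open>T\<close> and to \<open>adj T\<close>, hence also the limits of the two square root
  iterations.\<close>

lemma intertwine: "T (D x) = D' (T x)"
proof -
  interpret a: contraction_between L' L "adj T" by (rule adjoint)
  interpret c: self_adjoint_contraction C by (rule C_self_adjoint_contraction)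
  have "T (sqrt_lim C x) = sqrt_lim a.C (T x)"
  proof (rule sqrt_lim_intertwine[of T C a.C, OF bop])
    show "T (C x) = a.C (T x)" for x
      by (simp add: bop_diff[OF bop] T_proj adj_adj_T orth_proj_id[OF L' T_mem])
    show "convergent (\<lambda>n. sqrt_iter C n x)" using c.iter_lim by (rule convergentI)
  qed
  then show ?thesis by (simp add: defect_eq a.defect_eq bop_diff[OF bop])
qed

text \<open>The locale applied to the contraction \<open>adj T\<close>, with
  \<open>adj (adj T)\<close> rewritten to \<open>T\<close>, so that both defect operators are at
  hand side by side.\<close>

lemma dual:
  shows "bop D'" "cinner (D' y) y' = cinner y (D' y')" "D' (D' y) = orth_proj L' y - T (adj T y)"
    "(norm (D' y))\<^sup>2 = (norm (orth_proj L' y))\<^sup>2 - (norm (adj T y))\<^sup>2"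
    "D' (orth_proj L' y) = D' y" "D' y \<in> L'" "D' y \<in> DS'" "DS' \<subseteq> L'" "csub DS'"
    "norm (D' y) \<le> norm y" "v \<in> DS' \<Longrightarrow> D' v = 0 \<Longrightarrow> v = 0" "adj T (D' y) = D (adj T y)"
    "bop (adj T)" "adj T y \<in> L" "norm (adj T y) \<le> norm y" "adj T (orth_proj L' y) = adj T y"
proof -
  interpret a: contraction_between L' L "adj T" by (rule adjoint)
  show "bop D'" "cinner (D' y) y' = cinner y (D' y')" "D' (D' y) = orth_proj L' y - T (adj T y)"
    "(norm (D' y))\<^sup>2 = (norm (orth_proj L' y))\<^sup>2 - (norm (adj T y))\<^sup>2"
    "D' (orth_proj L' y) = D' y" "D' y \<in> L'" "D' y \<in> DS'" "DS' \<subseteq> L'" "csub DS'"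
    "norm (D' y) \<le> norm y" "v \<in> DS' \<Longrightarrow> D' v = 0 \<Longrightarrow> v = 0" "adj T (D' y) = D (adj T y)"
    "bop (adj T)" "adj T y \<in> L" "norm (adj T y) \<le> norm y" "adj T (orth_proj L' y) = adj T y"
    using a.bop_D a.D_self_adjoint a.D_square a.norm_D a.D_proj a.D_mem a.D_mem_DS a.DS_subset
      a.csub_DS a.norm_D_le a.D_injective a.intertwine a.bop a.T_mem a.T_norm a.T_proj adj_adj_T
    by auto
qed

text \<open>By the intertwining relation \<open>adj T\<close> maps the range of \<open>D'\<close>
  into that of \<open>D\<close>, and \<open>DS\<close> is closed.\<close>

lemma adj_DS: "v \<in> DS' \<Longrightarrow> adj T v \<in> DS"
proof (rule bop_sub_closed[OF dual(13) csub_DS, of "range D'"])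
  show "adj T x \<in> DS" if "x \<in> range D'" for x
    using that by (auto simp: dual(12) D_mem_DS)
qed (simp add: defect_space_def)

text \<open>The two cross terms agree by the intertwining relation and cancel; what remains are the
  norm identities of the two defect operators. The projections appear because \<open>x\<close> and
  \<open>y\<close> range over the ambient types, on which the operators are extended by
  zero.\<close>

lemma rotation_isometry:
  "(norm (T x + D' y))\<^sup>2 + (norm (D x - adj T y))\<^sup>2 = (norm (orth_proj L x))\<^sup>2 + (norm (orth_proj L' y))\<^sup>2"
proof -
  have "cinner (T x) (D' y) = cinner (D x) (adj T y)"
    using cinner_adj[OF bop, of "D x" y] intertwine[of x] dual(2)[of "T x" y] by simp
  then show ?thesis
    by (simp add: norm_add_sq norm_diff_sq norm_D dual(4))
qed

lemma rotation_isometry':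
  assumes "x \<in> L" "y \<in> L'"
  shows "(norm (T x + D' y))\<^sup>2 + (norm (D x - adj T y))\<^sup>2 = (norm x)\<^sup>2 + (norm y)\<^sup>2"
  using rotation_isometry[of x y] assms by (simp add: orth_proj_id L L')

end

section \<open>Factorization through dense ranges\<close>

lemma closure_range_eqI:
  assumes "bop X" "bop Y" "\<And>x. X (A x) = Y (A x)" "v \<in> closure (range A)"
  shows "X v = Y v"
proof -
  obtain f where f: "\<And>n. f n \<in> range A" "f \<longlonglongrightarrow> v" using assms(4) by (auto simp: closure_sequential)
  have "X (f n) = Y (f n)" for n using f(1)[of n] assms(3) by auto
  then have "(\<lambda>n. X (f n)) \<longlonglongrightarrow> Y v" using bop_tendsto[OF assms(2) f(2)] by simp
  then show ?thesis using bop_tendsto[OF assms(1) f(2)] LIMSEQ_unique by blast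
qed

lemma closure_range_le:
  assumes X: "bop X" and Y: "bop Y" and le: "\<And>x. norm (X (A x)) \<le> norm (Y (A x))" and v: "v \<in> closure (range A)"
  shows "norm (X v) \<le> norm (Y v)"
proof -
  obtain f where f: "\<And>n. f n \<in> range A" "f \<longlonglongrightarrow> v" using v by (auto simp: closure_sequential)
  have "norm (X (f n)) \<le> norm (Y (f n))" for n using f(1)[of n] le by auto
  then show ?thesis
    using tendsto_norm[OF bop_tendsto[OF X f(2)]] tendsto_norm[OF bop_tendsto[OF Y f(2)]]
    by (intro LIMSEQ_le) auto
qed

lemma closure_range_orth:
  assumes "\<And>x. cinner (A x) w = 0" "v \<in> closure (range A)"
  shows "cinner v w = 0"
proof -
  obtain f where f: "\<And>n. f n \<in> range A" "f \<longlonglongrightarrow> v" using assms(2) by (auto simp: closure_sequential)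
  have "cinner (f n) w = 0" for n using f(1)[of n] assms(1) by auto
  moreover have "(\<lambda>n. cinner (f n) w) \<longlonglongrightarrow> cinner v w" by (intro cinner.tendsto f tendsto_const)
  ultimately show ?thesis by (simp add: LIMSEQ_const_iff)
qed

lemma closure_range_cinner_eqI:
  assumes A: "bop A" and v: "v \<in> closure (range A)" "v' \<in> closure (range A)"
    and eq: "\<And>x. cinner (A x) v = cinner (A x) v'"
  shows "v = v'"
proof -
  have "v - v' \<in> closure (range A)" by (rule csub_diff[OF csub_closure_range[OF A] v])
  then have "cinner (v - v') (v - v') = 0"
    by (rule closure_range_orth[rotated]) (simp only: cinner.diff_right eq diff_self)
  then show ?thesis by (simp only: cinner_self_zero right_minus_eq)
qed

text \<open>The Riesz lemma is applied twice. For fixed \<open>x\<close> it represents the form in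
  \<open>y\<close> by a vector \<open>V x\<close> in the closure of the range of \<open>B\<close>.
  For fixed \<open>b\<close> it represents \<open>cinner (V x) b\<close> through \<open>A x\<close>;
  the bound \<open>norm (V x) \<le> K * norm (A x)\<close> makes injectivity of \<open>A\<close>
  unnecessary. The second step yields \<open>W\<close>, and the factor is its adjoint.\<close>

lemma form_factor:
  fixes s :: "'a::chilbert_space \<Rightarrow> 'b::chilbert_space \<Rightarrow> complex"
    and A :: "'a \<Rightarrow> 'c::chilbert_space" and B :: "'b \<Rightarrow> 'd::chilbert_space"
  assumes s: "\<And>x x' y. s (x + x') y = s x y + s x' y" "\<And>c x y. s (c *\<^sub>C x) y = c * s x y"
    "\<And>x y y'. s x (y + y') = s x y + s x y'" "\<And>c x y. s x (c *\<^sub>C y) = cnj c * s x y"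
    and bound: "\<And>x y. cmod (s x y) \<le> K * norm (A x) * norm (B y)" and K: "0 \<le> K"
    and A: "bop A" and B: "bop B"
  shows "\<exists>X\<in>bounded_ops (closure (range A)) (closure (range B)).
    (\<forall>a. norm (X a) \<le> K * norm a) \<and> (\<forall>x y. cinner (X (A x)) (B y) = s x y)"
proof -
  have "\<exists>v\<in>closure (B ` UNIV). norm v \<le> K * norm (A x) \<and> (\<forall>y\<in>UNIV. cnj (s x y) = cinner (B y) v)" for x
    by (rule riesz_factor) (use bound K in \<open>auto simp: s bop_add[OF B] bop_scaleC[OF B]\<close>)
  then obtain V where V: "\<And>x. V x \<in> closure (range B)" "\<And>x. norm (V x) \<le> K * norm (A x)"
    "\<And>x y. cnj (s x y) = cinner (B y) (V x)"
    by (metis UNIV_I)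
  have sV: "s x y = cinner (V x) (B y)" for x y
    by (metis V(3) cinner_commute complex_cnj_cnj)
  have BV: "csub (closure (range B))" by (rule csub_closure_range[OF B])
  have V_add: "V (x + x') = V x + V x'" for x x'
    by (rule closure_range_cinner_eqI[OF B V(1) csub_add[OF BV V(1) V(1)]])
      (simp only: cinner.add_right V(3)[symmetric] s complex_cnj_add)
  have V_scale: "V (c *\<^sub>C x) = c *\<^sub>C V x" for c x
    by (rule closure_range_cinner_eqI[OF B V(1) csub_scaleC[OF BV V(1)]])
      (simp only: cinner_scaleC_right V(3)[symmetric] s complex_cnj_mult)
  have "\<exists>w\<in>closure (A ` UNIV). norm w \<le> K * norm b \<and> (\<forall>x\<in>UNIV. cinner (V x) b = cinner (A x) w)" for b
  proof (rule riesz_factor)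
    show "cmod (cinner (V x) b) \<le> K * norm b * norm (A x)" for x
      using cauchy_schwarz[of "V x" b] mult_right_mono[OF V(2)[of x], of "norm b"] by (simp add: mult_ac)
  qed (use K in \<open>auto simp: V_add V_scale bop_add[OF A] bop_scaleC[OF A]\<close>)
  then obtain W where W: "\<And>b. W b \<in> closure (range A)" "\<And>b. norm (W b) \<le> K * norm b"
    "\<And>x b. cinner (V x) b = cinner (A x) (W b)"
    by (metis UNIV_I)
  have AW: "csub (closure (range A))" by (rule csub_closure_range[OF A])
  have bW: "bop W"
  proof (rule bopI)
    show "W (b + b') = W b + W b'" for b b'
      by (rule closure_range_cinner_eqI[OF A W(1) csub_add[OF AW W(1) W(1)]])
        (simp only: cinner.add_right W(3)[symmetric])
    show "W (c *\<^sub>C b) = c *\<^sub>C W b" for c b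
      by (rule closure_range_cinner_eqI[OF A W(1) csub_scaleC[OF AW W(1)]])
        (simp only: cinner_scaleC_right W(3)[symmetric])
  qed (rule W(2))
  have "adj W a \<in> closure (range B)" for a
  proof (rule mem_csub_orth[OF BV])
    fix u assume "\<And>v. v \<in> closure (range B) \<Longrightarrow> cinner u v = 0"
    then have "cinner (A x) (W u) = 0" for x using V(1) cinner_zero_sym by (metis W(3))
    then have "W u = 0"
      by (intro closure_range_cinner_eqI[OF A W(1) csub_0[OF AW]]) (simp only: cinner.zero_right)
    then show "cinner (adj W a) u = 0" by (simp add: cinner_adj'[OF bW])
  qed
  moreover have "adj W (orth_proj (closure (range A)) a) = adj W a" for a
    by (rule cinner_ext) (simp only: cinner_adj'[OF bW] orth_proj_cinner[OF AW] orth_proj_id[OF AW W(1)])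
  ultimately have "adj W \<in> bounded_ops (closure (range A)) (closure (range B))"
    by (auto simp: bounded_ops_iff[OF AW] bop_adj[OF bW])
  moreover have "norm (adj W a) \<le> K * norm a" for a by (rule adj_bound[OF bW K W(2)])
  moreover have "cinner (adj W (A x)) (B y) = s x y" for x y
    by (simp add: cinner_adj'[OF bW] W(3)[symmetric] sV)
  ultimately show ?thesis by blast
qed

section \<open>Operator-valued holomorphic functions\<close>

text \<open>Cauchy estimates on circles of radius \<delta> about points within \<delta> of
  \<open>z\<close>, which explains the margin \<open>2 * \<delta>\<close>. The constants depend on
  \<open>g\<close> only through \<open>B\<close>, so they are uniform over families of scalar
  functions.\<close>

lemma scalar_taylor:
  assumes hol: "g holomorphic_on ball 0 1" and \<delta>: "0 < \<delta>" "norm z + 2 * \<delta> < 1"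
    and B: "\<And>w. norm w \<le> norm z + 2 * \<delta> \<Longrightarrow> cmod (g w) \<le> B"
  shows "cmod (deriv g z) \<le> B / \<delta>"
    and "dist w z < \<delta> \<Longrightarrow> cmod (g w - g z - deriv g z * (w - z)) \<le> 2 * B / \<delta>\<^sup>2 * (cmod (w - z))\<^sup>2"
proof -
  have bnd: "cmod (g w) \<le> B" if "dist u z < \<delta>" "dist u w \<le> \<delta>" for u w
  proof (rule B)
    have "norm w \<le> norm z + dist z u + dist u w" by norm
    then show "norm w \<le> norm z + 2 * \<delta>" using that by (simp add: dist_commute)
  qed
  have sub: "cball u \<delta> \<subseteq> ball 0 1" if "dist u z < \<delta>" for u
  proof
    fix w assume w: "w \<in> cball u \<delta>"
    have "norm w \<le> norm z + dist z u + dist u w" by norm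
    then show "w \<in> ball 0 1" using that w \<delta> by (simp add: dist_commute)
  qed
  have C: "cmod ((deriv ^^ n) g u) \<le> fact n * B / \<delta> ^ n" if "dist u z < \<delta>" for u n
  proof (rule Cauchy_inequality)
    show "g holomorphic_on ball u \<delta>" using hol sub[OF that] by (meson ball_subset_cball holomorphic_on_subset order_trans)
    show "continuous_on (cball u \<delta>) g"
      using hol sub[OF that] by (meson holomorphic_on_imp_continuous_on holomorphic_on_subset)
    show "cmod (g w) \<le> B" if "cmod (u - w) = \<delta>" for w
      using bnd[of u w] \<open>dist u z < \<delta>\<close> that by (simp add: dist_norm)
  qed (rule \<delta>)
  show "cmod (deriv g z) \<le> B / \<delta>" using C[of z 1] \<delta> by simp
  have deriv: "((deriv ^^ i) g has_field_derivative (deriv ^^ Suc i) g u) (at u within ball z \<delta>)" if "u \<in> ball z \<delta>" for i u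
  proof -
    have "dist u z < \<delta>" using that by (simp add: dist_commute)
    from subsetD[OF sub[OF this], of u] have "u \<in> ball 0 1" using \<delta> by simp
    then show ?thesis
      using holomorphic_derivI[OF holomorphic_higher_deriv[OF hol open_ball] open_ball, of u i] by simp
  qed
  show "cmod (g w - g z - deriv g z * (w - z)) \<le> 2 * B / \<delta>\<^sup>2 * (cmod (w - z))\<^sup>2" if "dist w z < \<delta>"
  proof -
    have "cmod ((deriv ^^ 0) g w - (\<Sum>i\<le>1. (deriv ^^ i) g z * (w - z) ^ i / fact i))
        \<le> 2 * B / \<delta>\<^sup>2 * cmod (w - z) ^ Suc 1 / fact 1"
    proof (rule complex_Taylor[where f = "\<lambda>i. (deriv ^^ i) g", OF convex_ball[of z \<delta>]])
      show "((deriv ^^ i) g has_field_derivative (deriv ^^ Suc i) g u) (at u within ball z \<delta>)"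
        if "u \<in> ball z \<delta>" for i u
        by (rule deriv[OF that])
      show "cmod ((deriv ^^ Suc 1) g u) \<le> 2 * B / \<delta>\<^sup>2" if "u \<in> ball z \<delta>" for u
        using C[of u 2] that by (simp add: dist_commute numeral_2_eq_2)
    qed (use that \<delta> in \<open>auto simp: dist_commute\<close>)
    then show ?thesis by (simp add: power2_eq_square algebra_simps)
  qed
qed

text \<open>Uniformity is asked on smaller disks only: the factor \<open>X\<close> of the Schur
  algorithm is controlled by |z| / (1 - |z|), which blows up at the boundary.\<close>

definition locally_bounded_on_disk :: "(complex \<Rightarrow> 'a::chilbert_space \<Rightarrow> 'b::chilbert_space) \<Rightarrow> bool" where
  "locally_bounded_on_disk \<Theta> \<longleftrightarrow> (\<forall>\<rho><1. \<exists>M\<ge>0. \<forall>z. norm z \<le> \<rho> \<longrightarrow> (\<forall>x. norm (\<Theta> z x) \<le> M * norm x))"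

lemma locally_bounded_on_diskI:
  "0 \<le> M \<Longrightarrow> (\<And>z x. norm z < 1 \<Longrightarrow> norm (\<Theta> z x) \<le> M * norm x) \<Longrightarrow> locally_bounded_on_disk \<Theta>"
  unfolding locally_bounded_on_disk_def by (metis order_le_less_trans)

lemma locally_bounded_on_disk_at:
  assumes "locally_bounded_on_disk \<Theta>" "norm z < 1"
  shows "\<exists>M\<ge>0. \<forall>\<^sub>F w in at z. norm w < 1 \<and> (\<forall>x. norm (\<Theta> w x) \<le> M * norm x)"
proof -
  define \<rho> where "\<rho> = (1 + norm z) / 2"
  have \<rho>: "\<rho> < 1" "norm z < \<rho>" using assms(2) by (auto simp: \<rho>_def)
  obtain M where M: "0 \<le> M" "\<And>w x. norm w \<le> \<rho> \<Longrightarrow> norm (\<Theta> w x) \<le> M * norm x"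
    using assms(1) \<rho> unfolding locally_bounded_on_disk_def by blast
  have "\<forall>\<^sub>F w in at z. w \<in> ball 0 \<rho>"
    using \<rho> by (intro eventually_at_in_open') auto
  then have "\<forall>\<^sub>F w in at z. norm w < 1 \<and> (\<forall>x. norm (\<Theta> w x) \<le> M * norm x)"
    by eventually_elim (use \<rho> M in auto)
  then show ?thesis using M(1) by blast
qed

definition weakly_holomorphic :: "(complex \<Rightarrow> 'a::chilbert_space \<Rightarrow> 'b::chilbert_space) \<Rightarrow> bool" where
  "weakly_holomorphic \<Theta> \<longleftrightarrow> (\<forall>x y. (\<lambda>z. cinner (\<Theta> z x) y) holomorphic_on ball 0 1)"

text \<open>An intermediate notion: unlike weak holomorphy it passes directly through products and
  inverses of operator functions, and unlike differentiability in the operator norm it can be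
  checked one vector at a time.\<close>

definition vec_differentiable :: "(complex \<Rightarrow> 'a::chilbert_space) \<Rightarrow> complex \<Rightarrow> bool" where
  "vec_differentiable f z \<longleftrightarrow> (\<exists>d. ((\<lambda>w. (1 / (w - z)) *\<^sub>C (f w - f z)) \<longlongrightarrow> d) (at z))"

text \<open>The coefficients have Taylor remainders bounded by a constant times
  \<open>norm x * norm y\<close>, and this uniformity upgrades weak differentiability to the
  operator norm. The derivative is the operator of the sesquilinear form of scalar
  derivatives.\<close>

lemma weakly_holomorphic_imp_op_holomorphic:
  assumes weak: "weakly_holomorphic \<Theta>" and lb: "locally_bounded_on_disk \<Theta>"
    and bop: "\<And>z. norm z < 1 \<Longrightarrow> bop (\<Theta> z)"
  shows "op_holomorphic \<Theta>"
  unfolding op_holomorphic_def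
proof
  fix z :: complex assume "z \<in> ball 0 1"
  then have z: "norm z < 1" by simp
  \<comment> \<open>A third of the distance to the unit circle, so that
    \<open>norm z + 2 * \<delta>\<close> stays below \<open>1\<close>.\<close>
  define \<delta> where "\<delta> = (1 - norm z) / 3"
  have \<delta>: "0 < \<delta>" "norm z + 2 * \<delta> < 1" using z by (auto simp: \<delta>_def field_simps)
  obtain M where M: "0 \<le> M" "\<And>w x. norm w \<le> norm z + 2 * \<delta> \<Longrightarrow> norm (\<Theta> w x) \<le> M * norm x"
    using lb \<delta>(2) unfolding locally_bounded_on_disk_def by blast
  define g where "g x y = (\<lambda>w. cinner (\<Theta> w x) y)" for x y
  have hol: "g x y holomorphic_on ball 0 1" for x y
    using weak by (simp add: g_def weakly_holomorphic_def)
  have B: "cmod (g x y w) \<le> M * norm x * norm y" if "norm w \<le> norm z + 2 * \<delta>" for x y w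
    using cauchy_schwarz[of "\<Theta> w x" y] mult_right_mono[OF M(2)[OF that, of x], of "norm y"]
    by (simp add: g_def)
  have diff: "g x y field_differentiable at z" for x y
    using hol z by (intro holomorphic_on_imp_differentiable_at[of _ "ball 0 1"]) auto
  note taylor = scalar_taylor[OF hol \<delta> B]
  have eq_ball: "deriv f z = deriv h z" if "\<And>w. norm w < 1 \<Longrightarrow> f w = h w" for f h
    using z by (intro deriv_cong_ev refl eventually_nhds_in_open[of "ball 0 1" z, THEN eventually_mono]) (auto simp: that)
  have "\<exists>F\<in>bounded_ops (closure (range (\<lambda>x. x))) (closure (range (\<lambda>x. x))).
     (\<forall>a. norm (F a) \<le> M / \<delta> * norm a) \<and> (\<forall>x y. cinner (F x) y = deriv (g x y) z)"
  proof (rule form_factor[OF _ _ _ _ _ _ bop_ident bop_ident])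
    show "deriv (g (x + x') y) z = deriv (g x y) z + deriv (g x' y) z" for x x' y
      unfolding deriv_add[OF diff diff, symmetric] by (rule eq_ball) (simp add: g_def bop_add[OF bop])
    show "deriv (g x (y + y')) z = deriv (g x y) z + deriv (g x y') z" for x y y'
      unfolding deriv_add[OF diff diff, symmetric] by (rule eq_ball) (simp add: g_def)
    show "deriv (g (c *\<^sub>C x) y) z = c * deriv (g x y) z" for c x y
      unfolding deriv_cmult[OF diff, symmetric] by (rule eq_ball) (simp add: g_def bop_scaleC[OF bop])
    show "deriv (g x (c *\<^sub>C y)) z = cnj c * deriv (g x y) z" for c x y
      unfolding deriv_cmult[OF diff, symmetric] by (rule eq_ball) (simp add: g_def)
    show "cmod (deriv (g x y) z) \<le> M / \<delta> * norm x * norm y" for x y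
      using taylor(1)[of x y] by simp
    show "0 \<le> M / \<delta>" using M \<delta> by simp
  qed
  then obtain F where F: "bop F" "\<And>x y. cinner (F x) y = deriv (g x y) z" by auto
  define E where "E w x = (1 / (w - z)) *\<^sub>C (\<Theta> w x - \<Theta> z x) - F x" for w x
  have E: "norm (E w x) \<le> 2 * M / \<delta>\<^sup>2 * cmod (w - z) * norm x" if w: "w \<noteq> z" "dist w z < \<delta>" for w x
  proof -
    define r where "r = \<Theta> w x - \<Theta> z x - (w - z) *\<^sub>C F x"
    have r: "norm r \<le> 2 * M / \<delta>\<^sup>2 * (cmod (w - z))\<^sup>2 * norm x"
    proof (rule norm_le_cinner)
      fix y
      have "cinner r y = g x y w - g x y z - deriv (g x y) z * (w - z)"
        by (simp add: r_def g_def[abs_def] F(2))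
      then show "cmod (cinner r y) \<le> 2 * M / \<delta>\<^sup>2 * (cmod (w - z))\<^sup>2 * norm x * norm y"
        using taylor(2)[OF _ w(2), of x y] by (simp add: mult_ac)
    qed (use M in simp)
    have "E w x = (1 / (w - z)) *\<^sub>C r"
      using w by (simp add: E_def r_def scaleC.diff_right scaleC_scaleC)
    then have "norm (E w x) = norm r / cmod (w - z)" by (simp add: norm_scaleC norm_divide)
    also have "\<dots> \<le> 2 * M / \<delta>\<^sup>2 * cmod (w - z) * norm x"
      using r w by (simp add: divide_le_eq power2_eq_square mult_ac)
    finally show ?thesis .
  qed
  have "((\<lambda>w. onorm (E w)) \<longlongrightarrow> 0) (at z)"
  proof (rule Lim_null_comparison)
    show "\<forall>\<^sub>F w in at z. norm (onorm (E w)) \<le> 2 * M / \<delta>\<^sup>2 * cmod (w - z)"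
      unfolding eventually_at
    proof (rule exI[of _ \<delta>], intro conjI ballI impI)
      show "0 < \<delta>" by (rule \<delta>(1))
      fix w assume w: "w \<noteq> z \<and> dist w z < \<delta>"
      have wz: "norm w < 1" "norm z < 1"
        using w \<delta> norm_triangle_ineq[of "w - z" z] by (auto simp: dist_norm)
      have "bop (E w)"
        unfolding E_def by (intro bop_difference bop_scale bop F(1) wz)
      then have "0 \<le> onorm (E w)" by (intro onorm_pos_le bop_bl)
      moreover have "onorm (E w) \<le> 2 * M / \<delta>\<^sup>2 * cmod (w - z)"
        by (rule onorm_bound) (use M E w in auto)
      ultimately show "norm (onorm (E w)) \<le> 2 * M / \<delta>\<^sup>2 * cmod (w - z)" by simp
    qed
    have "((\<lambda>w. 2 * M / \<delta>\<^sup>2 * cmod (w - z)) \<longlongrightarrow> 2 * M / \<delta>\<^sup>2 * cmod (z - z)) (at z)"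
      by (intro tendsto_intros)
    then show "((\<lambda>w. 2 * M / \<delta>\<^sup>2 * cmod (w - z)) \<longlongrightarrow> 0) (at z)" by simp
  qed
  then show "\<exists>F\<in>bounded_ops UNIV UNIV.
      ((\<lambda>w. onorm (\<lambda>x. (1 / (w - z)) *\<^sub>C (\<Theta> w x - \<Theta> z x) - F x)) \<longlongrightarrow> 0) (at z)"
    using F(1) unfolding E_def[abs_def] by blast
qed

lemma op_holomorphic_derivative:
  assumes hol: "op_holomorphic \<Theta>" and z: "norm z < 1" and bop: "\<And>z. norm z < 1 \<Longrightarrow> bop (\<Theta> z)"
  shows "\<exists>F. bop F \<and> (\<forall>x. ((\<lambda>w. (1 / (w - z)) *\<^sub>C (\<Theta> w x - \<Theta> z x)) \<longlongrightarrow> F x) (at z))"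
proof -
  obtain F where F: "bop F" "((\<lambda>w. onorm (\<lambda>x. (1 / (w - z)) *\<^sub>C (\<Theta> w x - \<Theta> z x) - F x)) \<longlongrightarrow> 0) (at z)"
    using hol z unfolding op_holomorphic_def mem_ball_0[symmetric] by blast
  have "((\<lambda>w. (1 / (w - z)) *\<^sub>C (\<Theta> w x - \<Theta> z x)) \<longlongrightarrow> F x) (at z)" for x
  proof (rule LIM_zero_cancel, rule Lim_null_comparison)
    have "\<forall>\<^sub>F w in at z. w \<in> ball 0 1" using z by (intro eventually_at_in_open') auto
    then show "\<forall>\<^sub>F w in at z. norm ((1 / (w - z)) *\<^sub>C (\<Theta> w x - \<Theta> z x) - F x)
        \<le> onorm (\<lambda>x. (1 / (w - z)) *\<^sub>C (\<Theta> w x - \<Theta> z x) - F x) * norm x"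
    proof eventually_elim
      case (elim w)
      then have "bop (\<lambda>x. (1 / (w - z)) *\<^sub>C (\<Theta> w x - \<Theta> z x) - F x)"
        by (intro bop_difference bop_scale bop F(1) z) simp
      then show ?case by (intro onorm bop_bl)
    qed
    show "((\<lambda>w. onorm (\<lambda>x. (1 / (w - z)) *\<^sub>C (\<Theta> w x - \<Theta> z x) - F x) * norm x) \<longlongrightarrow> 0) (at z)"
      using tendsto_mult[OF F(2) tendsto_const[of "norm x"]] by simp
  qed
  then show ?thesis using F(1) by blast
qed

lemma op_holomorphic_vec_differentiable:
  assumes "op_holomorphic \<Theta>" "norm z < 1" "\<And>z. norm z < 1 \<Longrightarrow> bop (\<Theta> z)"
  shows "vec_differentiable (\<lambda>w. \<Theta> w x) z"
  using op_holomorphic_derivative[OF assms] unfolding vec_differentiable_def by blast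

lemma vec_differentiable_cinner:
  assumes "\<And>z. norm z < 1 \<Longrightarrow> vec_differentiable f z"
  shows "(\<lambda>z. cinner (f z) y) holomorphic_on ball 0 1"
  unfolding holomorphic_on_open[OF open_ball]
proof
  fix z :: complex assume "z \<in> ball 0 1"
  then obtain d where "((\<lambda>w. (1 / (w - z)) *\<^sub>C (f w - f z)) \<longlongrightarrow> d) (at z)"
    using assms[of z] by (auto simp: vec_differentiable_def)
  then have "((\<lambda>w. cinner ((1 / (w - z)) *\<^sub>C (f w - f z)) y) \<longlongrightarrow> cinner d y) (at z)"
    by (intro cinner.tendsto tendsto_const)
  then show "\<exists>f'. ((\<lambda>z. cinner (f z) y) has_field_derivative f') (at z)"
    unfolding has_field_derivative_iff by (auto simp: diff_divide_distrib)
qed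

lemma op_holomorphic_weakly:
  assumes "op_holomorphic \<Theta>" "\<And>z. norm z < 1 \<Longrightarrow> bop (\<Theta> z)"
  shows "weakly_holomorphic \<Theta>"
  unfolding weakly_holomorphic_def
proof (intro allI vec_differentiable_cinner)
  show "vec_differentiable (\<lambda>w. \<Theta> w x) z" if "norm z < 1" for x z
    using assms(1) that assms(2) by (rule op_holomorphic_vec_differentiable)
qed

section \<open>Calculus of strongly differentiable functions\<close>

lemma vec_differentiable_tendsto:
  assumes "vec_differentiable f z"
  shows "(f \<longlongrightarrow> f z) (at z)"
proof -
  obtain d where d: "((\<lambda>w. (1 / (w - z)) *\<^sub>C (f w - f z)) \<longlongrightarrow> d) (at z)"
    using assms by (auto simp: vec_differentiable_def)
  have "((\<lambda>w. w - z) \<longlongrightarrow> z - z) (at z)" by (intro tendsto_intros)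
  from scaleC.tendsto[OF this d]
  have "((\<lambda>w. (w - z) *\<^sub>C (1 / (w - z)) *\<^sub>C (f w - f z)) \<longlongrightarrow> 0) (at z)" by simp
  moreover have "\<forall>\<^sub>F w in at z. (w - z) *\<^sub>C (1 / (w - z)) *\<^sub>C (f w - f z) = f w - f z"
    by (auto simp: eventually_at_filter scaleC_scaleC)
  ultimately have "((\<lambda>w. f w - f z) \<longlongrightarrow> 0) (at z)" by (rule Lim_transform_eventually)
  then show ?thesis by (rule LIM_zero_cancel)
qed

text \<open>Convergence of the family is known only at the vector \<open>c\<close>; the uniform
  bound absorbs the moving argument.\<close>

lemma bounded_family_tendsto:
  assumes bnd: "\<forall>\<^sub>F w in F. bop (A w) \<and> (\<forall>x. norm (A w x) \<le> M * norm x)"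
    and A: "((\<lambda>w. A w c) \<longlongrightarrow> l) F" and f: "(f \<longlongrightarrow> c) F"
  shows "((\<lambda>w. A w (f w)) \<longlongrightarrow> l) F"
proof -
  have "((\<lambda>w. A w (f w - c)) \<longlongrightarrow> 0) F"
  proof (rule Lim_null_comparison)
    show "\<forall>\<^sub>F w in F. norm (A w (f w - c)) \<le> M * norm (f w - c)"
      using bnd by eventually_elim blast
    show "((\<lambda>w. M * norm (f w - c)) \<longlongrightarrow> 0) F"
      using tendsto_mult[OF tendsto_const tendsto_norm_zero[OF LIM_zero[OF f]], of M] by simp
  qed
  from tendsto_add[OF this A] have "((\<lambda>w. A w (f w - c) + A w c) \<longlongrightarrow> l) F" by simp
  moreover have "\<forall>\<^sub>F w in F. A w (f w - c) + A w c = A w (f w)"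
    using bnd by eventually_elim (simp add: bop_diff)
  ultimately show ?thesis by (rule Lim_transform_eventually)
qed

text \<open>The product rule with the split
  \<open>A w (f w - f z) + (A w (f z) - A z (f z))\<close>. In the first term a strongly continuous
  family acts on a moving vector, hence the local bound.\<close>

lemma vec_differentiable_apply:
  assumes bop: "\<And>w. norm w < 1 \<Longrightarrow> bop (A w)" and lb: "locally_bounded_on_disk A"
    and A: "\<And>x. vec_differentiable (\<lambda>w. A w x) z" and f: "vec_differentiable f z" and z: "norm z < 1"
  shows "vec_differentiable (\<lambda>w. A w (f w)) z"
proof -
  obtain M where M: "\<forall>\<^sub>F w in at z. norm w < 1 \<and> (\<forall>x. norm (A w x) \<le> M * norm x)"
    using locally_bounded_on_disk_at[OF lb z] by blast
  have bnd: "\<forall>\<^sub>F w in at z. bop (A w) \<and> (\<forall>x. norm (A w x) \<le> M * norm x)"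
    using M by eventually_elim (use bop in auto)
  obtain d where d: "((\<lambda>w. (1 / (w - z)) *\<^sub>C (f w - f z)) \<longlongrightarrow> d) (at z)"
    using f by (auto simp: vec_differentiable_def)
  obtain e where e: "((\<lambda>w. (1 / (w - z)) *\<^sub>C (A w (f z) - A z (f z))) \<longlongrightarrow> e) (at z)"
    using A[of "f z"] by (auto simp: vec_differentiable_def)
  have "((\<lambda>w. A w ((1 / (w - z)) *\<^sub>C (f w - f z))) \<longlongrightarrow> A z d) (at z)"
    by (rule bounded_family_tendsto[OF bnd vec_differentiable_tendsto[OF A] d])
  from tendsto_add[OF this e]
  have "((\<lambda>w. A w ((1 / (w - z)) *\<^sub>C (f w - f z)) + (1 / (w - z)) *\<^sub>C (A w (f z) - A z (f z))) \<longlongrightarrow> A z d + e) (at z)" .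
  moreover have "\<forall>\<^sub>F w in at z. A w ((1 / (w - z)) *\<^sub>C (f w - f z)) + (1 / (w - z)) *\<^sub>C (A w (f z) - A z (f z))
      = (1 / (w - z)) *\<^sub>C (A w (f w) - A z (f z))"
    using bnd by eventually_elim (simp add: bop_diff bop_scaleC scaleC.diff_right)
  ultimately have "((\<lambda>w. (1 / (w - z)) *\<^sub>C (A w (f w) - A z (f z))) \<longlongrightarrow> A z d + e) (at z)"
    by (rule Lim_transform_eventually)
  then show ?thesis by (auto simp: vec_differentiable_def)
qed

lemma vec_differentiable_bop:
  assumes T: "bop T" and f: "vec_differentiable f z"
  shows "vec_differentiable (\<lambda>w. T (f w)) z"
proof -
  obtain d where "((\<lambda>w. (1 / (w - z)) *\<^sub>C (f w - f z)) \<longlongrightarrow> d) (at z)"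
    using f by (auto simp: vec_differentiable_def)
  from bop_tendsto[OF T this] show ?thesis
    unfolding vec_differentiable_def by (auto simp: bop_diff[OF T] bop_scaleC[OF T])
qed

lemma vec_differentiable_add:
  assumes "vec_differentiable f z" "vec_differentiable g z"
  shows "vec_differentiable (\<lambda>w. f w + g w) z"
proof -
  obtain d e where "((\<lambda>w. (1 / (w - z)) *\<^sub>C (f w - f z)) \<longlongrightarrow> d) (at z)"
    "((\<lambda>w. (1 / (w - z)) *\<^sub>C (g w - g z)) \<longlongrightarrow> e) (at z)"
    using assms by (auto simp: vec_differentiable_def)
  from tendsto_add[OF this] have "((\<lambda>w. (1 / (w - z)) *\<^sub>C ((f w + g w) - (f z + g z))) \<longlongrightarrow> d + e) (at z)"
    by (simp add: scaleC.diff_right scaleC_add_right algebra_simps)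
  then show ?thesis by (auto simp: vec_differentiable_def)
qed

lemma vec_differentiable_const: "vec_differentiable (\<lambda>w. a) z"
  unfolding vec_differentiable_def by (rule exI[of _ 0]) simp

lemma vec_differentiable_mult_ident:
  assumes f: "vec_differentiable f z"
  shows "vec_differentiable (\<lambda>w. w *\<^sub>C f w) z"
proof -
  obtain d where d: "((\<lambda>w. (1 / (w - z)) *\<^sub>C (f w - f z)) \<longlongrightarrow> d) (at z)"
    using f by (auto simp: vec_differentiable_def)
  have "((\<lambda>w. w *\<^sub>C ((1 / (w - z)) *\<^sub>C (f w - f z)) + f z) \<longlongrightarrow> z *\<^sub>C d + f z) (at z)"
    by (intro tendsto_add scaleC.tendsto d tendsto_const tendsto_ident_at)
  moreover have "\<forall>\<^sub>F w in at z. w *\<^sub>C ((1 / (w - z)) *\<^sub>C (f w - f z)) + f z = (1 / (w - z)) *\<^sub>C (w *\<^sub>C f w - z *\<^sub>C f z)"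
  proof -
    have "w *\<^sub>C ((1 / (w - z)) *\<^sub>C (f w - f z)) + f z = (1 / (w - z)) *\<^sub>C (w *\<^sub>C f w - z *\<^sub>C f z)" if "w \<noteq> z" for w
    proof -
      have "f z = (1 / (w - z)) *\<^sub>C ((w - z) *\<^sub>C f z)" using that by (simp add: scaleC_scaleC)
      also have "\<dots> = (1 / (w - z)) *\<^sub>C (w *\<^sub>C f z) - (1 / (w - z)) *\<^sub>C (z *\<^sub>C f z)"
        by (simp only: scaleC.diff_left scaleC.diff_right)
      finally show ?thesis
        by (simp add: scaleC.diff_right scaleC_scaleC algebra_simps)
    qed
    then show ?thesis by (auto simp: eventually_at_filter)
  qed
  ultimately have "((\<lambda>w. (1 / (w - z)) *\<^sub>C (w *\<^sub>C f w - z *\<^sub>C f z)) \<longlongrightarrow> z *\<^sub>C d + f z) (at z)"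
    by (rule Lim_transform_eventually)
  then show ?thesis by (auto simp: vec_differentiable_def)
qed

text \<open>The resolvent identity Q(w) - Q(z) = - Q(w) (A(w) - A(z)) Q(z) gives continuity and,
  with it, the derivative. The hypotheses on \<open>Q\<close> and \<open>A\<close> are the form this
  identity takes for inverses that live on a subspace \<open>V\<close>.\<close>

lemma vec_differentiable_inverse:
  assumes Q: "\<And>w. norm w < 1 \<Longrightarrow> bop (Q w)" "locally_bounded_on_disk Q"
    and A: "\<And>x. vec_differentiable (\<lambda>w. A w x) z"
    and QA: "\<And>w v. norm w < 1 \<Longrightarrow> v \<in> V \<Longrightarrow> Q w (A w v) = v"
    and QAQ: "\<And>w a. norm w < 1 \<Longrightarrow> Q z a \<in> V \<and> Q w (A z (Q z a)) = Q w a"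
    and z: "norm z < 1"
  shows "vec_differentiable (\<lambda>w. Q w a) z"
proof -
  obtain M where M: "\<forall>\<^sub>F w in at z. norm w < 1 \<and> (\<forall>x. norm (Q w x) \<le> M * norm x)"
    using locally_bounded_on_disk_at[OF Q(2) z] by blast
  have bnd: "\<forall>\<^sub>F w in at z. bop (Q w) \<and> (\<forall>x. norm (Q w x) \<le> M * norm x)"
    using M by eventually_elim (use Q in auto)
  have step: "Q w a - Q z a = - Q w (A w (Q z a) - A z (Q z a))" if "norm w < 1" for w a
    using QA[OF that, of "Q z a"] QAQ[OF that, of a] by (simp add: bop_diff[OF Q(1)[OF that]])
  have cont: "((\<lambda>w. Q w a) \<longlongrightarrow> Q z a) (at z)" for a
  proof (rule LIM_zero_cancel, rule Lim_null_comparison)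
    show "\<forall>\<^sub>F w in at z. norm (Q w a - Q z a) \<le> M * norm (A w (Q z a) - A z (Q z a))"
      using M by eventually_elim (simp add: step)
    show "((\<lambda>w. M * norm (A w (Q z a) - A z (Q z a))) \<longlongrightarrow> 0) (at z)"
      using tendsto_mult[OF tendsto_const tendsto_norm_zero[OF LIM_zero[OF vec_differentiable_tendsto[OF A]]], of M] by simp
  qed
  obtain d where d: "((\<lambda>w. (1 / (w - z)) *\<^sub>C (A w (Q z a) - A z (Q z a))) \<longlongrightarrow> d) (at z)"
    using A[of "Q z a"] by (auto simp: vec_differentiable_def)
  have "((\<lambda>w. - Q w ((1 / (w - z)) *\<^sub>C (A w (Q z a) - A z (Q z a)))) \<longlongrightarrow> - Q z d) (at z)"
    by (intro tendsto_minus bounded_family_tendsto[OF bnd cont d])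
  moreover have "\<forall>\<^sub>F w in at z. - Q w ((1 / (w - z)) *\<^sub>C (A w (Q z a) - A z (Q z a))) = (1 / (w - z)) *\<^sub>C (Q w a - Q z a)"
    using M by eventually_elim (simp add: step bop_scaleC[OF Q(1)] scaleC.minus_right)
  ultimately have "((\<lambda>w. (1 / (w - z)) *\<^sub>C (Q w a - Q z a)) \<longlongrightarrow> - Q z d) (at z)"
    by (rule Lim_transform_eventually)
  then show ?thesis by (auto simp: vec_differentiable_def)
qed

text \<open>Approximating \<open>a\<close> and \<open>b\<close> from the two ranges gives uniform
  convergence on small closed disks by the local bound, and holomorphy survives locally uniform
  limits.\<close>

lemma weakly_holomorphic_closure:
  assumes bop: "\<And>z. norm z < 1 \<Longrightarrow> bop (X z)" and lb: "locally_bounded_on_disk X"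
    and dense: "\<And>x y. (\<lambda>z. cinner (X z (A x)) (B y)) holomorphic_on ball 0 1"
    and ab: "a \<in> closure (range A)" "b \<in> closure (range B)"
  shows "(\<lambda>z. cinner (X z a) b) holomorphic_on ball 0 1"
proof -
  obtain f where f: "\<And>n. f n \<in> range A" "f \<longlonglongrightarrow> a" using ab(1) by (auto simp: closure_sequential)
  obtain g where g: "\<And>n. g n \<in> range B" "g \<longlonglongrightarrow> b" using ab(2) by (auto simp: closure_sequential)
  show ?thesis
  proof (rule holomorphic_uniform_sequence[OF open_ball, of "\<lambda>n z. cinner (X z (f n)) (g n)"])
    fix n
    show "(\<lambda>z. cinner (X z (f n)) (g n)) holomorphic_on ball 0 1"
      using dense f(1)[of n] g(1)[of n] by auto
  next
    fix z :: complex assume "z \<in> ball 0 1"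
    define \<rho> where "\<rho> = (1 + norm z) / 2"
    have \<rho>: "\<rho> < 1" "norm z < \<rho>" using \<open>z \<in> ball 0 1\<close> by (auto simp: \<rho>_def)
    obtain M where M: "0 \<le> M" "\<And>w x. norm w \<le> \<rho> \<Longrightarrow> norm (X w x) \<le> M * norm x"
      using lb \<rho> unfolding locally_bounded_on_disk_def by blast
    define d where "d = \<rho> - norm z"
    have d: "0 < d" "\<And>w. w \<in> cball z d \<Longrightarrow> norm w \<le> \<rho>"
    proof -
      fix w assume w: "w \<in> cball z d"
      have "norm w \<le> norm z + dist z w" by norm
      then show "norm w \<le> \<rho>" using w by (simp add: d_def)
    qed (use \<rho> in \<open>simp add: d_def\<close>)
    have "uniform_limit (cball z d) (\<lambda>n w. cinner (X w (f n)) (g n)) (\<lambda>w. cinner (X w a) b) sequentially"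
    proof (rule uniform_limitI)
      fix e :: real assume "0 < e"
      have bound: "dist (cinner (X w (f n)) (g n)) (cinner (X w a) b)
          \<le> M * norm (f n - a) * norm (g n) + M * norm a * norm (g n - b)" if "w \<in> cball z d" for w n
      proof -
        have w: "bop (X w)" "norm w \<le> \<rho>" using bop d(2)[OF that] \<rho> by auto
        have "cinner (X w (f n)) (g n) - cinner (X w a) b = cinner (X w (f n - a)) (g n) + cinner (X w a) (g n - b)"
          by (simp add: bop_diff[OF w(1)])
        then have "dist (cinner (X w (f n)) (g n)) (cinner (X w a) b)
            \<le> norm (X w (f n - a)) * norm (g n) + norm (X w a) * norm (g n - b)"
          unfolding dist_norm
          by (simp only:) (intro order_trans[OF norm_triangle_ineq] add_mono cauchy_schwarz)
        also have "\<dots> \<le> M * norm (f n - a) * norm (g n) + M * norm a * norm (g n - b)"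
          by (intro add_mono mult_right_mono M(2) w(2)) auto
        finally show ?thesis .
      qed
      have "(\<lambda>n. M * norm (f n - a) * norm (g n) + M * norm a * norm (g n - b)) \<longlonglongrightarrow> M * norm (a - a) * norm b + M * norm a * norm (b - b)"
        by (intro tendsto_intros f g)
      then have "(\<lambda>n. M * norm (f n - a) * norm (g n) + M * norm a * norm (g n - b)) \<longlonglongrightarrow> 0" by simp
      then have "\<forall>\<^sub>F n in sequentially. M * norm (f n - a) * norm (g n) + M * norm a * norm (g n - b) < e"
        using \<open>0 < e\<close> by (rule order_tendstoD(2))
      then show "\<forall>\<^sub>F n in sequentially. \<forall>w\<in>cball z d. dist (cinner (X w (f n)) (g n)) (cinner (X w a) b) < e"
        by eventually_elim (use bound in \<open>meson le_less_trans\<close>)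
    qed
    moreover have "cball z d \<subseteq> ball 0 1" using d \<rho> by fastforce
    ultimately show "\<exists>d>0. cball z d \<subseteq> ball 0 1 \<and>
        uniform_limit (cball z d) (\<lambda>n w. cinner (X w (f n)) (g n)) (\<lambda>w. cinner (X w a) b) sequentially"
      using d(1) by blast
  qed
qed

section \<open>Inverses on a closed subspace\<close>

text \<open>Boundedness below turns convergence of images into convergence of preimages. A closed
  range can be projected onto, which opens the way to surjectivity by orthogonality.\<close>

lemma csub_image_bounded_below:
  assumes P: "bop P" and V: "csub V" and c: "0 < c" "\<And>v. v \<in> V \<Longrightarrow> c * norm v \<le> norm (P v)"
  shows "csub (P ` V)"
  unfolding csub_def
proof (intro conjI ballI allI)
  show "closed (P ` V)"
    unfolding closed_sequential_limits
  proof (intro allI impI, elim conjE)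
    fix f l assume "\<forall>n. f n \<in> P ` V" and l: "f \<longlonglongrightarrow> l"
    then obtain a where a: "\<And>n. a n \<in> V" "\<And>n. f n = P (a n)" unfolding image_iff Bex_def by metis
    have "Cauchy a"
    proof (rule CauchyI)
      fix e :: real assume "0 < e"
      then have "0 < c * e" using c by simp
      then obtain N where N: "\<And>m n. m \<ge> N \<Longrightarrow> n \<ge> N \<Longrightarrow> norm (f m - f n) < c * e"
        using CauchyD[OF LIMSEQ_imp_Cauchy[OF l]] by blast
      have "norm (a m - a n) < e" if "m \<ge> N" "n \<ge> N" for m n
      proof -
        have "c * norm (a m - a n) \<le> norm (P (a m - a n))" by (intro c csub_diff[OF V] a)
        also have "\<dots> < c * e" using N[OF that] by (simp add: a(2) bop_diff[OF P])
        finally show ?thesis using c by simp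
      qed
      then show "\<exists>M. \<forall>m\<ge>M. \<forall>n\<ge>M. norm (a m - a n) < e" by blast
    qed
    then obtain v where v: "a \<longlonglongrightarrow> v" using Cauchy_convergent convergent_def by blast
    have "v \<in> V" by (rule csub_lim[OF V a(1) v])
    moreover have "l = P v" using bop_tendsto[OF P v] l by (simp add: a(2)[abs_def] LIMSEQ_unique)
    ultimately show "l \<in> P ` V" by blast
  qed
  show "0 \<in> P ` V" using csub_0[OF V] bop_0[OF P] by (metis imageI)
  show "x + y \<in> P ` V" if "x \<in> P ` V" "y \<in> P ` V" for x y
    using that csub_add[OF V] by (auto simp flip: bop_add[OF P])
  show "a *\<^sub>C x \<in> P ` V" if "x \<in> P ` V" for a x
    using that csub_scaleC[OF V] by (auto simp flip: bop_scaleC[OF P])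
qed

text \<open>Precomposing with the projection makes the inverse a bounded operator on the whole type;
  \<open>inv_into\<close> alone is not controlled off \<open>V\<close>.\<close>

definition subspace_inverse :: "'a::chilbert_space set \<Rightarrow> ('a \<Rightarrow> 'a) \<Rightarrow> 'a \<Rightarrow> 'a" where
  "subspace_inverse V A x = inv_into V A (orth_proj V x)"

lemma
  assumes A: "bop A" and V: "csub V" and bij: "bij_betw A V V"
    and c: "0 < c" "\<And>v. v \<in> V \<Longrightarrow> c * norm v \<le> norm (A v)"
  shows subspace_inverse_mem: "subspace_inverse V A x \<in> V"
    and subspace_inverse_right: "A (subspace_inverse V A x) = orth_proj V x"
    and subspace_inverse_left: "v \<in> V \<Longrightarrow> subspace_inverse V A (A v) = v"
    and subspace_inverse_norm: "norm (subspace_inverse V A x) \<le> inverse c * norm x"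
    and bop_subspace_inverse: "bop (subspace_inverse V A)"
proof -
  have mem: "subspace_inverse V A x \<in> V" for x
    unfolding subspace_inverse_def using bij orth_proj(1)[OF V] by (metis bij_betw_imp_surj_on inv_into_into)
  have right: "A (subspace_inverse V A x) = orth_proj V x" for x
    unfolding subspace_inverse_def using bij orth_proj(1)[OF V] by (metis bij_betw_inv_into_right)
  have inj: "u = v" if "u \<in> V" "v \<in> V" "A u = A v" for u v
    using bij that by (metis bij_betw_def inj_onD)
  have norm: "norm (subspace_inverse V A x) \<le> inverse c * norm x" for x
  proof -
    have "c * norm (subspace_inverse V A x) \<le> norm x"
      using c(2)[OF mem[of x]] orth_proj_norm[OF V, of x] by (simp add: right)
    then show ?thesis using c(1) by (simp add: field_simps)
  qed
  show "subspace_inverse V A x \<in> V" "A (subspace_inverse V A x) = orth_proj V x"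
    "norm (subspace_inverse V A x) \<le> inverse c * norm x"
    by (rule mem right norm)+
  show "subspace_inverse V A (A v) = v" if "v \<in> V" for v
  proof -
    have "A v \<in> V" using bij that by (meson bij_betwE)
    then show ?thesis by (intro inj[OF mem that]) (simp only: right orth_proj_id[OF V])
  qed
  show "bop (subspace_inverse V A)"
  proof (rule bopI[OF _ _ norm])
    show "subspace_inverse V A (x + y) = subspace_inverse V A x + subspace_inverse V A y" for x y
      by (rule inj[OF mem csub_add[OF V mem mem]]) (simp only: bop_add[OF A] right bop_add[OF bop_orth_proj[OF V]])
    show "subspace_inverse V A (a *\<^sub>C x) = a *\<^sub>C subspace_inverse V A x" for a x
      by (rule inj[OF mem csub_scaleC[OF V mem]]) (simp only: bop_scaleC[OF A] right bop_scaleC[OF bop_orth_proj[OF V]])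
  qed
qed

text \<open>Surjectivity is the fixed point theorem for the map \<open>b + K v\<close> of
  \<open>v\<close> on the complete set \<open>V\<close>. It serves both the loop of a Schur step and
  the inverse in the linear-fractional formula, where \<open>q\<close> is |z|.\<close>

lemma bij_betw_id_minus_contraction:
  assumes V: "csub V" and K: "bop K" "\<And>v. v \<in> V \<Longrightarrow> K v \<in> V"
    and q: "0 \<le> q" "q < 1" "\<And>v. v \<in> V \<Longrightarrow> norm (K v) \<le> q * norm v"
  shows "bij_betw (\<lambda>v. v - K v) V V" and "v \<in> V \<Longrightarrow> (1 - q) * norm v \<le> norm (v - K v)"
proof -
  show below: "(1 - q) * norm v \<le> norm (v - K v)" if "v \<in> V" for v
    using q(3)[OF that] norm_triangle_ineq2[of v "K v"] by (simp add: left_diff_distrib)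
  show "bij_betw (\<lambda>v. v - K v) V V"
    unfolding bij_betw_def
  proof (intro conjI equalityI subsetI)
    show "inj_on (\<lambda>v. v - K v) V"
    proof (rule inj_onI)
      fix u v assume uv: "u \<in> V" "v \<in> V" "u - K u = v - K v"
      have "(1 - q) * norm (u - v) \<le> norm ((u - v) - K (u - v))" by (rule below[OF csub_diff[OF V uv(1,2)]])
      also have "(u - v) - K (u - v) = (u - K u) - (v - K v)" by (simp add: bop_diff[OF K(1)])
      finally have "(1 - q) * norm (u - v) \<le> 0" using uv(3) by simp
      then show "u = v" using q by (simp add: mult_le_0_iff)
    qed
    fix b assume b: "b \<in> V"
    have "\<exists>!v\<in>V. b + K v = v"
    proof (rule Banach_fix[OF _ _ q(1,2)])
      show "complete V" using csub_closed[OF V] by (simp add: complete_eq_closed)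
      show "V \<noteq> {}" using b by blast
      show "(\<lambda>v. b + K v) ` V \<subseteq> V" using csub_add[OF V b] K(2) by blast
      show "dist (b + K u) (b + K v) \<le> q * dist u v" if "u \<in> V" "v \<in> V" for u v
        using q(3)[OF csub_diff[OF V, of u v]] that by (simp add: dist_norm bop_diff[OF K(1)])
    qed
    then obtain v where "v \<in> V" "b + K v = v" by blast
    then have "b = v - K v" by (metis add_diff_cancel_right')
    then show "b \<in> (\<lambda>v. v - K v) ` V" using \<open>v \<in> V\<close> by blast
  next
    fix b assume "b \<in> (\<lambda>v. v - K v) ` V"
    then show "b \<in> V" using csub_diff[OF V] K(2) by blast
  qed
qed

section \<open>One step of the Schur algorithm\<close>

text \<open>The scalar Schwarz lemma for each coefficient bounds \<open>Y z\<close> by |z|, so the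
  quotient by \<open>z\<close> is contractive. Its value at \<open>0\<close> is the derivative
  \<open>F\<close>, which inherits range, projection and norm conditions as a limit.\<close>

lemma op_schwarz:
  assumes V: "csub V" and V': "csub V'" and Y: "\<And>z. norm z < 1 \<Longrightarrow> Y z \<in> contractions V V'"
    and weak: "weakly_holomorphic Y" and Y0: "\<And>x. Y 0 x = 0"
  shows "\<exists>\<Psi>\<in>schur_class V V'. \<forall>z\<in>ball 0 1. \<forall>x. Y z x = z *\<^sub>C \<Psi> z x"
proof -
  have bop: "bop (Y z)" and mem: "Y z x \<in> V'" and proj: "Y z (orth_proj V x) = Y z x"
    and le: "norm (Y z x) \<le> norm x" if "norm z < 1" for z x
    using Y[OF that] by (auto simp: contractions_iff[OF V])
  have "op_holomorphic Y"
    by (intro weakly_holomorphic_imp_op_holomorphic[OF weak] locally_bounded_on_diskI[of 1] bop) (auto simp: le)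
  from op_holomorphic_derivative[OF this _ bop, of 0]
  obtain F where F: "bop F" "\<And>x. ((\<lambda>w. (1 / w) *\<^sub>C Y w x) \<longlongrightarrow> F x) (at 0)" by (auto simp: Y0)
  have near: "\<forall>\<^sub>F w in at 0. norm (w :: complex) < 1 \<and> w \<noteq> 0"
    unfolding eventually_at by (intro exI[of _ 1]) auto
  have schwarz: "norm (Y z x) \<le> norm z * norm x" if z: "norm z < 1" for z x
  proof (rule norm_le_cinner)
    fix y
    show "cmod (cinner (Y z x) y) \<le> norm z * norm x * norm y"
    proof (rule field_le_epsilon)
      fix e :: real assume e: "0 < e"
      \<comment> \<open>The scalar lemma asks for a strict bound by \<open>1\<close>; adding
        \<open>e\<close> secures it, also when \<open>norm x * norm y = 0\<close>, and
        \<open>e\<close> is arbitrary.\<close>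
      define m where "m = norm x * norm y + e"
      have m: "0 < m" using e by (simp add: m_def add_nonneg_pos)
      have "cmod (cinner (Y z x) y / m) \<le> norm z"
      proof (rule Schwarz_Lemma(1)[OF _ _ _ z])
        show "(\<lambda>z. cinner (Y z x) y / m) holomorphic_on ball 0 1"
          using weak m by (intro holomorphic_intros) (auto simp: weakly_holomorphic_def)
        show "cmod (cinner (Y w x) y / m) < 1" if "norm w < 1" for w
        proof -
          have "cmod (cinner (Y w x) y) \<le> norm x * norm y"
            using cauchy_schwarz[of "Y w x" y] mult_right_mono[OF le[OF that, of x] norm_ge_zero[of y]] by linarith
          also have "\<dots> < m" using e by (simp add: m_def)
          finally show ?thesis using m by (simp add: norm_divide)
        qed
      qed (simp add: Y0)
      then have "cmod (cinner (Y z x) y) \<le> norm z * m" using m by (simp add: norm_divide divide_le_eq)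
      also have "norm z * m \<le> norm z * norm x * norm y + e"
        using mult_left_le_one_le[of e "norm z"] z e by (simp add: m_def algebra_simps)
      finally show "cmod (cinner (Y z x) y) \<le> norm z * norm x * norm y + e" .
    qed
  qed simp
  define \<Psi> where "\<Psi> z = (if z = 0 then F else (\<lambda>x. (1 / z) *\<^sub>C Y z x))" for z
  have contr: "\<Psi> z \<in> contractions V V'" if z: "norm z < 1" for z
  proof (cases "z = 0")
    case False
    have "norm ((1 / z) *\<^sub>C Y z x) \<le> norm x" for x
      using schwarz[OF z, of x] False by (simp add: norm_scaleC norm_divide divide_le_eq mult.commute)
    then show ?thesis
      using False by (auto simp: contractions_iff[OF V] \<Psi>_def bop_scale bop z mem proj csub_scaleC[OF V'])
  next
    case True
    have "norm (F x) \<le> norm x" for x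
    proof (rule tendsto_upperbound[OF tendsto_norm[OF F(2)]])
      show "\<forall>\<^sub>F w in at 0. norm ((1 / w) *\<^sub>C Y w x) \<le> norm x"
        using near
      proof eventually_elim
        case (elim w)
        then show ?case
          using schwarz[of w x] by (simp add: norm_scaleC norm_divide divide_le_eq mult.commute)
      qed
    qed simp
    moreover have "F x \<in> V'" for x
    proof (rule Lim_in_closed_set[OF csub_closed[OF V'] _ _ F(2)])
      show "\<forall>\<^sub>F w in at 0. (1 / w) *\<^sub>C Y w x \<in> V'"
        using near by eventually_elim (intro csub_scaleC[OF V'] mem, simp)
    qed simp
    moreover have "F (orth_proj V x) = F x" for x
    proof (rule tendsto_unique[OF _ F(2)])
      have "\<forall>\<^sub>F w in at 0. (1 / w) *\<^sub>C Y w x = (1 / w) *\<^sub>C Y w (orth_proj V x)"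
        using near by eventually_elim (simp add: proj)
      then show "((\<lambda>w. (1 / w) *\<^sub>C Y w (orth_proj V x)) \<longlongrightarrow> F x) (at 0)"
        by (rule Lim_transform_eventually[OF F(2)])
    qed simp
    ultimately show ?thesis
      using True F(1) by (auto simp: contractions_iff[OF V] \<Psi>_def)
  qed
  have "weakly_holomorphic \<Psi>"
    unfolding weakly_holomorphic_def
  proof (intro allI)
    fix x y
    let ?g = "\<lambda>z. cinner (Y z x) y"
    have hol: "?g holomorphic_on ball 0 1" using weak by (simp add: weakly_holomorphic_def)
    have "(?g has_field_derivative cinner (F x) y) (at 0)"
      using cinner.tendsto[OF F(2)[of x] tendsto_const[of y]] by (simp add: has_field_derivative_iff Y0)
    then have "deriv ?g 0 = cinner (F x) y" by (rule DERIV_imp_deriv)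
    \<comment> \<open>The coefficient of \<open>\<Psi>\<close> is the difference quotient of
      \<open>?g\<close> at \<open>0\<close> with its singularity removed.\<close>
    then have "(\<lambda>z. cinner (\<Psi> z x) y) = (\<lambda>z. if z = 0 then deriv ?g 0 else (?g z - ?g 0) / (z - 0))"
      by (auto simp: \<Psi>_def Y0)
    then show "(\<lambda>z. cinner (\<Psi> z x) y) holomorphic_on ball 0 1"
      using pole_lemma_open[OF hol open_ball, of 0] by simp
  qed
  then have weak': "weakly_holomorphic (restrict \<Psi> (ball 0 1))"
    unfolding weakly_holomorphic_def
  proof (intro allI)
    fix x y
    assume "\<forall>x y. (\<lambda>z. cinner (\<Psi> z x) y) holomorphic_on ball 0 1"
    then have "(\<lambda>z. cinner (\<Psi> z x) y) holomorphic_on ball 0 1" by blast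
    then show "(\<lambda>z. cinner (restrict \<Psi> (ball 0 1) z x) y) holomorphic_on ball 0 1"
      by (rule holomorphic_transform) simp
  qed
  have "restrict \<Psi> (ball 0 1) \<in> schur_class V V'"
    unfolding schur_class_def
  proof (intro CollectI conjI)
    show "op_holomorphic (restrict \<Psi> (ball 0 1))"
    proof (rule weakly_holomorphic_imp_op_holomorphic[OF weak'])
      show "locally_bounded_on_disk (restrict \<Psi> (ball 0 1))"
        using contr by (intro locally_bounded_on_diskI[of 1]) (auto simp: contractions_iff[OF V])
    qed (use contr in \<open>auto simp: contractions_iff[OF V]\<close>)
  qed (use contr in auto)
  moreover have "Y z x = z *\<^sub>C restrict \<Psi> (ball 0 1) z x" if "z \<in> ball 0 1" for z x
    using that by (auto simp: \<Psi>_def Y0 scaleC_scaleC)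
  ultimately show ?thesis by blast
qed

lemma schur_class_intro:
  assumes V: "csub V" and contr: "\<And>z. norm z < 1 \<Longrightarrow> \<Theta> z \<in> contractions V V'" and weak: "weakly_holomorphic \<Theta>"
    and ext: "\<Theta> \<in> extensional (ball 0 1)"
  shows "\<Theta> \<in> schur_class V V'"
proof -
  have "op_holomorphic \<Theta>"
    using contr
    by (intro weakly_holomorphic_imp_op_holomorphic[OF weak] locally_bounded_on_diskI[of 1])
      (auto simp: contractions_iff[OF V])
  then show ?thesis using contr ext by (auto simp: schur_class_def PiE_def)
qed

lemma schur_classD:
  assumes V: "csub V" and \<Theta>: "\<Theta> \<in> schur_class V V'" and z: "norm z < 1"
  shows "\<Theta> z \<in> contractions V V'" "bop (\<Theta> z)" "\<Theta> z x \<in> V'" "\<Theta> z (orth_proj V x) = \<Theta> z x" "norm (\<Theta> z x) \<le> norm x"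
    "op_holomorphic \<Theta>"
proof -
  show c: "\<Theta> z \<in> contractions V V'" and "op_holomorphic \<Theta>" using \<Theta> z by (auto simp: schur_class_def)
  show "bop (\<Theta> z)" "\<Theta> z x \<in> V'" "\<Theta> z (orth_proj V x) = \<Theta> z x" "norm (\<Theta> z x) \<le> norm x"
    using c by (auto simp: contractions_iff[OF V])
qed

section \<open>The Schur step as a map between Schur classes\<close>

definition schur_step :: "'a::chilbert_space set \<Rightarrow> 'b::chilbert_space set \<Rightarrow> ('a \<Rightarrow> 'b) \<Rightarrow>
    (complex \<Rightarrow> 'a \<Rightarrow> 'b) \<Rightarrow> complex \<Rightarrow> 'a \<Rightarrow> 'b" where
  "schur_step L L' G \<Psi> = (\<lambda>z\<in>ball 0 1. \<lambda>x. G x + z *\<^sub>C defect_op L' (adj G)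
     (\<Psi> z (inv_into (defect_space L G) (\<lambda>u. u + z *\<^sub>C adj G (\<Psi> z u)) (defect_op L G x))))"

context contraction_between
begin

lemma T_DS: "u \<in> DS \<Longrightarrow> T u \<in> DS'"
proof -
  interpret a: contraction_between L' L "adj T" by (rule adjoint)
  show "u \<in> DS \<Longrightarrow> T u \<in> DS'" using a.adj_DS[of u] by (simp only: adj_adj_T)
qed

text \<open>The internal signal u of the loop u = D x - z adj T S u. The rotation of
  \<open>T\<close> maps the pair of x and z S u to the pair of the value of the step at x and u;
  contractivity and the block operator formula are read off from this.\<close>

definition feedback :: "complex \<Rightarrow> ('a \<Rightarrow> 'b) \<Rightarrow> 'a \<Rightarrow> 'a" where
  "feedback z S x = inv_into DS (\<lambda>u. u + z *\<^sub>C adj T (S u)) (D x)"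

context
  fixes z :: complex and S :: "'a \<Rightarrow> 'b"
  assumes z: "norm z < 1" and S: "S \<in> contractions DS DS'"
begin

lemma S_facts: "bop S" "S x \<in> DS'" "S (orth_proj DS x) = S x" "norm (S x) \<le> norm x"
  using S by (auto simp: contractions_iff[OF csub_DS])

lemma bop_loop: "bop (\<lambda>u. u + z *\<^sub>C adj T (S u))"
  by (intro bop_sum bop_ident bop_scale bop_compose[of "adj T" S] dual(13) S_facts(1))

lemma loop_bij: "bij_betw (\<lambda>u. u + z *\<^sub>C adj T (S u)) DS DS"
  and loop_below: "u \<in> DS \<Longrightarrow> (1 - norm z) * norm u \<le> norm (u + z *\<^sub>C adj T (S u))"
proof -
  have b: "bop (\<lambda>u. (- z) *\<^sub>C adj T (S u))"
    by (intro bop_scale bop_compose[of "adj T" S] dual(13) S_facts(1))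
  have m: "(- z) *\<^sub>C adj T (S v) \<in> DS" for v
    by (intro csub_scaleC[OF csub_DS] adj_DS S_facts(2))
  have n: "norm ((- z) *\<^sub>C adj T (S v)) \<le> norm z * norm v" for v
    unfolding norm_scaleC norm_minus_cancel
    by (intro mult_left_mono order_trans[OF dual(15) S_facts(4)]) simp
  have eq: "u - (- z) *\<^sub>C adj T (S u) = u + z *\<^sub>C adj T (S u)" for u by (simp add: scaleC.minus_left)
  show "bij_betw (\<lambda>u. u + z *\<^sub>C adj T (S u)) DS DS"
    using bij_betw_id_minus_contraction(1)[OF csub_DS b m norm_ge_zero z n] unfolding eq .
  show "u \<in> DS \<Longrightarrow> (1 - norm z) * norm u \<le> norm (u + z *\<^sub>C adj T (S u))"
    using bij_betw_id_minus_contraction(2)[OF csub_DS b m norm_ge_zero z n, of u] unfolding eq .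
qed

lemma feedback_mem: "feedback z S x \<in> DS"
  unfolding feedback_def using loop_bij D_mem_DS by (metis bij_betw_imp_surj_on inv_into_into)

lemma feedback_eq: "feedback z S x + z *\<^sub>C adj T (S (feedback z S x)) = D x"
  unfolding feedback_def
  using bij_betw_inv_into_right[OF loop_bij D_mem_DS[of x]] by simp

lemma feedback_unique: "u \<in> DS \<Longrightarrow> u + z *\<^sub>C adj T (S u) = D x \<Longrightarrow> u = feedback z S x"
  using loop_bij feedback_eq[of x] feedback_mem[of x] by (metis (mono_tags, lifting) bij_betw_def inj_onD)

lemma feedback_eq_inverse: "feedback z S x = subspace_inverse DS (\<lambda>u. u + z *\<^sub>C adj T (S u)) (D x)"
  by (simp add: feedback_def subspace_inverse_def orth_proj_id[OF csub_DS D_mem_DS])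

lemma loop_inverse:
  defines "Q \<equiv> subspace_inverse DS (\<lambda>u. u + z *\<^sub>C adj T (S u))"
  shows "Q x \<in> DS" "Q x + z *\<^sub>C adj T (S (Q x)) = orth_proj DS x"
    "v \<in> DS \<Longrightarrow> Q (v + z *\<^sub>C adj T (S v)) = v"
    "norm (Q x) \<le> inverse (1 - norm z) * norm x" "bop Q"
proof -
  have pos: "0 < 1 - norm z" using z by simp
  note inverse = bop_loop csub_DS loop_bij pos loop_below
  show "Q x \<in> DS" unfolding Q_def by (rule subspace_inverse_mem[OF inverse])
  show "Q x + z *\<^sub>C adj T (S (Q x)) = orth_proj DS x"
    unfolding Q_def by (rule subspace_inverse_right[OF inverse])
  show "v \<in> DS \<Longrightarrow> Q (v + z *\<^sub>C adj T (S v)) = v"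
    unfolding Q_def by (rule subspace_inverse_left[OF inverse])
  show "norm (Q x) \<le> inverse (1 - norm z) * norm x"
    unfolding Q_def by (rule subspace_inverse_norm[OF inverse])
  show "bop Q" unfolding Q_def by (rule bop_subspace_inverse[OF inverse])
qed

text \<open>The rotation sends x and z S u to the value and u. It is isometric on the projected
  inputs, and z S u is no longer than u, so the value is no longer than x.\<close>

lemma schur_step_point: "(\<lambda>x. T x + z *\<^sub>C D' (S (feedback z S x))) \<in> contractions L L'"
  unfolding contractions_iff[OF L]
proof (intro conjI allI subsetI)
  have "bop (feedback z S)"
    unfolding feedback_eq_inverse[abs_def] by (rule bop_compose[OF loop_inverse(5) bop_D])
  note b = bop_compose[OF dual(1) bop_compose[OF S_facts(1) this]]
  show "bop (\<lambda>x. T x + z *\<^sub>C D' (S (feedback z S x)))" by (intro bop_sum bop bop_scale b)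
  show "T (orth_proj L x) + z *\<^sub>C D' (S (feedback z S (orth_proj L x))) = T x + z *\<^sub>C D' (S (feedback z S x))" for x
    by (simp add: feedback_def T_proj D_proj)
  show "y \<in> L'" if "y \<in> range (\<lambda>x. T x + z *\<^sub>C D' (S (feedback z S x)))" for y
    using that by (auto intro!: csub_add[OF L'] csub_scaleC[OF L'] T_mem dual(6))
  fix x
  let ?u = "feedback z S x"
  have "D x - adj T (z *\<^sub>C S ?u) = ?u"
    unfolding bop_scaleC[OF dual(13)] using feedback_eq[of x] by (metis add_diff_cancel_right')
  then have "(norm (T x + D' (z *\<^sub>C S ?u)))\<^sup>2 + (norm ?u)\<^sup>2
      = (norm (orth_proj L x))\<^sup>2 + (norm (orth_proj L' (z *\<^sub>C S ?u)))\<^sup>2"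
    using rotation_isometry[of x "z *\<^sub>C S ?u"] by simp
  moreover have "norm (orth_proj L' (z *\<^sub>C S ?u)) \<le> norm ?u"
  proof -
    have "norm z * norm (S ?u) \<le> 1 * norm ?u" by (intro mult_mono S_facts(4)) (use z in auto)
    then show ?thesis using orth_proj_norm[OF L', of "z *\<^sub>C S ?u"] by (simp add: norm_scaleC)
  qed
  then have "(norm (orth_proj L' (z *\<^sub>C S ?u)))\<^sup>2 \<le> (norm ?u)\<^sup>2" by (intro power_mono) auto
  moreover have "(norm (orth_proj L x))\<^sup>2 \<le> (norm x)\<^sup>2" by (intro power_mono orth_proj_norm[OF L]) auto
  ultimately have "(norm (T x + D' (z *\<^sub>C S ?u)))\<^sup>2 \<le> (norm x)\<^sup>2" by linarith
  then have "norm (T x + D' (z *\<^sub>C S ?u)) \<le> norm x" by (rule power2_le_imp_le) simp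
  then show "norm (T x + z *\<^sub>C D' (S ?u)) \<le> norm x" by (simp add: bop_scaleC[OF dual(1)])
qed

end

lemma schur_step_eq: "norm z < 1 \<Longrightarrow> schur_step L L' T \<Psi> z x = T x + z *\<^sub>C D' (\<Psi> z (feedback z (\<Psi> z) x))"
  by (simp add: schur_step_def feedback_def)

text \<open>Contractivity is a pointwise matter. For analyticity the value is composed of strongly
  differentiable factors, the loop inverse being covered by
  \<open>vec_differentiable_inverse\<close>; weak holomorphy then suffices by
  \<open>schur_class_intro\<close>.\<close>

lemma schur_step_schur_class:
  assumes \<Psi>: "\<Psi> \<in> schur_class DS DS'"
  shows "schur_step L L' T \<Psi> \<in> schur_class L L'"
proof (rule schur_class_intro[OF L])
  note \<Psi>D = schur_classD[OF csub_DS \<Psi>]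
  show "schur_step L L' T \<Psi> z \<in> contractions L L'" if "norm z < 1" for z
    using schur_step_point[OF that \<Psi>D(1)[OF that]] that by (simp add: schur_step_def feedback_def)
  show "schur_step L L' T \<Psi> \<in> extensional (ball 0 1)" by (simp add: schur_step_def)
  let ?A = "\<lambda>z u. u + z *\<^sub>C adj T (\<Psi> z u)"
  let ?Q = "\<lambda>z. subspace_inverse DS (?A z)"
  have \<Psi>_lb: "locally_bounded_on_disk \<Psi>"
    by (intro locally_bounded_on_diskI[of 1]) (auto simp: \<Psi>D)
  have Q_lb: "locally_bounded_on_disk ?Q"
    unfolding locally_bounded_on_disk_def
  proof (intro allI impI)
    fix \<rho> :: real assume \<rho>: "\<rho> < 1"
    have "norm (?Q z x) \<le> inverse (1 - \<rho>) * norm x" if z: "norm z \<le> \<rho>" for z x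
    proof -
      have z1: "norm z < 1" using z \<rho> by simp
      have "norm (?Q z x) \<le> inverse (1 - norm z) * norm x"
        by (rule loop_inverse(4)[OF z1 \<Psi>D(1)[OF z1]])
      also have "\<dots> \<le> inverse (1 - \<rho>) * norm x"
        using z \<rho> by (intro mult_right_mono le_imp_inverse_le) auto
      finally show ?thesis .
    qed
    then show "\<exists>M\<ge>0. \<forall>z. norm z \<le> \<rho> \<longrightarrow> (\<forall>x. norm (?Q z x) \<le> M * norm x)"
      using \<rho> by (intro exI[of _ "inverse (1 - \<rho>)"]) auto
  qed
  have "vec_differentiable (\<lambda>z. schur_step L L' T \<Psi> z x) z" if z: "norm z < 1" for z x
  proof -
    have \<Psi>_diff: "vec_differentiable (\<lambda>w. \<Psi> w u) z" for u
      by (rule op_holomorphic_vec_differentiable[OF \<Psi>D(6)[OF z] z \<Psi>D(2)])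
    have A_diff: "vec_differentiable (\<lambda>w. ?A w u) z" for u
      by (intro vec_differentiable_add vec_differentiable_const vec_differentiable_mult_ident
          vec_differentiable_bop[OF dual(13)] \<Psi>_diff)
    have Q_diff: "vec_differentiable (\<lambda>w. ?Q w u) z" for u
    proof (rule vec_differentiable_inverse[where A = ?A and V = DS, OF _ Q_lb A_diff])
      fix w :: complex assume w: "norm w < 1"
      note lw = loop_inverse[OF w \<Psi>D(1)[OF w]]
      note lz = loop_inverse[OF z \<Psi>D(1)[OF z]]
      show "bop (?Q w)" by (rule lw(5))
      show "v \<in> DS \<Longrightarrow> ?Q w (?A w v) = v" for v by (rule lw(3))
      fix a
      have "?Q w (?A z (?Q z a)) = ?Q w a"
        by (simp add: lz(2)) (simp add: subspace_inverse_def orth_proj_id[OF csub_DS orth_proj(1)[OF csub_DS]])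
      then show "?Q z a \<in> DS \<and> ?Q w (?A z (?Q z a)) = ?Q w a" using lz(1) by blast
    qed (rule z)
    have "vec_differentiable (\<lambda>w. T x + w *\<^sub>C D' (\<Psi> w (?Q w (D x)))) z"
      by (intro vec_differentiable_add vec_differentiable_const vec_differentiable_mult_ident
          vec_differentiable_bop[OF dual(1)] vec_differentiable_apply[OF \<Psi>D(2) \<Psi>_lb \<Psi>_diff Q_diff z])
    then obtain d where d: "((\<lambda>w. (1 / (w - z)) *\<^sub>C ((T x + w *\<^sub>C D' (\<Psi> w (?Q w (D x)))) - (T x + z *\<^sub>C D' (\<Psi> z (?Q z (D x)))))) \<longlongrightarrow> d) (at z)"
      by (auto simp: vec_differentiable_def)
    have eq: "schur_step L L' T \<Psi> w x = T x + w *\<^sub>C D' (\<Psi> w (?Q w (D x)))" if "norm w < 1" for w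
      by (simp only: schur_step_eq[OF that] feedback_eq_inverse[OF that \<Psi>D(1)[OF that]])
    have "\<forall>\<^sub>F w in at z. w \<in> ball 0 1" using z by (intro eventually_at_in_open') auto
    then have "\<forall>\<^sub>F w in at z. (1 / (w - z)) *\<^sub>C ((T x + w *\<^sub>C D' (\<Psi> w (?Q w (D x)))) - (T x + z *\<^sub>C D' (\<Psi> z (?Q z (D x)))))
        = (1 / (w - z)) *\<^sub>C (schur_step L L' T \<Psi> w x - schur_step L L' T \<Psi> z x)"
      by eventually_elim (simp add: eq z)
    from Lim_transform_eventually[OF d this] show ?thesis by (auto simp: vec_differentiable_def)
  qed
  then show "weakly_holomorphic (schur_step L L' T \<Psi>)"
    unfolding weakly_holomorphic_def by (intro allI vec_differentiable_cinner)
qed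

lemma schur_step_0: "schur_step L L' T \<Psi> 0 = T"
  by (auto simp: schur_step_def)

text \<open>Equal values force equal outputs of the two loops because \<open>D'\<close> is injective
  on \<open>DS'\<close>, and then equal signals. So both functions agree on the image under
  \<open>Q\<close> of the range of \<open>D\<close>, which is dense in \<open>DS\<close>. Division
  by \<open>z\<close> excludes \<open>0\<close>, where continuity decides.\<close>

lemma schur_step_inj:
  assumes \<Psi>: "\<Psi> \<in> schur_class DS DS'" and \<Phi>: "\<Phi> \<in> schur_class DS DS'"
    and eq: "schur_step L L' T \<Psi> = schur_step L L' T \<Phi>"
  shows "\<Psi> = \<Phi>"
proof -
  note \<Psi>D = schur_classD[OF csub_DS \<Psi>] and \<Phi>D = schur_classD[OF csub_DS \<Phi>]
  have nonzero: "\<Psi> z a = \<Phi> z a" if z: "norm z < 1" "z \<noteq> 0" for z a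
  proof -
    define Q where "Q = subspace_inverse DS (\<lambda>u. u + z *\<^sub>C adj T (\<Psi> z u))"
    note loop = loop_inverse[OF z(1) \<Psi>D(1)[OF z(1)], folded Q_def]
    have fb: "\<Psi> z (Q (D x)) = \<Phi> z (Q (D x))" for x
    proof -
      let ?u = "feedback z (\<Psi> z) x" and ?v = "feedback z (\<Phi> z) x"
      have "z *\<^sub>C D' (\<Psi> z ?u) = z *\<^sub>C D' (\<Phi> z ?v)"
        using fun_cong[OF fun_cong[OF eq, of z], of x] by (simp add: schur_step_eq[OF z(1)])
      then have "(1 / z) *\<^sub>C z *\<^sub>C D' (\<Psi> z ?u) = (1 / z) *\<^sub>C z *\<^sub>C D' (\<Phi> z ?v)" by simp
      then have "D' (\<Psi> z ?u - \<Phi> z ?v) = 0"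
        using z by (simp add: scaleC_scaleC bop_diff[OF dual(1)])
      moreover have "\<Psi> z ?u - \<Phi> z ?v \<in> DS'"
        by (intro csub_diff[OF dual(9)] \<Psi>D(3) \<Phi>D(3) z)
      ultimately have same: "\<Psi> z ?u = \<Phi> z ?v" using dual(11)[of "\<Psi> z ?u - \<Phi> z ?v"] by simp
      have "?u + z *\<^sub>C adj T (\<Psi> z ?u) = ?v + z *\<^sub>C adj T (\<Phi> z ?v)"
        by (simp only: feedback_eq[OF z(1) \<Psi>D(1)[OF z(1)]] feedback_eq[OF z(1) \<Phi>D(1)[OF z(1)]])
      then have "?u = ?v" by (simp add: same)
      then show ?thesis
        using same by (simp add: Q_def feedback_eq_inverse[OF z(1) \<Psi>D(1)[OF z(1)], symmetric])
    qed
    have "\<Psi> z (Q b) = \<Phi> z (Q b)" if "b \<in> DS" for b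
      using closure_range_eqI[OF bop_compose[OF \<Psi>D(2)[OF z(1)] loop(5)] bop_compose[OF \<Phi>D(2)[OF z(1)] loop(5)] fb]
        that by (simp add: defect_space_def)
    \<comment> \<open>\<open>Q\<close> maps this vector back to
      \<open>orth_proj DS a\<close>.\<close>
    from this[of "orth_proj DS a + z *\<^sub>C adj T (\<Psi> z (orth_proj DS a))"]
    have "\<Psi> z (orth_proj DS a) = \<Phi> z (orth_proj DS a)"
      using loop(3)[OF orth_proj(1)[OF csub_DS]]
      by (simp add: csub_add[OF csub_DS] csub_scaleC[OF csub_DS] orth_proj(1)[OF csub_DS] adj_DS \<Psi>D(3)[OF z(1)])
    then show ?thesis by (simp only: \<Psi>D(4)[OF z(1)] \<Phi>D(4)[OF z(1)])
  qed
  have zero: "\<Psi> 0 a = \<Phi> 0 a" for a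
  proof (rule tendsto_unique)
    have n0: "norm (0::complex) < 1" by simp
    show "((\<lambda>w. \<Psi> w a) \<longlongrightarrow> \<Psi> 0 a) (at 0)"
      by (rule vec_differentiable_tendsto[OF op_holomorphic_vec_differentiable[OF \<Psi>D(6)[OF n0] n0 \<Psi>D(2)]])
    have lim: "((\<lambda>w. \<Phi> w a) \<longlongrightarrow> \<Phi> 0 a) (at 0)"
      by (rule vec_differentiable_tendsto[OF op_holomorphic_vec_differentiable[OF \<Phi>D(6)[OF n0] n0 \<Phi>D(2)]])
    have "\<forall>\<^sub>F w in at 0. \<Phi> w a = \<Psi> w a"
      unfolding eventually_at using nonzero by (intro exI[of _ 1]) auto
    then show "((\<lambda>w. \<Psi> w a) \<longlongrightarrow> \<Phi> 0 a) (at 0)" by (rule Lim_transform_eventually[OF lim])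
  qed simp
  show ?thesis
  proof (rule PiE_ext)
    show "\<Psi> \<in> ball 0 1 \<rightarrow>\<^sub>E contractions DS DS'" "\<Phi> \<in> ball 0 1 \<rightarrow>\<^sub>E contractions DS DS'"
      using \<Psi> \<Phi> by (auto simp: schur_class_def)
    show "\<Psi> z = \<Phi> z" if "z \<in> ball 0 1" for z
      using that nonzero zero by (cases "z = 0") auto
  qed
qed

end

section \<open>Surjectivity of the Schur step\<close>

context contraction_between
begin

text \<open>If \<open>R = T + D' X D\<close> is a contraction, then the solution \<open>Y = X (I - T\<^sup>* X)\<^sup>-\<^sup>1\<close> of
  \<open>X = Y (I + T\<^sup>* Y)\<^sup>-\<^sup>1\<close> is one too, because the rotation maps \<open>(x, X D x)\<close> to
  \<open>(R x, (I - T\<^sup>* X) D x)\<close>.\<close>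

lemma factor_norm_le:
  assumes R: "R \<in> contractions L L'" and X: "X \<in> bounded_ops DS DS'"
    and fac: "\<And>x. D' (X (D x)) = R x - T x" and a: "a \<in> DS"
  shows "norm (X a) \<le> norm (a - adj T (X a))"
proof -
  have X': "bop X" "X v \<in> DS'" for v using X by (auto simp: bounded_ops_iff[OF csub_DS])
  have R': "R (orth_proj L x) = R x" "norm (R x) \<le> norm x" for x
    using R by (auto simp: contractions_iff[OF L])
  show ?thesis
  proof (rule closure_range_le[of X "\<lambda>a. a - adj T (X a)" D])
    show "bop X" by (rule X')
    show "bop (\<lambda>a. a - adj T (X a))" by (intro bop_difference bop_ident bop_compose[OF dual(13)] X')
    show "a \<in> closure (range D)" using a by (simp add: defect_space_def)
    fix x
    let ?v = "X (D x)"
    have v: "?v \<in> L'" using X'(2) dual(8) by blast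
    have "R x = T x + D' ?v" by (simp add: fac)
    then have "(norm (R x))\<^sup>2 + (norm (D x - adj T ?v))\<^sup>2 = (norm (orth_proj L x))\<^sup>2 + (norm ?v)\<^sup>2"
      using rotation_isometry[of x ?v] by (simp only: orth_proj_id[OF L' v])
    moreover have "(norm (R x))\<^sup>2 \<le> (norm (orth_proj L x))\<^sup>2"
      using R'(2)[of "orth_proj L x"] by (intro power_mono) (auto simp: R'(1))
    ultimately have "(norm ?v)\<^sup>2 \<le> (norm (D x - adj T ?v))\<^sup>2" by linarith
    then show "norm ?v \<le> norm (D x - adj T ?v)" by (rule power2_le_imp_le) simp
  qed
qed

text \<open>\<open>X\<close> may be large, so no perturbation argument applies. With P = I - adj T
  X, \<open>factor_norm_le\<close> gives norm a <= 2 norm (P a), so P is injective with closed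
  range. A vector r of \<open>DS\<close> orthogonal to that range satisfies
  \<open>r = adj X (T r)\<close>, and the same estimate for the adjoints, applied to
  \<open>T r\<close>, forces \<open>r = 0\<close>.\<close>

lemma factor_bij:
  assumes R: "R \<in> contractions L L'" and X: "X \<in> bounded_ops DS DS'"
    and fac: "\<And>x. D' (X (D x)) = R x - T x"
  shows "bij_betw (\<lambda>a. a - adj T (X a)) DS DS" and "\<And>a. a \<in> DS \<Longrightarrow> 1/2 * norm a \<le> norm (a - adj T (X a))"
proof -
  interpret a: contraction_between L' L "adj T" by (rule adjoint)
  let ?P = "\<lambda>a. a - adj T (X a)"
  have X': "bop X" "X v \<in> DS'" "X (orth_proj DS v) = X v" for v
    using X by (auto simp: bounded_ops_iff[OF csub_DS])
  have bR: "bop R" using R by (auto simp: contractions_iff[OF L])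
  have P: "bop ?P" by (intro bop_difference bop_ident bop_compose[OF dual(13)] X')
  have P_mem: "?P a \<in> DS" if "a \<in> DS" for a by (intro csub_diff[OF csub_DS] that adj_DS X')
  show below: "1/2 * norm a \<le> norm (?P a)" if "a \<in> DS" for a
  proof -
    have "norm a \<le> norm (?P a) + norm (adj T (X a))" using norm_triangle_ineq[of "?P a" "adj T (X a)"] by simp
    also have "norm (adj T (X a)) \<le> norm (?P a)"
      using dual(15)[of "X a"] factor_norm_le[OF R X fac that] by linarith
    finally show ?thesis by simp
  qed
  have adj_X: "adj X \<in> bounded_ops DS' DS" by (rule adj_bounded_ops[OF csub_DS dual(9) X])
  have adj_X_mem: "adj X v \<in> DS" for v using adj_X by (auto simp: bounded_ops_iff[OF dual(9)])
  have adj_fac: "D (adj X (D' y)) = adj R y - adj T y" for y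
  proof (rule cinner_ext)
    fix x
    have "cinner (D (adj X (D' y))) x = cinner y (D' (X (D x)))"
      by (simp only: D_self_adjoint cinner_adj'[OF X'(1)] dual(2))
    also have "\<dots> = cinner (adj R y - adj T y) x"
      by (simp add: fac cinner_adj'[OF bR] cinner_adj'[OF bop])
    finally show "cinner (D (adj X (D' y))) x = cinner (adj R y - adj T y) x" .
  qed
  have adj_inj: "r = 0" if r: "r \<in> DS" "r = adj X (T r)" for r
  proof -
    \<comment> \<open>After inserting \<open>r = adj X (T r)\<close> the right-hand side is the norm
      of \<open>T r - T r\<close>.\<close>
    have "norm (adj X (T r)) \<le> norm (T r - adj (adj T) (adj X (T r)))"
      by (rule a.factor_norm_le[OF adj_contractions[OF L L' R]])
        (simp_all only: adj_adj_T adj_X adj_fac T_DS[OF r(1)])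
    then show "r = 0" using r(2) by (simp add: adj_adj_T)
  qed
  have M: "csub (?P ` DS)" by (rule csub_image_bounded_below[OF P csub_DS _ below]) auto
  show "bij_betw ?P DS DS"
    unfolding bij_betw_def
  proof (intro conjI equalityI subsetI)
    show "inj_on ?P DS"
    proof (rule inj_onI)
      fix u v assume uv: "u \<in> DS" "v \<in> DS" "?P u = ?P v"
      have "1/2 * norm (u - v) \<le> norm (?P (u - v))" by (rule below[OF csub_diff[OF csub_DS uv(1,2)]])
      also have "?P (u - v) = 0" using uv(3) bop_diff[OF P, of u v] by simp
      finally show "u = v" by simp
    qed
    show "b \<in> DS" if "b \<in> ?P ` DS" for b using that P_mem by blast
    fix b assume b: "b \<in> DS"
    define r where "r = b - orth_proj (?P ` DS) b"
    obtain a where "a \<in> DS" "orth_proj (?P ` DS) b = ?P a" using orth_proj(1)[OF M, of b] by (elim imageE)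
    then have r: "r \<in> DS" unfolding r_def by (simp only: csub_diff[OF csub_DS b] P_mem)
    have "adj X (T r) = r"
    proof -
      have d: "r - adj X (T r) \<in> DS" by (intro csub_diff[OF csub_DS r] adj_X_mem)
      have "cinner (r - adj X (T r)) c = cinner r (?P c)" for c
        by (simp add: cinner_adj'[OF X'(1)] cinner_adj[OF bop])
      moreover have "cinner r (?P c) = 0" if "c \<in> DS" for c
        unfolding r_def by (rule orth_proj(2)[OF M]) (use that in blast)
      ultimately have "cinner (r - adj X (T r)) c = 0" if "c \<in> DS" for c using that by simp
      from this[OF d] show ?thesis by (simp only: cinner_self_zero right_minus_eq)
    qed
    then have "r = 0" using adj_inj r by metis
    then have "b = orth_proj (?P ` DS) b" by (simp add: r_def)
    then show "b \<in> ?P ` DS" using orth_proj(1)[OF M] by metis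
  qed
qed

text \<open>The weight \<open>\<kappa>\<close> enters only qualitatively, to construct
  \<open>X\<close> and to make it locally bounded; the second conclusion is free of
  \<open>\<kappa>\<close>, which is what permits a later limit. The Schwarz lemma is applied to
  \<open>Y\<close>, the product of \<open>X\<close> with the inverse of I - adj T X, which vanishes
  at \<open>0\<close>.\<close>

lemma schur_factor:
  assumes \<Theta>: "\<Theta> \<in> schur_class L L'" and \<Theta>0: "\<Theta> 0 = T"
    and \<kappa>: "\<And>z. norm z < 1 \<Longrightarrow> 0 \<le> \<kappa> z" "\<And>\<rho>. \<rho> < 1 \<Longrightarrow> \<exists>M\<ge>0. \<forall>z. norm z \<le> \<rho> \<longrightarrow> \<kappa> z \<le> M"
    and bound: "\<And>z x y. norm z < 1 \<Longrightarrow> cmod (cinner (\<Theta> z x - T x) y) \<le> \<kappa> z * norm (D x) * norm (D' y)"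
  shows "\<exists>\<Psi>\<in>schur_class DS DS'. schur_step L L' T \<Psi> = \<Theta>"
    and "norm z < 1 \<Longrightarrow> cmod (cinner (\<Theta> z x - T x) y) \<le> norm z / (1 - norm z) * norm (D x) * norm (D' y)"
proof -
  note \<Theta>D = schur_classD[OF L \<Theta>]
  have "\<exists>X\<in>bounded_ops DS DS'. (\<forall>a. norm (X a) \<le> \<kappa> z * norm a) \<and>
      (\<forall>x y. cinner (X (D x)) (D' y) = cinner (\<Theta> z x - T x) y)" if z: "norm z < 1" for z
    unfolding defect_space_def
  proof (rule form_factor[OF _ _ _ _ bound[OF z] \<kappa>(1)[OF z] bop_D dual(1)])
    show "cinner (\<Theta> z (x + x') - T (x + x')) y = cinner (\<Theta> z x - T x) y + cinner (\<Theta> z x' - T x') y" for x x' y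
      by (simp add: bop_add[OF bop] bop_add[OF \<Theta>D(2)[OF z]])
    show "cinner (\<Theta> z (c *\<^sub>C x) - T (c *\<^sub>C x)) y = c * cinner (\<Theta> z x - T x) y" for c x y
      by (simp add: bop_scaleC[OF bop] bop_scaleC[OF \<Theta>D(2)[OF z]] right_diff_distrib)
  qed (simp_all add: right_diff_distrib)
  then obtain X where X: "\<And>z. norm z < 1 \<Longrightarrow> X z \<in> bounded_ops DS DS'"
    "\<And>z a. norm z < 1 \<Longrightarrow> norm (X z a) \<le> \<kappa> z * norm a"
    "\<And>z x y. norm z < 1 \<Longrightarrow> cinner (X z (D x)) (D' y) = cinner (\<Theta> z x - T x) y"
    by metis
  have bX: "bop (X z)" and X_mem: "X z a \<in> DS'" and X_proj: "X z (orth_proj DS a) = X z a" if "norm z < 1" for z a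
    using X(1)[OF that] by (auto simp: bounded_ops_iff[OF csub_DS])
  have fac: "D' (X z (D x)) = \<Theta> z x - T x" if z: "norm z < 1" for z x
    by (rule cinner_ext) (simp only: dual(2) X(3)[OF z])
  have X_lb: "locally_bounded_on_disk X"
    unfolding locally_bounded_on_disk_def
  proof (intro allI impI)
    fix \<rho> :: real assume \<rho>: "\<rho> < 1"
    then obtain M where M: "0 \<le> M" "\<And>z. norm z \<le> \<rho> \<Longrightarrow> \<kappa> z \<le> M" using \<kappa>(2) by blast
    have "norm (X z x) \<le> M * norm x" if "norm z \<le> \<rho>" for z x
      using X(2)[of z x] mult_right_mono[OF M(2)[OF that] norm_ge_zero[of x]] that \<rho> by linarith
    then show "\<exists>M\<ge>0. \<forall>z. norm z \<le> \<rho> \<longrightarrow> (\<forall>x. norm (X z x) \<le> M * norm x)" using M(1) by blast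
  qed
  have "weakly_holomorphic X"
    unfolding weakly_holomorphic_def
  proof (intro allI)
    fix a b
    have "(\<lambda>z. cinner (X z (orth_proj DS a)) (orth_proj DS' b)) holomorphic_on ball 0 1"
    proof (rule weakly_holomorphic_closure[OF bX X_lb])
      fix x y
      have "(\<lambda>z. cinner (\<Theta> z x) y - cinner (T x) y) holomorphic_on ball 0 1"
        using op_holomorphic_weakly[OF \<Theta>D(6)[of 0] \<Theta>D(2)]
        by (intro holomorphic_intros) (auto simp: weakly_holomorphic_def)
      then show "(\<lambda>z. cinner (X z (D x)) (D' y)) holomorphic_on ball 0 1"
        by (rule holomorphic_transform) (simp add: X(3))
    qed (use orth_proj(1)[OF csub_DS] orth_proj(1)[OF dual(9)] in \<open>simp_all add: defect_space_def\<close>)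
    then show "(\<lambda>z. cinner (X z a) b) holomorphic_on ball 0 1"
    proof (rule holomorphic_transform)
      fix z :: complex assume "z \<in> ball 0 1"
      then have z: "norm z < 1" by simp
      show "cinner (X z (orth_proj DS a)) (orth_proj DS' b) = cinner (X z a) b"
        by (simp only: X_proj[OF z] orth_proj_cinner[OF dual(9), symmetric] orth_proj_id[OF dual(9) X_mem[OF z]])
    qed
  qed
  from weakly_holomorphic_imp_op_holomorphic[OF this X_lb bX]
  have X_diff: "vec_differentiable (\<lambda>w. X w a) z" if "norm z < 1" for z a
    using that bX by (rule op_holomorphic_vec_differentiable)
  let ?P = "\<lambda>z a. a - adj T (X z a)"
  let ?Q = "\<lambda>z. subspace_inverse DS (?P z)"
  have P: "bop (?P z)" if "norm z < 1" for z
    by (intro bop_difference bop_ident bop_compose[OF dual(13)] bX that)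
  have half: "(0::real) < 1/2" by simp
  have Q: "?Q z a \<in> DS" "?P z (?Q z a) = orth_proj DS a" "v \<in> DS \<Longrightarrow> ?Q z (?P z v) = v"
    "norm (?Q z a) \<le> inverse (1/2) * norm a" "bop (?Q z)" if z: "norm z < 1" for z a v
  proof -
    note inverse = P[OF z] csub_DS factor_bij(1)[OF \<Theta>D(1)[OF z] X(1)[OF z] fac[OF z]] half
      factor_bij(2)[OF \<Theta>D(1)[OF z] X(1)[OF z] fac[OF z]]
    show "?Q z a \<in> DS" by (rule subspace_inverse_mem[OF inverse])
    show "?P z (?Q z a) = orth_proj DS a" by (rule subspace_inverse_right[OF inverse])
    show "v \<in> DS \<Longrightarrow> ?Q z (?P z v) = v" by (rule subspace_inverse_left[OF inverse])
    show "norm (?Q z a) \<le> inverse (1/2) * norm a" by (rule subspace_inverse_norm[OF inverse])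
    show "bop (?Q z)" by (rule bop_subspace_inverse[OF inverse])
  qed
  define Y where "Y z a = X z (?Q z a)" for z a
  have Y_contr: "Y z \<in> contractions DS DS'" if z: "norm z < 1" for z
    unfolding contractions_iff[OF csub_DS]
  proof (intro conjI allI)
    show "bop (Y z)" unfolding Y_def[abs_def] by (rule bop_compose[OF bX[OF z] Q(5)[OF z]])
    show "range (Y z) \<subseteq> DS'" using X_mem[OF z] by (auto simp: Y_def)
    show "Y z (orth_proj DS a) = Y z a" for a
      by (simp add: Y_def subspace_inverse_def orth_proj_id[OF csub_DS orth_proj(1)[OF csub_DS]])
    show "norm (Y z a) \<le> norm a" for a
    proof -
      have "norm (Y z a) \<le> norm (?P z (?Q z a))"
        unfolding Y_def by (rule factor_norm_le[OF \<Theta>D(1)[OF z] X(1)[OF z] fac[OF z] Q(1)[OF z]])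
      then show ?thesis using orth_proj_norm[OF csub_DS, of a] by (simp only: Q(2)[OF z])
    qed
  qed
  have "vec_differentiable (\<lambda>w. Y w a) z" if z: "norm z < 1" for z a
  proof -
    have P_diff: "vec_differentiable (\<lambda>w. ?P w u) z" for u
    proof -
      have "vec_differentiable (\<lambda>w. - adj T (X w u)) z"
        using vec_differentiable_bop[OF bop_scale[OF dual(13), of "-1"] X_diff[OF z, of u]]
        by (simp add: scaleC.minus_left)
      from vec_differentiable_add[OF vec_differentiable_const this] show ?thesis by simp
    qed
    have Q_lb: "locally_bounded_on_disk ?Q"
      by (rule locally_bounded_on_diskI[OF _ Q(4)]) auto
    have Q_diff: "vec_differentiable (\<lambda>w. ?Q w a) z" for a
    proof (rule vec_differentiable_inverse[where A = ?P and V = DS, OF Q(5) Q_lb P_diff Q(3) _ z])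
      fix w :: complex and a assume w: "norm w < 1"
      have "?Q w (?P z (?Q z a)) = ?Q w a"
        by (simp only: Q(2)[OF z]) (simp add: subspace_inverse_def orth_proj_id[OF csub_DS orth_proj(1)[OF csub_DS]])
      then show "?Q z a \<in> DS \<and> ?Q w (?P z (?Q z a)) = ?Q w a" using Q(1)[OF z] by blast
    qed
    show ?thesis
      unfolding Y_def by (rule vec_differentiable_apply[OF bX X_lb X_diff[OF z] Q_diff z])
  qed
  then have Y_weak: "weakly_holomorphic Y"
    unfolding weakly_holomorphic_def by (intro allI vec_differentiable_cinner)
  have n0: "norm (0::complex) < 1" by simp
  have X0: "X 0 a = 0" for a
  proof -
    have "X 0 (D x) = 0" for x
      by (rule dual(11)[OF X_mem[OF n0]]) (simp add: fac[OF n0] \<Theta>0)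
    then have "X 0 (orth_proj DS a) = 0"
      using closure_range_eqI[OF bX[OF n0] bop_zero, of D] orth_proj(1)[OF csub_DS, of a]
      by (simp add: defect_space_def)
    then show ?thesis by (simp only: X_proj[OF n0])
  qed
  obtain \<Psi> where \<Psi>: "\<Psi> \<in> schur_class DS DS'" "\<And>z a. norm z < 1 \<Longrightarrow> Y z a = z *\<^sub>C \<Psi> z a"
    using op_schwarz[OF csub_DS dual(9) Y_contr Y_weak] X0 by (auto simp: Y_def)
  note \<Psi>D = schur_classD[OF csub_DS \<Psi>(1)]
  have YP: "Y z (?P z a) = X z a" if "norm z < 1" "a \<in> DS" for z a
    using that by (simp only: Y_def Q(3))
  have "schur_step L L' T \<Psi> z = \<Theta> z" if "z \<in> ball 0 1" for z
  proof
    fix x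
    have z: "norm z < 1" using that by simp
    \<comment> \<open>For a = D x the vector a - adj T X a solves the loop equation of
      \<open>\<Psi>\<close>, because \<open>Y\<close>, which is z times \<open>\<Psi>\<close>, maps
      it to X a.\<close>
    have "?P z (D x) + z *\<^sub>C adj T (\<Psi> z (?P z (D x))) = D x"
    proof -
      have "z *\<^sub>C adj T (\<Psi> z (?P z (D x))) = adj T (Y z (?P z (D x)))"
        by (simp only: \<Psi>(2)[OF z] bop_scaleC[OF dual(13)])
      then show ?thesis by (simp add: YP[OF z D_mem_DS])
    qed
    moreover have "?P z (D x) \<in> DS" by (intro csub_diff[OF csub_DS D_mem_DS] adj_DS X_mem z)
    ultimately have fb: "feedback z (\<Psi> z) x = ?P z (D x)"
      using feedback_unique[OF z \<Psi>D(1)[OF z]] by metis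
    have "schur_step L L' T \<Psi> z x = T x + D' (Y z (?P z (D x)))"
      by (simp only: schur_step_eq[OF z] fb \<Psi>(2)[OF z] bop_scaleC[OF dual(1)])
    also have "\<dots> = \<Theta> z x" by (simp only: YP[OF z D_mem_DS] fac[OF z]) simp
    finally show "schur_step L L' T \<Psi> z x = \<Theta> z x" .
  qed
  moreover have "schur_step L L' T \<Psi> \<in> extensional (ball 0 1)" "\<Theta> \<in> extensional (ball 0 1)"
    using \<Theta> by (auto simp: schur_step_def schur_class_def PiE_def)
  ultimately have "schur_step L L' T \<Psi> = \<Theta>" by (metis extensionalityI)
  then show "\<exists>\<Psi>\<in>schur_class DS DS'. schur_step L L' T \<Psi> = \<Theta>" using \<Psi>(1) by blast
  assume z: "norm z < 1"
  have "norm (X z (D x)) \<le> norm z / (1 - norm z) * norm (D x)"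
  proof -
    let ?a = "D x"
    have "norm (X z ?a) = norm (Y z (?P z ?a))" by (simp only: YP[OF z D_mem_DS])
    also have "\<dots> \<le> norm z * norm (?P z ?a)"
      by (simp only: \<Psi>(2)[OF z] norm_scaleC) (intro mult_left_mono \<Psi>D(5) z norm_ge_zero)
    \<comment> \<open>\<open>X\<close> reappears on the right with weight |z| < 1 and is absorbed on
      the left, which produces the factor |z| / (1 - |z|).\<close>
    also have "\<dots> \<le> norm z * (norm ?a + norm (X z ?a))"
      using norm_triangle_ineq4[of ?a "adj T (X z ?a)"] dual(15)[of "X z ?a"]
      by (intro mult_left_mono) auto
    finally have "(1 - norm z) * norm (X z ?a) \<le> norm z * norm ?a" by (simp add: algebra_simps)
    then show ?thesis using z by (simp add: field_simps)
  qed
  then have "norm (X z (D x)) * norm (D' y) \<le> norm z / (1 - norm z) * norm (D x) * norm (D' y)"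
    by (rule mult_right_mono) simp
  then show "cmod (cinner (\<Theta> z x - T x) y) \<le> norm z / (1 - norm z) * norm (D x) * norm (D' y)"
    using cauchy_schwarz[of "X z (D x)" "D' y"] by (simp only: X(3)[OF z])
qed

text \<open>For \<open>r < 1\<close> the defect operators of \<open>r T\<close> are bounded below, so that the preceding lemma applies
  to \<open>r \<Theta>\<close>; its second conclusion survives the limit \<open>r \<rightarrow> 1\<close>.\<close>

lemma schur_pick_bound:
  assumes \<Theta>: "\<Theta> \<in> schur_class L L'" and \<Theta>0: "\<Theta> 0 = T" and z: "norm z < 1"
  shows "cmod (cinner (\<Theta> z x - T x) y) \<le> norm z / (1 - norm z) * norm (D x) * norm (D' y)"
proof -
  note \<Theta>D = schur_classD[OF L \<Theta>]
  let ?p = "(norm (orth_proj L x))\<^sup>2" and ?q = "(norm (orth_proj L' y))\<^sup>2"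
  \<comment> \<open>The defect operators of r T vary with r. Their norms at \<open>x\<close> and
    \<open>y\<close> are written as explicit square roots, so that the limit is one of real
    functions.\<close>
  have strict: "r * cmod (cinner (\<Theta> z x - T x) y) \<le> norm z / (1 - norm z)
      * sqrt (?p - r\<^sup>2 * (norm (T x))\<^sup>2) * sqrt (?q - r\<^sup>2 * (norm (adj T y))\<^sup>2)"
    if r: "0 < r" "r < 1" for r
  proof -
    define Tr where "Tr x = complex_of_real r *\<^sub>C T x" for x
    define \<Theta>r where "\<Theta>r = (\<lambda>z\<in>ball 0 1. \<lambda>x. complex_of_real r *\<^sub>C \<Theta> z x)"
    have shrink: "complex_of_real r *\<^sub>C v \<in> V'" if "v \<in> V'" "csub V'" for v :: 'b and V'
      by (rule csub_scaleC[OF that(2,1)])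
    have norm_shrink: "norm (complex_of_real r *\<^sub>C v) \<le> norm u" if "norm v \<le> norm u" for v :: 'b and u :: 'a
    proof -
      have "r * norm v \<le> 1 * norm u" using r that by (intro mult_mono) auto
      then show ?thesis using r by (simp add: norm_scaleC)
    qed
    have contr: "(\<lambda>x. complex_of_real r *\<^sub>C S x) \<in> contractions L L'" if "S \<in> contractions L L'" for S
      using that unfolding contractions_iff[OF L]
      by (intro conjI bop_scale) (auto intro: csub_scaleC[OF L'] norm_shrink)
    have Tr: "Tr \<in> contractions L L'" unfolding Tr_def[abs_def] by (rule contr[OF T])
    interpret r: contraction_between L L' Tr by unfold_locales (rule L L' Tr)+
    have adj_Tr: "adj Tr y = complex_of_real r *\<^sub>C adj T y" for y
      by (rule fun_cong[OF adj_eqI[OF r.bop]]) (simp add: Tr_def cinner_adj[OF bop])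
    have D_sq: "(norm (r.D x))\<^sup>2 = (norm (orth_proj L x))\<^sup>2 - r\<^sup>2 * (norm (T x))\<^sup>2" for x
      using r by (simp add: r.norm_D Tr_def norm_scaleC power_mult_distrib)
    have D'_sq: "(norm (r.D' y))\<^sup>2 = (norm (orth_proj L' y))\<^sup>2 - r\<^sup>2 * (norm (adj T y))\<^sup>2" for y
      using r by (simp add: r.dual(4) adj_Tr norm_scaleC power_mult_distrib)
    have r2: "r\<^sup>2 < 1" using r by (simp add: power_less_one_iff)
    \<comment> \<open>The norm of r T is at most r, so its squared defect operator is at least
      \<open>1 - r\<^sup>2\<close> times the identity on \<open>L\<close>; \<open>k\<close> is the
      resulting bound for the inverse of the defect operator.\<close>
    define k where "k = 1 / sqrt (1 - r\<^sup>2)"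
    have k: "0 < k" using r2 by (simp add: k_def)
    have root: "a \<le> k * b" if ab: "b\<^sup>2 = a\<^sup>2 - r\<^sup>2 * c\<^sup>2" "0 \<le> c" "c \<le> a" "0 \<le> b" for a b c :: real
    proof -
      have "r\<^sup>2 * c\<^sup>2 \<le> r\<^sup>2 * a\<^sup>2" using ab by (intro mult_left_mono power_mono) auto
      then have "(1 - r\<^sup>2) * a\<^sup>2 \<le> b\<^sup>2" using ab(1) by (simp add: left_diff_distrib)
      then have "sqrt ((1 - r\<^sup>2) * a\<^sup>2) \<le> sqrt (b\<^sup>2)" by (rule real_sqrt_le_mono)
      then have "sqrt (1 - r\<^sup>2) * a \<le> b" using ab(2-4) by (simp add: real_sqrt_mult)
      then show ?thesis using r2 by (simp add: k_def field_simps)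
    qed
    have below: "norm (orth_proj L x) \<le> k * norm (r.D x)" for x
      using T_norm[of "orth_proj L x"] by (intro root[OF D_sq]) (auto simp: T_proj)
    have below': "norm (orth_proj L' y) \<le> k * norm (r.D' y)" for y
      using dual(15)[of "orth_proj L' y"] by (intro root[OF D'_sq]) (auto simp: dual(16))
    have "\<Theta>r \<in> schur_class L L'"
    proof (rule schur_class_intro[OF L])
      show "\<Theta>r z \<in> contractions L L'" if "norm z < 1" for z
        using contr[OF \<Theta>D(1)[OF that]] that by (simp add: \<Theta>r_def)
      show "weakly_holomorphic \<Theta>r"
        unfolding weakly_holomorphic_def
      proof (intro allI)
        fix x y
        have "(\<lambda>z. complex_of_real r * cinner (\<Theta> z x) y) holomorphic_on ball 0 1"
          using op_holomorphic_weakly[OF \<Theta>D(6)[of 0] \<Theta>D(2)]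
          by (intro holomorphic_intros) (auto simp: weakly_holomorphic_def)
        then show "(\<lambda>z. cinner (\<Theta>r z x) y) holomorphic_on ball 0 1"
          by (rule holomorphic_transform) (simp add: \<Theta>r_def)
      qed
    qed (simp add: \<Theta>r_def)
    moreover have "\<Theta>r 0 = Tr" by (simp add: \<Theta>r_def Tr_def[abs_def] \<Theta>0)
    moreover have "0 \<le> 2 * k * k" using k by simp
    moreover have "\<exists>M\<ge>0. \<forall>z::complex. norm z \<le> \<rho> \<longrightarrow> 2 * k * k \<le> M" for \<rho>
      using k by (intro exI[of _ "2 * k * k"]) auto
    \<comment> \<open>The factor 2 bounds a difference of two contractions, and each of the two
      defect operators costs one factor \<open>k\<close>.\<close>
    moreover have "cmod (cinner (\<Theta>r z x - Tr x) y) \<le> 2 * k * k * norm (r.D x) * norm (r.D' y)"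
      if z: "norm z < 1" for z x y
    proof -
      let ?e = "\<Theta> z x - T x"
      have e: "?e \<in> L'" by (intro csub_diff[OF L'] \<Theta>D(3) T_mem z)
      have "norm ?e \<le> 2 * norm (orth_proj L x)"
        using norm_triangle_ineq4[of "\<Theta> z x" "T x"] \<Theta>D(5)[OF z, of "orth_proj L x"] T_norm[of "orth_proj L x"]
        by (simp add: \<Theta>D(4)[OF z] T_proj)
      moreover have "cinner ?e y = cinner ?e (orth_proj L' y)"
        by (metis orth_proj_cinner[OF L'] orth_proj_id[OF L' e])
      moreover have "cinner (\<Theta>r z x - Tr x) y = complex_of_real r * cinner ?e y"
        using z by (simp add: \<Theta>r_def Tr_def right_diff_distrib)
      ultimately have "cmod (cinner (\<Theta>r z x - Tr x) y) = r * cmod (cinner ?e (orth_proj L' y))"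
        using r by (simp add: norm_mult)
      also have "\<dots> \<le> 1 * (norm ?e * norm (orth_proj L' y))"
        using r by (intro mult_mono cauchy_schwarz) auto
      also have "\<dots> \<le> (2 * (k * norm (r.D x))) * (k * norm (r.D' y))"
        using \<open>norm ?e \<le> _\<close> below[of x] below'[of y] k
        by (simp only: mult_1_left) (intro mult_mono, auto)
      finally show ?thesis by (simp add: mult_ac)
    qed
    ultimately have "cmod (cinner (\<Theta>r z x - Tr x) y) \<le> norm z / (1 - norm z) * norm (r.D x) * norm (r.D' y)"
      using z by (intro r.schur_factor(2)[where \<kappa> = "\<lambda>_. 2 * k * k"])
    moreover have "cinner (\<Theta>r z x - Tr x) y = complex_of_real r * cinner (\<Theta> z x - T x) y"
      using z by (simp add: \<Theta>r_def Tr_def right_diff_distrib)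
    moreover have "norm (r.D x) = sqrt (?p - r\<^sup>2 * (norm (T x))\<^sup>2)" "norm (r.D' y) = sqrt (?q - r\<^sup>2 * (norm (adj T y))\<^sup>2)"
      by (simp_all flip: D_sq D'_sq)
    ultimately show ?thesis using r by (simp add: norm_mult)
  qed
  have "1 * cmod (cinner (\<Theta> z x - T x) y) \<le> norm z / (1 - norm z)
      * sqrt (?p - 1\<^sup>2 * (norm (T x))\<^sup>2) * sqrt (?q - 1\<^sup>2 * (norm (adj T y))\<^sup>2)"
  proof (rule tendsto_le[OF trivial_limit_at_left_real])
    show "((\<lambda>r. norm z / (1 - norm z) * sqrt (?p - r\<^sup>2 * (norm (T x))\<^sup>2) * sqrt (?q - r\<^sup>2 * (norm (adj T y))\<^sup>2))
        \<longlongrightarrow> norm z / (1 - norm z) * sqrt (?p - 1\<^sup>2 * (norm (T x))\<^sup>2) * sqrt (?q - 1\<^sup>2 * (norm (adj T y))\<^sup>2)) (at_left 1)"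
      by (intro tendsto_intros)
    show "((\<lambda>r. r * cmod (cinner (\<Theta> z x - T x) y)) \<longlongrightarrow> 1 * cmod (cinner (\<Theta> z x - T x) y)) (at_left 1)"
      by (intro tendsto_intros)
    show "\<forall>\<^sub>F r in at_left 1. r * cmod (cinner (\<Theta> z x - T x) y) \<le> norm z / (1 - norm z)
      * sqrt (?p - r\<^sup>2 * (norm (T x))\<^sup>2) * sqrt (?q - r\<^sup>2 * (norm (adj T y))\<^sup>2)"
      by (rule eventually_at_leftI[of 0]) (use strict in auto)
  qed
  moreover have "sqrt (?p - 1\<^sup>2 * (norm (T x))\<^sup>2) = norm (D x)" "sqrt (?q - 1\<^sup>2 * (norm (adj T y))\<^sup>2) = norm (D' y)"
    by (simp_all flip: norm_D dual(4))
  ultimately show ?thesis by (simp only: mult_1_left)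
qed

lemma schur_step_surj:
  assumes \<Theta>: "\<Theta> \<in> schur_class L L'" and \<Theta>0: "\<Theta> 0 = T"
  shows "\<exists>\<Psi>\<in>schur_class DS DS'. schur_step L L' T \<Psi> = \<Theta>"
proof (rule schur_factor(1)[where \<kappa> = "\<lambda>z. norm z / (1 - norm z)", OF \<Theta> \<Theta>0 _ _ schur_pick_bound[OF \<Theta> \<Theta>0]])
  show "0 \<le> norm z / (1 - norm z)" if "norm z < 1" for z :: complex using that by simp
  fix \<rho> :: real assume \<rho>: "\<rho> < 1"
  have "norm z / (1 - norm z) \<le> 1 / (1 - \<rho>)" if "norm z \<le> \<rho>" for z :: complex
    using that \<rho> by (intro frac_le) auto
  then show "\<exists>M\<ge>0. \<forall>z::complex. norm z \<le> \<rho> \<longrightarrow> norm z / (1 - norm z) \<le> M"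
    using \<rho> by (intro exI[of _ "1 / (1 - \<rho>)"]) auto
qed

lemma schur_step_bij: "bij_betw (schur_step L L' T) (schur_class DS DS') {\<Theta> \<in> schur_class L L'. \<Theta> 0 = T}"
  unfolding bij_betw_def
proof (intro conjI equalityI subsetI)
  show "inj_on (schur_step L L' T) (schur_class DS DS')" using schur_step_inj by (intro inj_onI)
  show "\<Theta> \<in> {\<Theta> \<in> schur_class L L'. \<Theta> 0 = T}" if "\<Theta> \<in> schur_step L L' T ` schur_class DS DS'" for \<Theta>
    using that schur_step_schur_class schur_step_0 by auto
  show "\<Theta> \<in> schur_step L L' T ` schur_class DS DS'" if "\<Theta> \<in> {\<Theta> \<in> schur_class L L'. \<Theta> 0 = T}" for \<Theta>
    using that schur_step_surj[of \<Theta>] by (auto simp: image_iff)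
qed

text \<open>The equation inside the definite description of \<open>schur_next\<close> says that a
  candidate has the same Schur step as \<open>\<Psi>\<close>; injectivity of the step makes it
  unique.\<close>

lemma schur_next_schur_step:
  assumes \<Psi>: "\<Psi> \<in> schur_class DS DS'"
  shows "schur_next L L' (schur_step L L' T \<Psi>) = \<Psi>"
  unfolding schur_next_def Let_def schur_step_0
proof (rule the_equality)
  show "\<Psi> \<in> schur_class DS DS' \<and> (\<forall>z\<in>ball 0 1. \<forall>x. schur_step L L' T \<Psi> z x = T x + z *\<^sub>C D'
       (\<Psi> z (inv_into DS (\<lambda>u. u + z *\<^sub>C adj T (\<Psi> z u)) (D x))))"
    using \<Psi> by (simp add: schur_step_def)
  fix \<Phi> assume \<Phi>: "\<Phi> \<in> schur_class DS DS' \<and> (\<forall>z\<in>ball 0 1. \<forall>x. schur_step L L' T \<Psi> z x = T x + z *\<^sub>C D'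
       (\<Phi> z (inv_into DS (\<lambda>u. u + z *\<^sub>C adj T (\<Phi> z u)) (D x))))"
  have "schur_step L L' T \<Phi> = schur_step L L' T \<Psi>"
  proof (rule extensionalityI)
    show "schur_step L L' T \<Phi> z = schur_step L L' T \<Psi> z" if "z \<in> ball 0 1" for z
    proof
      fix x
      show "schur_step L L' T \<Phi> z x = schur_step L L' T \<Psi> z x"
        using conjunct2[OF \<Phi>, rule_format, OF that, of x] that by (simp add: schur_step_def)
    qed
  qed (simp_all add: schur_step_def)
  then show "\<Phi> = \<Psi>" using \<Phi> \<Psi> schur_step_inj by blast
qed

end

section \<open>Iterating the Schur algorithm\<close>

text \<open>That the spaces at stage \<open>k\<close> are closed subspaces rests on the contractions
  before \<open>k\<close>, hence the induction.\<close>

lemma choice_sequence_contraction_between: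
  assumes choice: "choice_sequence_upto N \<Gamma>" and k: "k \<le> N"
  shows "contraction_between (dom_space \<Gamma> k) (cod_space \<Gamma> k) (\<Gamma> k)"
proof -
  have "csub (dom_space \<Gamma> k) \<and> csub (cod_space \<Gamma> k)" using k
  proof (induction k)
    case (Suc k)
    then interpret contraction_between "dom_space \<Gamma> k" "cod_space \<Gamma> k" "\<Gamma> k"
      using choice by unfold_locales (auto simp: choice_sequence_upto_def)
    show ?case using csub_DS dual(9) by simp
  qed (simp add: csub_UNIV)
  then show ?thesis
    using choice k by unfold_locales (auto simp: choice_sequence_upto_def)
qed

text \<open>\<open>\<E>\<close> sits innermost, and the steps of the contractions are wrapped around
  it from the highest index down to \<open>\<Gamma> 0\<close>. Recursing at the inner end matches
  the order in which parameters are prescribed.\<close>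

primrec ladder :: "(nat \<Rightarrow> 'm::chilbert_space \<Rightarrow> 'n::chilbert_space) \<Rightarrow> nat \<Rightarrow>
    (complex \<Rightarrow> 'm \<Rightarrow> 'n) \<Rightarrow> complex \<Rightarrow> 'm \<Rightarrow> 'n" where
  "ladder \<Gamma> 0 \<E> = \<E>"
| "ladder \<Gamma> (Suc k) \<E> = ladder \<Gamma> k (schur_step (dom_space \<Gamma> k) (cod_space \<Gamma> k) (\<Gamma> k) \<E>)"

text \<open>Both claims share one induction: the second, at \<open>j = 0\<close>, identifies
  parameter \<open>K\<close> of \<open>ladder \<Gamma> K \<Phi>\<close> with
  \<open>\<Phi> 0\<close>. Prescribing one more parameter thus means prescribing
  \<open>\<Phi> 0\<close>, which describes the image of one more Schur step.\<close>

lemma ladder_bij: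
  assumes choice: "choice_sequence_upto N \<Gamma>" and K: "K \<le> Suc N"
  shows "bij_betw (ladder \<Gamma> K) (schur_class (dom_space \<Gamma> K) (cod_space \<Gamma> K))
      {\<Theta> \<in> schur_class UNIV UNIV. \<forall>k<K. schur_param UNIV UNIV \<Theta> k = \<Gamma> k}"
    and "\<And>\<E> j. \<E> \<in> schur_class (dom_space \<Gamma> K) (cod_space \<Gamma> K) \<Longrightarrow>
      schur_fun UNIV UNIV (ladder \<Gamma> K \<E>) (K + j) = schur_fun (dom_space \<Gamma> K) (cod_space \<Gamma> K) \<E> j"
proof -
  have "bij_betw (ladder \<Gamma> K) (schur_class (dom_space \<Gamma> K) (cod_space \<Gamma> K))
      {\<Theta> \<in> schur_class UNIV UNIV. \<forall>k<K. schur_param UNIV UNIV \<Theta> k = \<Gamma> k} \<and>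
    (\<forall>\<E>\<in>schur_class (dom_space \<Gamma> K) (cod_space \<Gamma> K). \<forall>j.
      schur_fun UNIV UNIV (ladder \<Gamma> K \<E>) (K + j) = schur_fun (dom_space \<Gamma> K) (cod_space \<Gamma> K) \<E> j)"
    using K
  proof (induction K)
    case 0
    show ?case by (auto simp: bij_betw_def inj_on_def)
  next
    case (Suc K)
    let ?L = "dom_space \<Gamma> K" and ?L' = "cod_space \<Gamma> K"
    interpret contraction_between ?L ?L' "\<Gamma> K"
      using Suc.prems by (intro choice_sequence_contraction_between[OF choice]) simp
    let ?B = "{\<Theta> \<in> schur_class UNIV UNIV. \<forall>k<K. schur_param UNIV UNIV \<Theta> k = \<Gamma> k}"
    have bij: "bij_betw (ladder \<Gamma> K) (schur_class ?L ?L') ?B"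
      and fn: "\<And>\<E> j. \<E> \<in> schur_class ?L ?L' \<Longrightarrow>
        schur_fun UNIV UNIV (ladder \<Gamma> K \<E>) (K + j) = schur_fun ?L ?L' \<E> j"
      using Suc by auto
    have param: "schur_param UNIV UNIV (ladder \<Gamma> K \<Phi>) K = \<Phi> 0" if "\<Phi> \<in> schur_class ?L ?L'" for \<Phi>
      using fn[OF that, of 0] by (simp add: schur_param_def)
    have "ladder \<Gamma> K ` {\<Phi> \<in> schur_class ?L ?L'. \<Phi> 0 = \<Gamma> K} = {\<Theta> \<in> ?B. schur_param UNIV UNIV \<Theta> K = \<Gamma> K}"
      (is "?f ` ?X = ?Y")
    proof (intro equalityI subsetI)
      show "\<Theta> \<in> ?Y" if \<Theta>: "\<Theta> \<in> ?f ` ?X" for \<Theta>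
      proof -
        obtain \<Phi> where \<Phi>: "\<Phi> \<in> schur_class ?L ?L'" "\<Phi> 0 = \<Gamma> K" "\<Theta> = ?f \<Phi>" using \<Theta> by blast
        have "\<Theta> \<in> ?B" using bij_betwE[OF bij] \<Phi> by blast
        then show ?thesis using param[OF \<Phi>(1)] \<Phi>(2,3) by simp
      qed
      show "\<Theta> \<in> ?f ` ?X" if "\<Theta> \<in> ?Y" for \<Theta>
      proof -
        have "\<Theta> \<in> ?B" using that by simp
        then obtain \<Phi> where \<Phi>: "\<Phi> \<in> schur_class ?L ?L'" "\<Theta> = ?f \<Phi>"
          unfolding bij_betw_imp_surj_on[OF bij, symmetric] by blast
        then have "\<Phi> 0 = \<Gamma> K" using param[OF \<Phi>(1)] that by simp
        then show ?thesis using \<Phi> by blast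
      qed
    qed
    then have "bij_betw (ladder \<Gamma> K) ?X ?Y" by (intro bij_betw_subset[OF bij]) auto
    moreover have "ladder \<Gamma> (Suc K) = ladder \<Gamma> K \<circ> schur_step ?L ?L' (\<Gamma> K)" by (rule ext) simp
    ultimately have B: "bij_betw (ladder \<Gamma> (Suc K)) (schur_class (dom_space \<Gamma> (Suc K)) (cod_space \<Gamma> (Suc K))) ?Y"
      using bij_betw_trans[OF schur_step_bij] by simp
    have Y: "?Y = {\<Theta> \<in> schur_class UNIV UNIV. \<forall>k<Suc K. schur_param UNIV UNIV \<Theta> k = \<Gamma> k}"
      by (auto simp: less_Suc_eq)
    have "schur_fun UNIV UNIV (ladder \<Gamma> (Suc K) \<E>) (Suc K + j)
        = schur_fun (dom_space \<Gamma> (Suc K)) (cod_space \<Gamma> (Suc K)) \<E> j"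
      if "\<E> \<in> schur_class (dom_space \<Gamma> (Suc K)) (cod_space \<Gamma> (Suc K))" for \<E> j
    proof -
      have \<E>: "\<E> \<in> schur_class DS DS'" using that by simp
      have "schur_fun UNIV UNIV (ladder \<Gamma> (Suc K) \<E>) (Suc K + j)
          = schur_fun UNIV UNIV (ladder \<Gamma> K (schur_step ?L ?L' (\<Gamma> K) \<E>)) (K + Suc j)" by simp
      also have "\<dots> = schur_fun ?L ?L' (schur_step ?L ?L' (\<Gamma> K) \<E>) (Suc j)"
        by (rule fn[OF schur_step_schur_class[OF \<E>]])
      also have "\<dots> = schur_fun (dom_space \<Gamma> (Suc K)) (cod_space \<Gamma> (Suc K)) \<E> j"
        by (simp add: schur_step_0 schur_next_schur_step[OF \<E>])
      finally show ?thesis .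
    qed
    then show ?case using B unfolding Y by blast
  qed
  then show "bij_betw (ladder \<Gamma> K) (schur_class (dom_space \<Gamma> K) (cod_space \<Gamma> K))
      {\<Theta> \<in> schur_class UNIV UNIV. \<forall>k<K. schur_param UNIV UNIV \<Theta> k = \<Gamma> k}"
    "\<And>\<E> j. \<E> \<in> schur_class (dom_space \<Gamma> K) (cod_space \<Gamma> K) \<Longrightarrow>
      schur_fun UNIV UNIV (ladder \<Gamma> K \<E>) (K + j) = schur_fun (dom_space \<Gamma> K) (cod_space \<Gamma> K) \<E> j"
    by blast+
qed

text \<open>The pairs \<open>(x\<^sub>k, z y\<^sub>k\<^sub>+\<^sub>1)\<close> are mapped by the rotation of \<open>\<Gamma>\<^sub>k\<close> to \<open>(y\<^sub>k, x\<^sub>k\<^sub>+\<^sub>1)\<close>.\<close>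

lemma ladder_wave:
  assumes choice: "choice_sequence_upto N \<Gamma>" and K: "K \<le> Suc N"
    and \<E>: "\<E> \<in> schur_class (dom_space \<Gamma> K) (cod_space \<Gamma> K)" and z: "norm z < 1"
  shows "\<exists>xs ys. xs 0 = x \<and> ys 0 = ladder \<Gamma> K \<E> z x \<and> ys K = \<E> z (xs K) \<and>
    (\<forall>k<K. xs (Suc k) \<in> dom_space \<Gamma> (Suc k) \<and> ys (Suc k) \<in> cod_space \<Gamma> (Suc k) \<and>
      ys k = \<Gamma> k (xs k) + Dop_adj \<Gamma> k (z *\<^sub>C ys (Suc k)) \<and>
      xs (Suc k) = Dop \<Gamma> k (xs k) - adj (\<Gamma> k) (z *\<^sub>C ys (Suc k)))"
  using K \<E>
proof (induction K arbitrary: \<E>)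
  case 0
  show ?case by (intro exI[of _ "\<lambda>_. x"] exI[of _ "\<lambda>_. \<E> z x"]) simp
next
  case (Suc K)
  interpret contraction_between "dom_space \<Gamma> K" "cod_space \<Gamma> K" "\<Gamma> K"
    using Suc.prems by (intro choice_sequence_contraction_between[OF choice]) simp
  have \<E>: "\<E> \<in> schur_class DS DS'" using Suc.prems by simp
  note \<E>D = schur_classD[OF csub_DS \<E> z]
  obtain xs ys where w: "xs 0 = x" "ys 0 = ladder \<Gamma> (Suc K) \<E> z x"
    "ys K = schur_step (dom_space \<Gamma> K) (cod_space \<Gamma> K) (\<Gamma> K) \<E> z (xs K)"
    "\<And>k. k < K \<Longrightarrow> xs (Suc k) \<in> dom_space \<Gamma> (Suc k) \<and> ys (Suc k) \<in> cod_space \<Gamma> (Suc k) \<and>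
      ys k = \<Gamma> k (xs k) + Dop_adj \<Gamma> k (z *\<^sub>C ys (Suc k)) \<and>
      xs (Suc k) = Dop \<Gamma> k (xs k) - adj (\<Gamma> k) (z *\<^sub>C ys (Suc k))"
    using Suc.IH[OF _ schur_step_schur_class[OF \<E>]] Suc.prems by auto
  \<comment> \<open>The signal of the newly inserted step becomes the next term of the wave; the
    terms up to index \<open>K\<close> and their equations are kept.\<close>
  define u where "u = feedback z (\<E> z) (xs K)"
  define xs' where "xs' = xs(Suc K := u)"
  define ys' where "ys' = ys(Suc K := \<E> z u)"
  have u: "u \<in> DS" unfolding u_def by (rule feedback_mem[OF z \<E>D(1)])
  have "u = D (xs K) - adj (\<Gamma> K) (z *\<^sub>C \<E> z u)"
    using feedback_eq[OF z \<E>D(1), of "xs K"] unfolding bop_scaleC[OF dual(13)] u_def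
    by (metis add_diff_cancel_right')
  moreover have "ys K = \<Gamma> K (xs K) + D' (z *\<^sub>C \<E> z u)"
    by (simp add: w(3) schur_step_eq[OF z] u_def bop_scaleC[OF dual(1)])
  ultimately have last: "ys' K = \<Gamma> K (xs' K) + Dop_adj \<Gamma> K (z *\<^sub>C ys' (Suc K))"
    "xs' (Suc K) = Dop \<Gamma> K (xs' K) - adj (\<Gamma> K) (z *\<^sub>C ys' (Suc K))"
    by (simp_all add: xs'_def ys'_def Dop_def Dop_adj_def)
  have steps: "\<forall>k<Suc K. xs' (Suc k) \<in> dom_space \<Gamma> (Suc k) \<and> ys' (Suc k) \<in> cod_space \<Gamma> (Suc k) \<and>
      ys' k = \<Gamma> k (xs' k) + Dop_adj \<Gamma> k (z *\<^sub>C ys' (Suc k)) \<and>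
      xs' (Suc k) = Dop \<Gamma> k (xs' k) - adj (\<Gamma> k) (z *\<^sub>C ys' (Suc k))"
  proof (intro allI impI)
    fix k assume k: "k < Suc K"
    show "xs' (Suc k) \<in> dom_space \<Gamma> (Suc k) \<and> ys' (Suc k) \<in> cod_space \<Gamma> (Suc k) \<and>
      ys' k = \<Gamma> k (xs' k) + Dop_adj \<Gamma> k (z *\<^sub>C ys' (Suc k)) \<and>
      xs' (Suc k) = Dop \<Gamma> k (xs' k) - adj (\<Gamma> k) (z *\<^sub>C ys' (Suc k))"
    proof (cases "k = K")
      case True
      have "xs' (Suc K) \<in> dom_space \<Gamma> (Suc K)" "ys' (Suc K) \<in> cod_space \<Gamma> (Suc K)"
        using u \<E>D(3)[of u] by (simp_all add: xs'_def ys'_def)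
      then show ?thesis unfolding True using last by blast
    next
      case False
      then have "xs' k = xs k" "xs' (Suc k) = xs (Suc k)" "ys' k = ys k" "ys' (Suc k) = ys (Suc k)" "k < K"
        using k by (simp_all add: xs'_def ys'_def)
      then show ?thesis using w(4)[of k] by metis
    qed
  qed
  moreover have "xs' 0 = x" "ys' 0 = ladder \<Gamma> (Suc K) \<E> z x" "ys' (Suc K) = \<E> z (xs' (Suc K))"
    using w(1,2) by (simp_all add: xs'_def ys'_def)
  ultimately show ?case by blast
qed

section \<open>The block operator matrix\<close>

declare dom_space.simps(2) [simp del] cod_space.simps(2) [simp del]

lemma scaleC_Pair [simp]: "c *\<^sub>C (a, b) = (c *\<^sub>C a, c *\<^sub>C b)"
  by (simp add: scaleC_prod_def)

lemma fst_scaleC [simp]: "fst (c *\<^sub>C p) = c *\<^sub>C fst p"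
  and snd_scaleC [simp]: "snd (c *\<^sub>C p) = c *\<^sub>C snd p"
  by (simp_all add: scaleC_prod_def)

lemma norm_pair_sq: "(norm p)\<^sup>2 = (norm (fst p))\<^sup>2 + (norm (snd p))\<^sup>2"
  by (simp add: norm_prod_def)

text \<open>The regrouping behind the block operator: the rotations in \<open>Vop\<close> pair
  entries within one index, those in \<open>Wop\<close> across neighbouring indices, and the
  outermost two entries are left over.\<close>

lemma sum_regroup:
  fixes a b :: "nat \<Rightarrow> real"
  shows "(\<Sum>k=1..n + 1. a k + b k) = a 1 + (\<Sum>k=1..n. b k + a (k + 1)) + b (n + 1)"
  by (induction n) (simp_all add: algebra_simps)

section \<open>Rotations of a choice sequence and their direct sums\<close>

locale choice_sequence =
  fixes n :: nat and \<Gamma> :: "nat \<Rightarrow> 'm::chilbert_space \<Rightarrow> 'n::chilbert_space"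
  assumes choice: "choice_sequence_upto (2 * n + 1) \<Gamma>"
begin

lemma contraction: "k \<le> 2 * n + 1 \<Longrightarrow> contraction_between (dom_space \<Gamma> k) (cod_space \<Gamma> k) (\<Gamma> k)"
  by (rule choice_sequence_contraction_between[OF choice])

lemma csub_spaces: "k \<le> 2 * n + 2 \<Longrightarrow> csub (dom_space \<Gamma> k)" "k \<le> 2 * n + 2 \<Longrightarrow> csub (cod_space \<Gamma> k)"
proof -
  have "csub (dom_space \<Gamma> k) \<and> csub (cod_space \<Gamma> k)" if k: "k \<le> 2 * n + 2"
  proof (cases k)
    case (Suc j)
    then interpret contraction_between "dom_space \<Gamma> j" "cod_space \<Gamma> j" "\<Gamma> j"
      using k by (intro contraction) simp
    show ?thesis using csub_DS dual(9) by (simp add: Suc dom_space.simps(2) cod_space.simps(2))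
  qed (simp add: csub_UNIV)
  then show "k \<le> 2 * n + 2 \<Longrightarrow> csub (dom_space \<Gamma> k)" "k \<le> 2 * n + 2 \<Longrightarrow> csub (cod_space \<Gamma> k)" by blast+
qed

lemma
  assumes k: "k \<le> 2 * n + 1"
  shows bop_row1: "bop (row1 \<Gamma> k)" and bop_row2: "bop (row2 \<Gamma> k)"
proof -
  interpret contraction_between "dom_space \<Gamma> k" "cod_space \<Gamma> k" "\<Gamma> k" by (rule contraction[OF k])
  have fst: "bop (fst :: 'm \<times> 'n \<Rightarrow> 'm)" and snd: "bop (snd :: 'm \<times> 'n \<Rightarrow> 'n)"
    by (simp_all add: bop_iff bounded_linear_fst bounded_linear_snd)
  have "row1 \<Gamma> k = (\<lambda>h. \<Gamma> k (fst h) + D' (snd h))" "row2 \<Gamma> k = (\<lambda>h. D (fst h) - adj (\<Gamma> k) (snd h))"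
    by (auto simp: row1_def row2_def Dop_def Dop_adj_def)
  then show "bop (row1 \<Gamma> k)" "bop (row2 \<Gamma> k)"
    using bop_sum[OF bop_compose[OF bop fst] bop_compose[OF dual(1) snd]]
      bop_difference[OF bop_compose[OF bop_D fst] bop_compose[OF dual(13) snd]] by simp_all
qed

lemma
  assumes k: "k \<le> 2 * n + 1"
  shows rotation_add: "rotation \<Gamma> k (p + q) = rotation \<Gamma> k p + rotation \<Gamma> k q"
    and rotation_scaleC: "rotation \<Gamma> k (c *\<^sub>C p) = c *\<^sub>C rotation \<Gamma> k p"
  by (simp_all add: rotation_def bop_add[OF bop_row1[OF k]] bop_add[OF bop_row2[OF k]]
      bop_scaleC[OF bop_row1[OF k]] bop_scaleC[OF bop_row2[OF k]])

lemma rotation_props: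
  assumes k: "k \<le> 2 * n + 1" and p: "p \<in> dom_space \<Gamma> k \<times> cod_space \<Gamma> (Suc k)"
  shows "rotation \<Gamma> k p \<in> cod_space \<Gamma> k \<times> dom_space \<Gamma> (Suc k)" and "norm (rotation \<Gamma> k p) = norm p"
proof -
  interpret contraction_between "dom_space \<Gamma> k" "cod_space \<Gamma> k" "\<Gamma> k" by (rule contraction[OF k])
  obtain x y where xy: "p = (x, y)" "x \<in> dom_space \<Gamma> k" "y \<in> DS'" using p by (auto simp: cod_space.simps(2))
  have y: "y \<in> cod_space \<Gamma> k" using xy(3) dual(8) by blast
  have rot: "rotation \<Gamma> k p = (\<Gamma> k x + D' y, D x - adj (\<Gamma> k) y)"
    by (simp add: rotation_def row1_def row2_def xy(1) Dop_def Dop_adj_def)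
  have "\<Gamma> k x + D' y \<in> cod_space \<Gamma> k" by (intro csub_add[OF L'] T_mem dual(6))
  moreover have "D x - adj (\<Gamma> k) y \<in> DS" by (intro csub_diff[OF csub_DS] D_mem_DS adj_DS xy(3))
  ultimately show "rotation \<Gamma> k p \<in> cod_space \<Gamma> k \<times> dom_space \<Gamma> (Suc k)" by (simp add: rot dom_space.simps(2))
  have "(norm (rotation \<Gamma> k p))\<^sup>2 = (norm p)\<^sup>2"
    using rotation_isometry'[OF xy(2) y] unfolding rot unfolding xy(1) norm_pair_sq fst_conv snd_conv .
  then show "norm (rotation \<Gamma> k p) = norm p" by (simp add: power2_eq_iff_nonneg)
qed

lemma Hsp_eq: "Hsp \<Gamma> (Suc i) = dom_space \<Gamma> (2 * i + 1) \<times> cod_space \<Gamma> (2 * i + 2)"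
  by (simp add: Hsp_def Dsp_def Dsp_adj_def dom_space.simps(2) cod_space.simps(2))

text \<open>Component \<open>k\<close> is the space on which the rotation of
  \<open>\<Gamma> (2 * k - 1)\<close> acts: the domain of that contraction and the defect space of
  its adjoint. Truncated subtraction at \<open>k = 0\<close> would spoil the indices.\<close>

lemma Hsp_eq': "1 \<le> k \<Longrightarrow> Hsp \<Gamma> k = dom_space \<Gamma> (2 * k - 1) \<times> cod_space \<Gamma> (2 * k)"
proof (cases k)
  case (Suc i)
  then have "2 * k - 1 = 2 * i + 1" "2 * k = 2 * i + 2" by simp_all
  then show ?thesis using Hsp_eq[of i] by (simp only: Suc)
qed simp

lemma Ksp_add: "h \<in> Ksp n \<Gamma> \<Longrightarrow> h' \<in> Ksp n \<Gamma> \<Longrightarrow> (\<lambda>k. h k + h' k) \<in> Ksp n \<Gamma>"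
  by (auto simp: Ksp_def Hsp_eq' mem_Times_iff csub_add csub_spaces)

lemma Ksp_scaleC: "h \<in> Ksp n \<Gamma> \<Longrightarrow> (\<lambda>k. c *\<^sub>C h k) \<in> Ksp n \<Gamma>"
  by (auto simp: Ksp_def Hsp_eq' mem_Times_iff csub_scaleC csub_spaces)

lemma Ksp_diff: "h \<in> Ksp n \<Gamma> \<Longrightarrow> h' \<in> Ksp n \<Gamma> \<Longrightarrow> (\<lambda>k. h k - h' k) \<in> Ksp n \<Gamma>"
  by (auto simp: Ksp_def Hsp_eq' mem_Times_iff csub_diff csub_spaces)

lemma Vop_add: "Vop n \<Gamma> (\<lambda>k. h k + h' k) k = Vop n \<Gamma> h k + Vop n \<Gamma> h' k"
  and Vop_scaleC: "Vop n \<Gamma> (\<lambda>k. c *\<^sub>C h k) k = c *\<^sub>C Vop n \<Gamma> h k"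
  by (auto simp: Vop_def rotation_add rotation_scaleC)

lemma adj_0_bop: "bop (adj (\<Gamma> 0))"
proof -
  interpret contraction_between "dom_space \<Gamma> 0" "cod_space \<Gamma> 0" "\<Gamma> 0" by (rule contraction) simp
  show ?thesis by (rule dual(13))
qed

lemma Wop_add: "Wop n \<Gamma> (\<lambda>k. g k + g' k) k = Wop n \<Gamma> g k + Wop n \<Gamma> g' k"
proof -
  have "rotation \<Gamma> j (a + a', b + b') = rotation \<Gamma> j (a, b) + rotation \<Gamma> j (a', b')" if "j \<le> 2 * n + 1" for j a a' b b'
    using rotation_add[OF that, of "(a, b)" "(a', b')"] by simp
  then show ?thesis by (auto simp: Wop_def bop_add[OF adj_0_bop])
qed

lemma Wop_scaleC: "Wop n \<Gamma> (\<lambda>k. c *\<^sub>C g k) k = c *\<^sub>C Wop n \<Gamma> g k"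
proof -
  have "rotation \<Gamma> j (c *\<^sub>C a, c *\<^sub>C b) = c *\<^sub>C rotation \<Gamma> j (a, b)" if "j \<le> 2 * n + 1" for j a b
    using rotation_scaleC[OF that, of c "(a, b)"] by simp
  then show ?thesis by (auto simp: Wop_def bop_scaleC[OF adj_0_bop] scaleC.minus_right)
qed

lemma Sop_add: "Sop n \<Gamma> (\<lambda>k. h k + h' k) k = Sop n \<Gamma> h k + Sop n \<Gamma> h' k"
  and Sop_scaleC: "Sop n \<Gamma> (\<lambda>k. c *\<^sub>C h k) k = c *\<^sub>C Sop n \<Gamma> h k"
  by (simp_all add: Sop_def Vop_add[abs_def] Vop_scaleC[abs_def] Wop_add Wop_scaleC)

lemma Sop_diff: "Sop n \<Gamma> (\<lambda>k. h k - h' k) k = Sop n \<Gamma> h k - Sop n \<Gamma> h' k"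
  using Sop_add[of h "\<lambda>k. (-1) *\<^sub>C h' k" k] Sop_scaleC[of "-1" h' k] by (simp add: scaleC.minus_left)

text \<open>Elements of the direct sum are plain functions on the natural numbers, so its squared
  norm is introduced by hand; the polymorphic form serves the source and the target of
  \<open>Vop\<close> alike.\<close>

definition hnorm_sq :: "(nat \<Rightarrow> 'c::real_normed_vector) \<Rightarrow> real" where
  "hnorm_sq h = (\<Sum>k=1..n + 1. (norm (h k))\<^sup>2)"

lemma Vop_props:
  assumes h: "h \<in> Ksp n \<Gamma>"
  shows "k \<in> {1..n + 1} \<Longrightarrow> Vop n \<Gamma> h k \<in> cod_space \<Gamma> (2 * k - 1) \<times> dom_space \<Gamma> (2 * k)"
    and "hnorm_sq (Vop n \<Gamma> h) = hnorm_sq h"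
proof -
  have mem: "h k \<in> dom_space \<Gamma> (2 * k - 1) \<times> cod_space \<Gamma> (Suc (2 * k - 1))" and le: "2 * k - 1 \<le> 2 * n + 1"
    if k: "k \<in> {1..n + 1}" for k
  proof -
    have "Suc (2 * k - 1) = 2 * k" using k by simp
    moreover have "h k \<in> Hsp \<Gamma> k" using h k by (simp add: Ksp_def)
    ultimately show "h k \<in> dom_space \<Gamma> (2 * k - 1) \<times> cod_space \<Gamma> (Suc (2 * k - 1))"
      using Hsp_eq'[of k] k by simp
  qed (use k in auto)
  show "Vop n \<Gamma> h k \<in> cod_space \<Gamma> (2 * k - 1) \<times> dom_space \<Gamma> (2 * k)" if k: "k \<in> {1..n + 1}"
  proof -
    have "Suc (2 * k - 1) = 2 * k" using k by simp
    then show ?thesis using rotation_props(1)[OF le[OF k] mem[OF k]] k unfolding Vop_def by (simp only:) simp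
  qed
  show "hnorm_sq (Vop n \<Gamma> h) = hnorm_sq h"
    unfolding hnorm_sq_def
  proof (rule sum.cong[OF refl])
    show "(norm (Vop n \<Gamma> h k))\<^sup>2 = (norm (h k))\<^sup>2" if k: "k \<in> {1..n + 1}" for k
      using rotation_props(2)[OF le[OF k] mem[OF k]] k by (simp add: Vop_def)
  qed
qed

text \<open>The block \<open>- adj (\<Gamma> 0)\<close> is contractive, the rotations are isometric,
  and the block \<open>0\<close> destroys the energy of the last entry, which is subtracted on the
  right. \<open>sum_regroup\<close> aligns the pairs of \<open>g\<close> with the inputs of the
  rotations.\<close>

lemma Wop_props:
  assumes g: "\<And>k. k \<in> {1..n + 1} \<Longrightarrow> g k \<in> cod_space \<Gamma> (2 * k - 1) \<times> dom_space \<Gamma> (2 * k)"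
  shows "Wop n \<Gamma> g \<in> Ksp n \<Gamma>"
    and "hnorm_sq (Wop n \<Gamma> g) \<le> hnorm_sq g - (norm (snd (g (n + 1))))\<^sup>2"
proof -
  interpret g0: contraction_between "dom_space \<Gamma> 0" "cod_space \<Gamma> 0" "\<Gamma> 0" by (rule contraction) simp
  let ?r = "\<lambda>k. rotation \<Gamma> (2 * k) (snd (g k), fst (g (k + 1)))"
  have r: "?r k \<in> cod_space \<Gamma> (2 * k) \<times> dom_space \<Gamma> (2 * k + 1)"
    "norm (?r k) = norm (snd (g k), fst (g (k + 1)))" if k: "k \<in> {1..n}" for k
  proof -
    have "fst (g (k + 1)) \<in> cod_space \<Gamma> (2 * (k + 1) - 1)" "snd (g k) \<in> dom_space \<Gamma> (2 * k)"
      using g[of k] g[of "k + 1"] k by (auto simp: mem_Times_iff)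
    then have "(snd (g k), fst (g (k + 1))) \<in> dom_space \<Gamma> (2 * k) \<times> cod_space \<Gamma> (Suc (2 * k))" by simp
    from rotation_props[OF _ this] k
    show "?r k \<in> cod_space \<Gamma> (2 * k) \<times> dom_space \<Gamma> (2 * k + 1)" "norm (?r k) = norm (snd (g k), fst (g (k + 1)))"
      by auto
  qed
  have g1: "fst (g 1) \<in> g0.DS'" using g[of 1] by (simp add: mem_Times_iff cod_space.simps(2))
  have W_fst1: "fst (Wop n \<Gamma> g 1) = - adj (\<Gamma> 0) (fst (g 1))" by (simp add: Wop_def)
  have W_fst: "fst (Wop n \<Gamma> g (k + 1)) = snd (?r k)" if "k \<in> {1..n}" for k using that by (auto simp: Wop_def)
  have W_snd: "snd (Wop n \<Gamma> g k) = fst (?r k)" if "k \<in> {1..n}" for k using that by (auto simp: Wop_def)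
  have W_snd_last: "snd (Wop n \<Gamma> g (n + 1)) = 0" by (simp add: Wop_def)
  show "Wop n \<Gamma> g \<in> Ksp n \<Gamma>"
    unfolding Ksp_def
  proof (intro CollectI conjI ballI allI impI)
    show "Wop n \<Gamma> g k = 0" if "k \<notin> {1..n + 1}" for k using that by (auto simp: Wop_def)
    fix k assume k: "k \<in> {1..n + 1}"
    have "fst (Wop n \<Gamma> g k) \<in> dom_space \<Gamma> (2 * k - 1)"
    proof (cases "k = 1")
      case True
      have "adj (\<Gamma> 0) (fst (g 1)) \<in> dom_space \<Gamma> 1" using g0.adj_DS[OF g1] by (simp add: dom_space.simps(2))
      then show ?thesis unfolding True W_fst1 using csub_uminus[OF csub_spaces(1), of 1] by simp
    next
      case False
      then have "k - 1 \<in> {1..n}" "k - 1 + 1 = k" "2 * (k - 1) + 1 = 2 * k - 1" using k by auto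
      then show ?thesis using W_fst[of "k - 1"] r(1)[of "k - 1"] by (simp only: mem_Times_iff)
    qed
    moreover have "snd (Wop n \<Gamma> g k) \<in> cod_space \<Gamma> (2 * k)"
    proof (cases "k = n + 1")
      case True
      then show ?thesis using W_snd_last csub_0[OF csub_spaces(2), of "2 * k"] by simp
    next
      case False
      then have "k \<in> {1..n}" using k by auto
      then show ?thesis using W_snd r(1) by (simp add: mem_Times_iff)
    qed
    ultimately show "Wop n \<Gamma> g k \<in> Hsp \<Gamma> k" using k by (simp add: Hsp_eq' mem_Times_iff)
  qed
  have "hnorm_sq (Wop n \<Gamma> g) = (norm (fst (Wop n \<Gamma> g 1)))\<^sup>2
      + (\<Sum>k=1..n. (norm (snd (Wop n \<Gamma> g k)))\<^sup>2 + (norm (fst (Wop n \<Gamma> g (k + 1))))\<^sup>2)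
      + (norm (snd (Wop n \<Gamma> g (n + 1))))\<^sup>2"
    unfolding hnorm_sq_def norm_pair_sq by (rule sum_regroup)
  also have "\<dots> \<le> (norm (fst (g 1)))\<^sup>2 + (\<Sum>k=1..n. (norm (snd (g k)))\<^sup>2 + (norm (fst (g (k + 1))))\<^sup>2) + 0"
  proof (rule add_mono[OF add_mono[OF _ sum_mono]])
    show "(norm (fst (Wop n \<Gamma> g 1)))\<^sup>2 \<le> (norm (fst (g 1)))\<^sup>2"
      unfolding W_fst1 norm_minus_cancel by (intro power_mono g0.dual(15)) simp
    fix k assume k: "k \<in> {1..n}"
    have "(norm (?r k))\<^sup>2 = (norm (snd (g k), fst (g (k + 1))))\<^sup>2" by (simp only: r(2)[OF k])
    then show "(norm (snd (Wop n \<Gamma> g k)))\<^sup>2 + (norm (fst (Wop n \<Gamma> g (k + 1))))\<^sup>2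
        \<le> (norm (snd (g k)))\<^sup>2 + (norm (fst (g (k + 1))))\<^sup>2"
      unfolding W_fst[OF k] W_snd[OF k] norm_pair_sq by simp
  qed (simp only: W_snd_last norm_zero power_zero_numeral order_refl)
  also have "\<dots> = hnorm_sq g - (norm (snd (g (n + 1))))\<^sup>2"
    unfolding hnorm_sq_def norm_pair_sq sum_regroup by simp
  finally show "hnorm_sq (Wop n \<Gamma> g) \<le> hnorm_sq g - (norm (snd (g (n + 1))))\<^sup>2" .
qed

text \<open>The energy destroyed by \<open>Wop\<close> is that of the last entry of
  \<open>Vop n \<Gamma> h\<close>, the outgoing signal at the end of the chain. Keeping this term is
  what later bounds \<open>Aop\<close>.\<close>

lemma
  assumes h: "h \<in> Ksp n \<Gamma>"
  shows Sop_Ksp: "Sop n \<Gamma> h \<in> Ksp n \<Gamma>"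
    and hnorm_sq_Sop: "hnorm_sq (Sop n \<Gamma> h) \<le> hnorm_sq h - (norm (row2 \<Gamma> (2 * n + 1) (h (n + 1))))\<^sup>2"
proof -
  have "snd (Vop n \<Gamma> h (n + 1)) = row2 \<Gamma> (2 * n + 1) (h (n + 1))"
    by (simp add: Vop_def rotation_def)
  then show "Sop n \<Gamma> h \<in> Ksp n \<Gamma>"
    "hnorm_sq (Sop n \<Gamma> h) \<le> hnorm_sq h - (norm (row2 \<Gamma> (2 * n + 1) (h (n + 1))))\<^sup>2"
    using Wop_props[of "Vop n \<Gamma> h"] Vop_props[OF h] unfolding Sop_def by auto
qed

lemma hnorm_sq_Sop_le: "h \<in> Ksp n \<Gamma> \<Longrightarrow> hnorm_sq (Sop n \<Gamma> h) \<le> hnorm_sq h"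
  using hnorm_sq_Sop[of h] zero_le_power2[of "norm (row2 \<Gamma> (2 * n + 1) (h (n + 1)))"] by linarith

lemma hnorm_sq_scaleC: "hnorm_sq (\<lambda>k. c *\<^sub>C h k) = (cmod c)\<^sup>2 * hnorm_sq h"
  for h :: "nat \<Rightarrow> 'c::chilbert_space"
  unfolding hnorm_sq_def norm_scaleC power_mult_distrib sum_distrib_left ..

lemma hnorm_sq_nonneg: "0 \<le> hnorm_sq h"
  by (simp add: hnorm_sq_def sum_nonneg)

lemma norm_le_hnorm: "k \<in> {1..n + 1} \<Longrightarrow> (norm (h k))\<^sup>2 \<le> hnorm_sq h"
  unfolding hnorm_sq_def by (rule member_le_sum) auto

lemma hnorm_sq_zero: "h \<in> Ksp n \<Gamma> \<Longrightarrow> hnorm_sq h \<le> 0 \<Longrightarrow> h = (\<lambda>k. 0)"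
proof
  fix k assume h: "h \<in> Ksp n \<Gamma>" "hnorm_sq h \<le> 0"
  show "h k = 0"
  proof (cases "k \<in> {1..n + 1}")
    case True
    then have "(norm (h k))\<^sup>2 \<le> 0" using norm_le_hnorm[of k h] h(2) by linarith
    then show ?thesis by simp
  qed (use h in \<open>auto simp: Ksp_def\<close>)
qed

section \<open>Completeness of the direct sum and existence of the resolvent\<close>

definition hdist :: "(nat \<Rightarrow> 'm \<times> 'n) \<Rightarrow> (nat \<Rightarrow> 'm \<times> 'n) \<Rightarrow> real" where
  "hdist h h' = sqrt (hnorm_sq (\<lambda>k. h k - h' k))"

lemma Metric_space_Ksp: "Metric_space (Ksp n \<Gamma>) hdist"
proof
  show "0 \<le> hdist h h'" for h h' by (simp add: hdist_def hnorm_sq_nonneg)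
  show "hdist h h' = hdist h' h" for h h' by (simp add: hdist_def hnorm_sq_def norm_minus_commute)
  show "hdist h h' = 0 \<longleftrightarrow> h = h'" if "h \<in> Ksp n \<Gamma>" "h' \<in> Ksp n \<Gamma>" for h h'
  proof
    assume "hdist h h' = 0"
    then have "(\<lambda>k. h k - h' k) = (\<lambda>k. 0)"
      by (intro hnorm_sq_zero Ksp_diff that) (simp add: hdist_def)
    then show "h = h'" by (metis ext right_minus_eq)
  qed (simp add: hdist_def hnorm_sq_def)
  show "hdist h h'' \<le> hdist h h' + hdist h' h''" for h h' h''
  proof -
    have "hdist h h'' = L2_set (\<lambda>k. norm (h k - h'' k)) {1..n + 1}" by (simp add: hdist_def hnorm_sq_def L2_set_def)
    also have "\<dots> \<le> L2_set (\<lambda>k. norm (h k - h' k) + norm (h' k - h'' k)) {1..n + 1}"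
      using norm_triangle_ineq[of "h k - h' k" "h' k - h'' k" for k] by (intro L2_set_mono) auto
    also have "\<dots> \<le> L2_set (\<lambda>k. norm (h k - h' k)) {1..n + 1} + L2_set (\<lambda>k. norm (h' k - h'' k)) {1..n + 1}"
      by (rule L2_set_triangle_ineq)
    finally show ?thesis by (simp add: hdist_def hnorm_sq_def L2_set_def)
  qed
qed

text \<open>Cauchy sequences converge in each of the finitely many components, and the component
  spaces are closed.\<close>

lemma mcomplete_Ksp: "Metric_space.mcomplete (Ksp n \<Gamma>) hdist"
proof -
  interpret Metric_space "Ksp n \<Gamma>" hdist by (rule Metric_space_Ksp)
  show ?thesis
    unfolding mcomplete_def
  proof (intro allI impI)
    fix \<sigma> assume \<sigma>: "MCauchy \<sigma>"
    have mem: "\<sigma> i \<in> Ksp n \<Gamma>" for i using \<sigma> by (auto simp: MCauchy_def)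
    have comp: "norm (\<sigma> i k - \<sigma> j k) \<le> hdist (\<sigma> i) (\<sigma> j)" if "k \<in> {1..n + 1}" for i j k
      unfolding hdist_def using norm_le_hnorm[OF that, of "\<lambda>k. \<sigma> i k - \<sigma> j k"] by (rule real_le_rsqrt)
    have "\<exists>l. (\<lambda>i. \<sigma> i k) \<longlonglongrightarrow> l" for k
    proof (cases "k \<in> {1..n + 1}")
      case True
      have "Cauchy (\<lambda>i. \<sigma> i k)"
      proof (rule CauchyI)
        fix e :: real assume "0 < e"
        then obtain N where "\<forall>i j. N \<le> i \<longrightarrow> N \<le> j \<longrightarrow> hdist (\<sigma> i) (\<sigma> j) < e"
          using \<sigma> unfolding MCauchy_def by blast
        then show "\<exists>M. \<forall>i\<ge>M. \<forall>j\<ge>M. norm (\<sigma> i k - \<sigma> j k) < e"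
          using comp[OF True] by (meson le_less_trans)
      qed
      then show ?thesis using Cauchy_convergent convergent_def by blast
    next
      case False
      then have "(\<lambda>i. \<sigma> i k) = (\<lambda>i. 0)" using mem by (auto simp: Ksp_def)
      then show ?thesis by (metis tendsto_const)
    qed
    then obtain l where l: "\<And>k. (\<lambda>i. \<sigma> i k) \<longlonglongrightarrow> l k" by metis
    have l_mem: "l \<in> Ksp n \<Gamma>"
      unfolding Ksp_def
    proof (intro CollectI conjI ballI allI impI)
      fix k assume k: "k \<in> {1..n + 1}"
      have "closed (Hsp \<Gamma> k)"
        using k by (auto simp: Hsp_eq' intro!: closed_Times csub_closed[OF csub_spaces(1)] csub_closed[OF csub_spaces(2)])
      moreover have "\<sigma> i k \<in> Hsp \<Gamma> k" for i using mem[of i] k by (simp add: Ksp_def)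
      ultimately show "l k \<in> Hsp \<Gamma> k" using l[of k] by (rule closed_sequentially)
    next
      fix k assume "k \<notin> {1..n + 1}"
      then have "(\<lambda>i. \<sigma> i k) = (\<lambda>i. 0)" using mem by (auto simp: Ksp_def)
      then show "l k = 0" using l[of k] by (simp add: LIMSEQ_const_iff)
    qed
    have "(\<lambda>i. hdist (\<sigma> i) l) \<longlonglongrightarrow> sqrt (\<Sum>k=1..n + 1. (norm (l k - l k))\<^sup>2)"
      unfolding hdist_def hnorm_sq_def by (intro tendsto_intros l)
    then have lim: "(\<lambda>i. hdist (\<sigma> i) l) \<longlonglongrightarrow> 0" by simp
    have "limitin mtopology \<sigma> l sequentially"
      unfolding limit_metric_sequentially
    proof (intro conjI allI impI l_mem)
      fix e :: real assume "0 < e"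
      then obtain N where "\<And>i. i \<ge> N \<Longrightarrow> hdist (\<sigma> i) l < e"
        using order_tendstoD(2)[OF lim] by (auto simp: eventually_sequentially)
      then show "\<exists>N. \<forall>i\<ge>N. \<sigma> i \<in> Ksp n \<Gamma> \<and> hdist (\<sigma> i) l < e" using mem by blast
    qed
    then show "\<exists>x. limitin mtopology \<sigma> x sequentially" by blast
  qed
qed

lemma id_minus_zS_Ksp: "h \<in> Ksp n \<Gamma> \<Longrightarrow> id_minus_zS n \<Gamma> z h \<in> Ksp n \<Gamma>"
  unfolding id_minus_zS_def by (intro Ksp_diff Ksp_scaleC Sop_Ksp)

lemma id_minus_zS_add:
  "id_minus_zS n \<Gamma> z (\<lambda>k. h k + h' k) = (\<lambda>k. id_minus_zS n \<Gamma> z h k + id_minus_zS n \<Gamma> z h' k)"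
  by (simp add: id_minus_zS_def Sop_add scaleC_add_right fun_eq_iff)

lemma id_minus_zS_scaleC:
  "id_minus_zS n \<Gamma> z (\<lambda>k. c *\<^sub>C h k) = (\<lambda>k. c *\<^sub>C id_minus_zS n \<Gamma> z h k)"
  by (simp add: id_minus_zS_def Sop_scaleC scaleC.diff_right scaleC_scaleC mult.commute fun_eq_iff)

text \<open>Solving h - z S h = f means finding a fixed point of f + z S h, a map with Lipschitz
  constant |z| because \<open>Sop\<close> does not increase energy. This is what gives
  \<open>resolvent\<close> its meaning.\<close>

lemma id_minus_zS_bij:
  assumes z: "norm z < 1"
  shows "bij_betw (id_minus_zS n \<Gamma> z) (Ksp n \<Gamma>) (Ksp n \<Gamma>)"
proof -
  interpret Metric_space "Ksp n \<Gamma>" hdist by (rule Metric_space_Ksp)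
  have contr: "hdist (\<lambda>k. f k + z *\<^sub>C Sop n \<Gamma> h k) (\<lambda>k. f k + z *\<^sub>C Sop n \<Gamma> h' k) \<le> norm z * hdist h h'"
    if "h \<in> Ksp n \<Gamma>" "h' \<in> Ksp n \<Gamma>" for f h h'
  proof -
    have "(\<lambda>k. (f k + z *\<^sub>C Sop n \<Gamma> h k) - (f k + z *\<^sub>C Sop n \<Gamma> h' k)) = (\<lambda>k. z *\<^sub>C Sop n \<Gamma> (\<lambda>k. h k - h' k) k)"
      by (simp add: Sop_diff scaleC.diff_right fun_eq_iff)
    then have "hdist (\<lambda>k. f k + z *\<^sub>C Sop n \<Gamma> h k) (\<lambda>k. f k + z *\<^sub>C Sop n \<Gamma> h' k)
        = norm z * sqrt (hnorm_sq (Sop n \<Gamma> (\<lambda>k. h k - h' k)))"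
      by (simp add: hdist_def hnorm_sq_scaleC real_sqrt_mult)
    also have "\<dots> \<le> norm z * sqrt (hnorm_sq (\<lambda>k. h k - h' k))"
      by (intro mult_left_mono real_sqrt_le_mono hnorm_sq_Sop_le Ksp_diff that) simp
    finally show ?thesis by (simp add: hdist_def)
  qed
  have fix_iff: "id_minus_zS n \<Gamma> z h = f \<longleftrightarrow> (\<lambda>k. f k + z *\<^sub>C Sop n \<Gamma> h k) = h" for f h
    by (auto simp: id_minus_zS_def fun_eq_iff diff_eq_eq)
  show ?thesis
    unfolding bij_betw_def
  proof (intro conjI equalityI subsetI)
    show "inj_on (id_minus_zS n \<Gamma> z) (Ksp n \<Gamma>)"
    proof (rule inj_onI)
      fix h h' assume h: "h \<in> Ksp n \<Gamma>" "h' \<in> Ksp n \<Gamma>" "id_minus_zS n \<Gamma> z h = id_minus_zS n \<Gamma> z h'"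
      define f where "f = id_minus_zS n \<Gamma> z h'"
      have "(\<lambda>k. f k + z *\<^sub>C Sop n \<Gamma> h k) = h" "(\<lambda>k. f k + z *\<^sub>C Sop n \<Gamma> h' k) = h'"
        using h(3) by (simp_all add: fix_iff[symmetric] f_def)
      then have "hdist h h' \<le> norm z * hdist h h'" using contr[OF h(1,2), of f] by simp
      then have "(1 - norm z) * hdist h h' \<le> 0" by (simp add: left_diff_distrib)
      then have "hdist h h' \<le> 0" using z by (simp add: mult_le_0_iff)
      then show "h = h'" using h nonneg[of h h'] zero by force
    qed
    show "f \<in> Ksp n \<Gamma>" if "f \<in> id_minus_zS n \<Gamma> z ` Ksp n \<Gamma>" for f using that id_minus_zS_Ksp by blast
    fix f assume f: "f \<in> Ksp n \<Gamma>"
    obtain h where "h \<in> Ksp n \<Gamma>" "(\<lambda>k. f k + z *\<^sub>C Sop n \<Gamma> h k) = h"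
    proof (rule Banach_fixedpoint_thm[OF mcomplete_Ksp _ _ z, of "\<lambda>h k. f k + z *\<^sub>C Sop n \<Gamma> h k"])
      show "Ksp n \<Gamma> \<noteq> {}" using f by blast
      show "(\<lambda>h k. f k + z *\<^sub>C Sop n \<Gamma> h k) \<in> Ksp n \<Gamma> \<rightarrow> Ksp n \<Gamma>"
        by (intro Pi_I Ksp_add[OF f] Ksp_scaleC Sop_Ksp)
    qed (use contr in auto)
    then have "id_minus_zS n \<Gamma> z h = f" by (simp add: fix_iff)
    then show "f \<in> id_minus_zS n \<Gamma> z ` Ksp n \<Gamma>" using \<open>h \<in> Ksp n \<Gamma>\<close> by blast
  qed
qed

lemma incl_last_Ksp:
  assumes "y \<in> cod_space \<Gamma> (2 * n + 2)"
  shows "incl (n + 1) (0, y) \<in> Ksp n \<Gamma>"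
  using assms by (auto simp: Ksp_def incl_def Hsp_eq' zero_prod_def intro!: csub_0[OF csub_spaces(1)] csub_0[OF csub_spaces(2)])

lemma incl_first_Ksp:
  assumes "x \<in> dom_space \<Gamma> 1"
  shows "incl 1 (x, 0) \<in> Ksp n \<Gamma>"
  using assms by (auto simp: Ksp_def incl_def Hsp_eq' zero_prod_def intro!: csub_0[OF csub_spaces(1)] csub_0[OF csub_spaces(2)])

section \<open>The coefficients of the linear-fractional formula\<close>

context
  fixes z :: complex
  assumes z: "norm z < 1"
begin

lemma resolvent_Ksp: "f \<in> Ksp n \<Gamma> \<Longrightarrow> resolvent n \<Gamma> z f \<in> Ksp n \<Gamma>"
  unfolding resolvent_def using id_minus_zS_bij[OF z] by (metis bij_betw_imp_surj_on inv_into_into)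

lemma resolvent_right: "f \<in> Ksp n \<Gamma> \<Longrightarrow> id_minus_zS n \<Gamma> z (resolvent n \<Gamma> z f) = f"
  unfolding resolvent_def using id_minus_zS_bij[OF z] by (metis bij_betw_inv_into_right)

lemma resolvent_eqI: "h \<in> Ksp n \<Gamma> \<Longrightarrow> id_minus_zS n \<Gamma> z h = f \<Longrightarrow> resolvent n \<Gamma> z f = h"
  unfolding resolvent_def using id_minus_zS_bij[OF z] by (metis bij_betw_inv_into_left)

lemma resolvent_add:
  "f \<in> Ksp n \<Gamma> \<Longrightarrow> f' \<in> Ksp n \<Gamma> \<Longrightarrow>
    resolvent n \<Gamma> z (\<lambda>k. f k + f' k) = (\<lambda>k. resolvent n \<Gamma> z f k + resolvent n \<Gamma> z f' k)"
  by (rule resolvent_eqI) (simp_all add: Ksp_add resolvent_Ksp id_minus_zS_add resolvent_right)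

lemma resolvent_scaleC:
  "f \<in> Ksp n \<Gamma> \<Longrightarrow> resolvent n \<Gamma> z (\<lambda>k. c *\<^sub>C f k) = (\<lambda>k. c *\<^sub>C resolvent n \<Gamma> z f k)"
  by (rule resolvent_eqI) (simp_all add: Ksp_scaleC resolvent_Ksp id_minus_zS_scaleC resolvent_right)

lemma Aop_add:
  assumes "y \<in> cod_space \<Gamma> (2 * n + 2)" "y' \<in> cod_space \<Gamma> (2 * n + 2)"
  shows "Aop n \<Gamma> z (y + y') = Aop n \<Gamma> z y + Aop n \<Gamma> z y'"
proof -
  have "incl (n + 1) (0, y + y') = (\<lambda>k. incl (n + 1) (0, y) k + incl (n + 1) (0 :: 'm, y') k)"
    by (auto simp: incl_def)
  then have "resolvent n \<Gamma> z (incl (n + 1) (0, y + y'))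
      = (\<lambda>k. resolvent n \<Gamma> z (incl (n + 1) (0, y)) k + resolvent n \<Gamma> z (incl (n + 1) (0, y')) k)"
    by (simp only: resolvent_add[OF incl_last_Ksp[OF assms(1)] incl_last_Ksp[OF assms(2)]])
  then show ?thesis
    by (simp only: Aop_def bop_add[OF bop_row2[OF order_refl]] scaleC_add_right)
qed

lemma Aop_scaleC:
  assumes "y \<in> cod_space \<Gamma> (2 * n + 2)"
  shows "Aop n \<Gamma> z (c *\<^sub>C y) = c *\<^sub>C Aop n \<Gamma> z y"
proof -
  have "incl (n + 1) (0, c *\<^sub>C y) = (\<lambda>k. c *\<^sub>C incl (n + 1) (0 :: 'm, y) k)"
    by (rule ext) (simp add: incl_def)
  then have "resolvent n \<Gamma> z (incl (n + 1) (0, c *\<^sub>C y)) = (\<lambda>k. c *\<^sub>C resolvent n \<Gamma> z (incl (n + 1) (0, y)) k)"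
    by (simp only: resolvent_scaleC[OF incl_last_Ksp[OF assms]])
  then show ?thesis
    unfolding Aop_def by (simp only: bop_scaleC[OF bop_row2[OF order_refl]] scaleC_scaleC) (simp add: mult.commute)
qed

lemma Aop_mem:
  assumes "y \<in> cod_space \<Gamma> (2 * n + 2)"
  shows "Aop n \<Gamma> z y \<in> dom_space \<Gamma> (2 * n + 2)"
proof -
  let ?h = "resolvent n \<Gamma> z (incl (n + 1) (0, y)) (n + 1)"
  have "?h \<in> Hsp \<Gamma> (n + 1)"
    using resolvent_Ksp[OF incl_last_Ksp[OF assms]] by (simp add: Ksp_def)
  then have "?h \<in> dom_space \<Gamma> (2 * n + 1) \<times> cod_space \<Gamma> (Suc (2 * n + 1))" by (simp add: Hsp_eq')
  from rotation_props(1)[OF _ this] have "row2 \<Gamma> (2 * n + 1) ?h \<in> dom_space \<Gamma> (2 * n + 2)"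
    by (simp add: rotation_def)
  then show ?thesis unfolding Aop_def by (intro csub_scaleC csub_spaces) simp_all
qed

text \<open>The rotations are isometric, so the energy lost by \<open>S\<close> dominates \<open>\<parallel>row2 h\<^sub>n\<^sub>+\<^sub>1\<parallel>\<^sup>2\<close>.\<close>

lemma Aop_norm:
  assumes y: "y \<in> cod_space \<Gamma> (2 * n + 2)"
  shows "norm (Aop n \<Gamma> z y) \<le> norm z * norm y"
proof -
  let ?f = "incl (n + 1) (0, y)"
  define h where "h = resolvent n \<Gamma> z ?f"
  define g where "g = row2 \<Gamma> (2 * n + 1) (h (n + 1))"
  have h: "h \<in> Ksp n \<Gamma>" unfolding h_def by (rule resolvent_Ksp[OF incl_last_Ksp[OF y]])
  have eq: "h k - z *\<^sub>C Sop n \<Gamma> h k = ?f k" for k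
    using fun_cong[OF resolvent_right[OF incl_last_Ksp[OF y]], of k] by (simp add: h_def id_minus_zS_def)
  \<comment> \<open>\<open>Wop\<close> puts \<open>0\<close> in the last place, so the second entry
    of component \<open>n + 1\<close> receives nothing from \<open>Sop\<close> and equals the input
    \<open>y\<close>.\<close>
  have snd_last: "snd (h (n + 1)) = y"
    using arg_cong[OF eq[of "n + 1"], of snd] by (simp add: Sop_def Wop_def incl_def)
  have split: "(norm (h k))\<^sup>2 = (norm (z *\<^sub>C Sop n \<Gamma> h k))\<^sup>2 + (if k = n + 1 then (norm y)\<^sup>2 else 0)" for k
  proof -
    have "h k = ?f k + z *\<^sub>C Sop n \<Gamma> h k" using eq[of k] by (simp only: diff_eq_eq)
    then have "z *\<^sub>C Sop n \<Gamma> h k = h k - ?f k" by (simp only: add_diff_cancel_left')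
    then show ?thesis using snd_last by (auto simp: incl_def norm_pair_sq)
  qed
  have "hnorm_sq h = hnorm_sq (\<lambda>k. z *\<^sub>C Sop n \<Gamma> h k) + (\<Sum>k=1..n + 1. if k = n + 1 then (norm y)\<^sup>2 else 0)"
    unfolding hnorm_sq_def sum.distrib[symmetric] by (intro sum.cong refl split)
  then have "hnorm_sq h = (norm z)\<^sup>2 * hnorm_sq (Sop n \<Gamma> h) + (norm y)\<^sup>2"
    by (simp add: hnorm_sq_scaleC)
  moreover have "(norm z)\<^sup>2 * hnorm_sq (Sop n \<Gamma> h) \<le> (norm z)\<^sup>2 * (hnorm_sq h - (norm g)\<^sup>2)"
    unfolding g_def by (intro mult_left_mono hnorm_sq_Sop h) simp
  moreover have "(norm y)\<^sup>2 \<le> hnorm_sq h"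
  proof -
    have "(norm y)\<^sup>2 \<le> (norm (h (n + 1)))\<^sup>2" using split[of "n + 1"] by simp
    then show ?thesis by (rule order_trans) (rule norm_le_hnorm, simp)
  qed
  \<comment> \<open>The energy balance reads |z|^2 |g|^2 <= |y|^2 - (1 - |z|^2) |h|^2; replacing the
    energy of \<open>h\<close> by the smaller |y|^2 leaves |z|^2 |y|^2.\<close>
  moreover have "(1 - (norm z)\<^sup>2) * (norm y)\<^sup>2 \<le> (1 - (norm z)\<^sup>2) * hnorm_sq h"
    using z calculation(3) by (intro mult_left_mono) (auto simp: power_le_one)
  ultimately have "(norm z)\<^sup>2 * (norm g)\<^sup>2 \<le> (norm z)\<^sup>2 * (norm y)\<^sup>2"
    by (simp add: algebra_simps)
  then have "(norm z * norm g)\<^sup>2 \<le> (norm z * norm y)\<^sup>2" by (simp add: power_mult_distrib)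
  then have "norm z * norm g \<le> norm z * norm y" by (rule power2_le_imp_le) simp
  then show ?thesis by (simp add: Aop_def g_def h_def norm_scaleC)
qed

text \<open>By \<open>Aop_norm\<close> the composition with a contraction \<open>E\<close> has norm
  at most |z| < 1, so the inverse in the formula exists for every admissible parameter.\<close>

lemma Aop_bij:
  assumes E: "E \<in> contractions (dom_space \<Gamma> (2 * n + 2)) (cod_space \<Gamma> (2 * n + 2))"
  shows "bij_betw (\<lambda>u. u - Aop n \<Gamma> z (E u)) (dom_space \<Gamma> (2 * n + 2)) (dom_space \<Gamma> (2 * n + 2))"
proof -
  have V: "csub (dom_space \<Gamma> (2 * n + 2))" by (rule csub_spaces) simp
  have ED: "bop E" "E u \<in> cod_space \<Gamma> (2 * n + 2)" "norm (E u) \<le> norm u" for u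
    using E[unfolded contractions_iff[OF V]] by blast+
  have le: "norm (Aop n \<Gamma> z (E u)) \<le> norm z * norm u" for u
    using Aop_norm[OF ED(2)] mult_left_mono[OF ED(3) norm_ge_zero] by (rule order_trans)
  have "bop (\<lambda>u. Aop n \<Gamma> z (E u))"
    by (rule bopI[OF _ _ le]) (simp_all only: bop_add[OF ED(1)] bop_scaleC[OF ED(1)] Aop_add[OF ED(2) ED(2)] Aop_scaleC[OF ED(2)])
  from bij_betw_id_minus_contraction(1)[OF V this Aop_mem[OF ED(2)] norm_ge_zero z le] show ?thesis .
qed

end

end

section \<open>Identification of the iterated Schur steps with the formula\<close>

context choice_sequence
begin

text \<open>The state \<open>h\<close> is the wave of \<open>ladder_wave\<close>, rescaled: each application of \<open>z S\<close> contributes a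
  factor \<open>z\<close> to both components of a pair, each step of the wave only to \<open>ys\<close>.\<close>

lemma ladder_eq_linear_fractional:
  assumes \<E>: "\<E> \<in> schur_class (dom_space \<Gamma> (2 * n + 2)) (cod_space \<Gamma> (2 * n + 2))" and z: "norm z < 1"
  shows "ladder \<Gamma> (2 * n + 2) \<E> z x = Theta0 n \<Gamma> z x + Cop n \<Gamma> z (\<E> z
    (inv_into (dom_space \<Gamma> (2 * n + 2)) (\<lambda>u. u - Aop n \<Gamma> z (\<E> z u)) (Bop n \<Gamma> z x)))"
proof -
  have V: "csub (dom_space \<Gamma> (2 * n + 2))" by (rule csub_spaces) simp
  note \<E>D = schur_classD[OF V \<E> z]
  have K: "2 * n + 2 \<le> Suc (2 * n + 1)" by simp
  obtain xs ys where w: "xs 0 = x" "ys 0 = ladder \<Gamma> (2 * n + 2) \<E> z x" "ys (2 * n + 2) = \<E> z (xs (2 * n + 2))"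
    and W: "\<forall>k<2 * n + 2. xs (Suc k) \<in> dom_space \<Gamma> (Suc k) \<and> ys (Suc k) \<in> cod_space \<Gamma> (Suc k) \<and>
      ys k = \<Gamma> k (xs k) + Dop_adj \<Gamma> k (z *\<^sub>C ys (Suc k)) \<and>
      xs (Suc k) = Dop \<Gamma> k (xs k) - adj (\<Gamma> k) (z *\<^sub>C ys (Suc k))"
    using ladder_wave[OF choice K \<E> z, of x] by blast
  have mem: "\<And>k. k < 2 * n + 2 \<Longrightarrow> xs (Suc k) \<in> dom_space \<Gamma> (Suc k)"
      "\<And>k. k < 2 * n + 2 \<Longrightarrow> ys (Suc k) \<in> cod_space \<Gamma> (Suc k)"
    and step: "\<And>k. k < 2 * n + 2 \<Longrightarrow> ys k = \<Gamma> k (xs k) + Dop_adj \<Gamma> k (z *\<^sub>C ys (Suc k))"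
      "\<And>k. k < 2 * n + 2 \<Longrightarrow> xs (Suc k) = Dop \<Gamma> k (xs k) - adj (\<Gamma> k) (z *\<^sub>C ys (Suc k))"
    using W by blast+
  have rot: "rotation \<Gamma> k (c *\<^sub>C xs k, c *\<^sub>C z *\<^sub>C ys (Suc k)) = (c *\<^sub>C ys k, c *\<^sub>C xs (Suc k))"
    if k: "k < 2 * n + 2" for k c
  proof -
    have "rotation \<Gamma> k (xs k, z *\<^sub>C ys (Suc k)) = (ys k, xs (Suc k))"
      using step[OF k] by (simp add: rotation_def row1_def row2_def)
    then show ?thesis using rotation_scaleC[of k c "(xs k, z *\<^sub>C ys (Suc k))"] k by simp
  qed
  \<comment> \<open>\<open>row2\<close> of the last component of the state is \<open>z ^ n\<close>
    times the last \<open>xs\<close>; the factor \<open>z\<close> in \<open>Aop\<close> and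
    \<open>Bop\<close> raises the exponent to \<open>n + 1\<close>.\<close>
  define u where "u = z ^ (n + 1) *\<^sub>C xs (2 * n + 2)"
  have Eu: "\<E> z u = z ^ (n + 1) *\<^sub>C ys (2 * n + 2)"
    by (simp only: u_def bop_scaleC[OF \<E>D(2)] w(3))
  \<comment> \<open>Each further component costs one application of z S, hence the power
    \<open>k - 1\<close>. The second entry carries an extra \<open>z\<close> because the rotation of
    \<open>\<Gamma> (2 * k - 1)\<close> takes \<open>z *\<^sub>C ys (2 * k)\<close> as
    input.\<close>
  define h where "h k = (if k \<in> {1..n + 1}
    then (z ^ (k - 1) *\<^sub>C xs (2 * k - 1), z ^ (k - 1) *\<^sub>C z *\<^sub>C ys (2 * k)) else 0)" for k
  have h_mem: "h \<in> Ksp n \<Gamma>"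
    unfolding Ksp_def
  proof (intro CollectI conjI ballI allI impI)
    fix k assume k: "k \<in> {1..n + 1}"
    then have "xs (2 * k - 1) \<in> dom_space \<Gamma> (2 * k - 1)" "ys (2 * k) \<in> cod_space \<Gamma> (2 * k)"
      using mem(1)[of "2 * k - 2"] mem(2)[of "2 * k - 1"] by (auto simp: Suc_diff_Suc numeral_2_eq_2)
    then show "h k \<in> Hsp \<Gamma> k"
      using k by (auto simp: h_def Hsp_eq' intro!: csub_scaleC csub_spaces)
  qed (auto simp: h_def)
  define g where "g = Vop n \<Gamma> h"
  have g: "g k = (z ^ (k - 1) *\<^sub>C ys (2 * k - 1), z ^ (k - 1) *\<^sub>C xs (2 * k))" if k: "k \<in> {1..n + 1}" for k
  proof -
    have "Suc (2 * k - 1) = 2 * k" using k by auto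
    then show ?thesis using rot[of "2 * k - 1" "z ^ (k - 1)"] k by (simp add: g_def Vop_def h_def)
  qed
  have even_rot: "rotation \<Gamma> (2 * k) (snd (g k), fst (g (k + 1)))
      = (z ^ (k - 1) *\<^sub>C ys (2 * k), z ^ (k - 1) *\<^sub>C xs (2 * k + 1))" if k: "k \<in> {1..n}" for k
  proof -
    have "z ^ k = z ^ (k - 1) * z" using k by (cases k) auto
    then have "fst (g (k + 1)) = z ^ (k - 1) *\<^sub>C z *\<^sub>C ys (Suc (2 * k))"
      using k by (simp add: g scaleC_scaleC)
    moreover have "snd (g k) = z ^ (k - 1) *\<^sub>C xs (2 * k)" using k by (simp add: g)
    ultimately show ?thesis using rot[of "2 * k" "z ^ (k - 1)"] k by simp
  qed
  \<comment> \<open>The two inputs of the chain: \<open>Dop \<Gamma> 0 x\<close> enters at the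
    front, \<open>\<E> z u\<close> at the place that \<open>Wop\<close> fills with
    \<open>0\<close>.\<close>
  let ?f = "\<lambda>k. incl 1 (Dop \<Gamma> 0 x, 0) k + incl (n + 1) (0, \<E> z u) k"
  have "id_minus_zS n \<Gamma> z h = ?f"
  proof
    fix k
    have S: "Sop n \<Gamma> h k = Wop n \<Gamma> g k" by (simp add: Sop_def g_def)
    show "id_minus_zS n \<Gamma> z h k = ?f k"
    proof (cases "k \<in> {1..n + 1}")
      case False
      then have "Wop n \<Gamma> g k = 0" "h k = 0" by (auto simp: Wop_def h_def)
      then show ?thesis using False by (auto simp: id_minus_zS_def S incl_def)
    next
      case k: True
      have "fst (h k) - z *\<^sub>C fst (Wop n \<Gamma> g k) = fst (?f k)"
      proof (cases "k = 1")
        case True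
        \<comment> \<open>The block \<open>- adj (\<Gamma> 0)\<close> closes the second row of the
          rotation of \<open>\<Gamma> 0\<close>; the first row stays outside the block operator, in
          \<open>Theta0\<close> and \<open>Cop\<close>.\<close>
        have "fst (Wop n \<Gamma> g 1) = - adj (\<Gamma> 0) (ys 1)" using g[of 1] by (simp add: Wop_def)
        moreover have "xs 1 = Dop \<Gamma> 0 x - z *\<^sub>C adj (\<Gamma> 0) (ys 1)"
          using step(2)[of 0] by (simp add: w(1) bop_scaleC[OF adj_0_bop])
        ultimately show ?thesis using True by (simp add: h_def incl_def scaleC.minus_right)
      next
        case False
        define i where "i = k - 1"
        have i: "k = i + 1" "i \<in> {1..n}" using False k by (auto simp: i_def)
        have "fst (Wop n \<Gamma> g (i + 1)) = z ^ (i - 1) *\<^sub>C xs (2 * i + 1)"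
          using even_rot[OF i(2)] i(2) by (auto simp: Wop_def)
        moreover have "z ^ i = z * z ^ (i - 1)" using i(2) by (cases i) auto
        ultimately show ?thesis using i by (auto simp: h_def incl_def scaleC_scaleC)
      qed
      moreover have "snd (h k) - z *\<^sub>C snd (Wop n \<Gamma> g k) = snd (?f k)"
      proof (cases "k = n + 1")
        case True
        then have "snd (Wop n \<Gamma> g k) = 0" by (simp add: Wop_def)
        then show ?thesis using True by (simp add: h_def incl_def Eu scaleC_scaleC mult.commute)
      next
        case False
        then have k': "k \<in> {1..n}" using k by auto
        then have "snd (Wop n \<Gamma> g k) = z ^ (k - 1) *\<^sub>C ys (2 * k)"
          using even_rot[OF k'] by (auto simp: Wop_def)
        then show ?thesis using k' by (simp add: h_def incl_def scaleC_scaleC mult.commute)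
      qed
      ultimately show ?thesis by (simp add: id_minus_zS_def S prod_eq_iff)
    qed
  qed
  moreover have x1: "Dop \<Gamma> 0 x \<in> dom_space \<Gamma> 1"
  proof -
    interpret contraction_between "dom_space \<Gamma> 0" "cod_space \<Gamma> 0" "\<Gamma> 0" by (rule contraction) simp
    show ?thesis using D_mem_DS[of x] by (simp add: Dop_def dom_space.simps(2))
  qed
  \<comment> \<open>By linearity the state is the sum of the responses to the two inputs, which
    separates \<open>Theta0\<close> and \<open>Bop\<close> from \<open>Cop\<close> and
    \<open>Aop\<close>.\<close>
  ultimately have h: "h = (\<lambda>k. resolvent n \<Gamma> z (incl 1 (Dop \<Gamma> 0 x, 0)) k + resolvent n \<Gamma> z (incl (n + 1) (0, \<E> z u)) k)"
    using resolvent_eqI[OF z h_mem, of ?f] resolvent_add[OF z incl_first_Ksp[OF x1] incl_last_Ksp[OF \<E>D(3)]] by simp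
  have r1: "row1 \<Gamma> 1 (resolvent n \<Gamma> z (incl 1 (Dop \<Gamma> 0 x, 0)) 1) + row1 \<Gamma> 1 (resolvent n \<Gamma> z (incl (n + 1) (0, \<E> z u)) 1) = ys 1"
  proof -
    have "row1 \<Gamma> 1 (h 1) = fst (g 1)" by (simp add: g_def Vop_def rotation_def)
    then show ?thesis using bop_add[OF bop_row1, of 1] g[of 1] by (simp add: h)
  qed
  have r2: "row2 \<Gamma> (2 * n + 1) (resolvent n \<Gamma> z (incl 1 (Dop \<Gamma> 0 x, 0)) (n + 1))
      + row2 \<Gamma> (2 * n + 1) (resolvent n \<Gamma> z (incl (n + 1) (0, \<E> z u)) (n + 1)) = z ^ n *\<^sub>C xs (2 * n + 2)"
  proof -
    have "row2 \<Gamma> (2 * n + 1) (h (n + 1)) = snd (g (n + 1))" by (simp add: g_def Vop_def rotation_def)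
    then show ?thesis using bop_add[OF bop_row2, of "2 * n + 1"] g[of "n + 1"] by (simp add: h)
  qed
  \<comment> \<open>The loop equation at the far end: the vector \<open>u\<close> chosen above is
    the preimage that \<open>inv_into\<close> selects.\<close>
  have "Bop n \<Gamma> z x + Aop n \<Gamma> z (\<E> z u) = u"
    unfolding Bop_def Aop_def scaleC_add_right[symmetric] r2 by (simp add: u_def scaleC_scaleC)
  then have "Bop n \<Gamma> z x = u - Aop n \<Gamma> z (\<E> z u)" by (simp only: eq_diff_eq)
  moreover have "u \<in> dom_space \<Gamma> (2 * n + 2)"
    unfolding u_def using mem(1)[of "2 * n + 1"] by (intro csub_scaleC[OF V]) simp
  ultimately have inv: "inv_into (dom_space \<Gamma> (2 * n + 2)) (\<lambda>u. u - Aop n \<Gamma> z (\<E> z u)) (Bop n \<Gamma> z x) = u"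
    using bij_betw_inv_into_left[OF Aop_bij[OF z \<E>D(1)]] by simp
  interpret contraction_between "dom_space \<Gamma> 0" "cod_space \<Gamma> 0" "\<Gamma> 0" by (rule contraction) simp
  have D0: "bop (Dop_adj \<Gamma> 0)" using dual(1) by (simp add: Dop_adj_def)
  have "Theta0 n \<Gamma> z x + Cop n \<Gamma> z (\<E> z u) = \<Gamma> 0 x + z *\<^sub>C Dop_adj \<Gamma> 0 (ys 1)"
    unfolding Theta0_def Cop_def add.assoc scaleC_add_right[symmetric] bop_add[OF D0, symmetric] r1 ..
  also have "\<dots> = ladder \<Gamma> (2 * n + 2) \<E> z x"
    using step(1)[of 0] by (simp add: w bop_scaleC[OF D0])
  finally show ?thesis by (simp only: inv)
qed

end

text \<open>Since \<open>inv_into\<close> is total, a formula with inverses says nothing about their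
  existence; the first two conjuncts supply it, so that \<open>F\<close> is the genuine
  linear-fractional map. The correspondence is transported from \<open>ladder\<close>, with which
  \<open>F\<close> agrees on the Schur class.\<close>

theorem theorem4p7:
  fixes n :: nat
    and \<Gamma> :: "nat \<Rightarrow> 'm::{chilbert_space, second_countable_topology}
                     \<Rightarrow> 'n::{chilbert_space, second_countable_topology}"
  defines "\<DD> \<equiv> Dsp \<Gamma> (2 * n + 1)"
    and "\<DD>' \<equiv> Dsp_adj \<Gamma> (2 * n + 1)"
    and "F \<equiv> (\<lambda>\<E>. \<lambda>z\<in>ball 0 1. \<lambda>x. Theta0 n \<Gamma> z x +
            Cop n \<Gamma> z (\<E> z (inv_into (Dsp \<Gamma> (2 * n + 1)) (\<lambda>u. u - Aop n \<Gamma> z (\<E> z u)) (Bop n \<Gamma> z x))))"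
  assumes choice: "choice_sequence_upto (2 * n + 1) \<Gamma>"
    and "\<DD> \<noteq> {0}" and "\<DD>' \<noteq> {0}"
  shows "(\<forall>z\<in>ball 0 1. bij_betw (id_minus_zS n \<Gamma> z) (Ksp n \<Gamma>) (Ksp n \<Gamma>)) \<and>
    (\<forall>\<E>\<in>schur_class \<DD> \<DD>'. \<forall>z\<in>ball 0 1. bij_betw (\<lambda>u. u - Aop n \<Gamma> z (\<E> z u)) \<DD> \<DD>) \<and>
    bij_betw F (schur_class \<DD> \<DD>')
      {\<Theta> \<in> schur_class UNIV UNIV. \<forall>k\<le>2 * n + 1. schur_param UNIV UNIV \<Theta> k = \<Gamma> k} \<and>
    (\<forall>\<E>\<in>schur_class \<DD> \<DD>'.
      (\<forall>k\<le>2 * n + 1. schur_param UNIV UNIV (F \<E>) k = \<Gamma> k) \<and>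
      (\<forall>j. schur_param UNIV UNIV (F \<E>) (2 * n + 2 + j) = schur_param \<DD> \<DD>' \<E> j))"
proof -
  interpret choice_sequence n \<Gamma> by unfold_locales (rule choice)
  let ?S = "schur_class \<DD> \<DD>'"
  have spaces: "\<DD> = dom_space \<Gamma> (2 * n + 2)" "\<DD>' = cod_space \<Gamma> (2 * n + 2)"
    by (simp_all add: \<DD>_def \<DD>'_def Dsp_def Dsp_adj_def dom_space.simps(2) cod_space.simps(2))
  have V: "csub \<DD>" unfolding spaces by (rule csub_spaces) simp
  have "{\<Theta> \<in> schur_class UNIV UNIV. \<forall>k<2 * n + 2. schur_param UNIV UNIV \<Theta> k = \<Gamma> k}
      = {\<Theta> \<in> schur_class UNIV UNIV. \<forall>k\<le>2 * n + 1. schur_param UNIV UNIV \<Theta> k = \<Gamma> k}" (is "_ = ?B")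
    by (simp add: less_Suc_eq_le)
  then have bij: "bij_betw (ladder \<Gamma> (2 * n + 2)) ?S ?B"
    using ladder_bij(1)[OF choice, of "2 * n + 2"] unfolding spaces by simp
  \<comment> \<open>Both sides are extensional, so agreement on the disk suffices.\<close>
  have F: "F \<E> = ladder \<Gamma> (2 * n + 2) \<E>" if \<E>: "\<E> \<in> ?S" for \<E>
  proof (rule extensionalityI)
    show "F \<E> \<in> extensional (ball 0 1)" by (simp add: F_def)
    have "ladder \<Gamma> (2 * n + 2) \<E> \<in> schur_class UNIV UNIV" using bij_betwE[OF bij] \<E> by blast
    then show "ladder \<Gamma> (2 * n + 2) \<E> \<in> extensional (ball 0 1)" by (simp add: schur_class_def PiE_def)
    fix z :: complex assume z: "z \<in> ball 0 1"
    have "Dsp \<Gamma> (2 * n + 1) = dom_space \<Gamma> (2 * n + 2)" using spaces(1) by (simp add: \<DD>_def)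
    then show "F \<E> z = ladder \<Gamma> (2 * n + 2) \<E> z"
      using ladder_eq_linear_fractional[of \<E> z] \<E> z unfolding spaces F_def
      by (simp add: fun_eq_iff)
  qed
  have bij_F: "bij_betw F ?S ?B"
    using bij by (rule bij_betw_cong[THEN iffD1, rotated]) (simp add: F)
  show ?thesis
  proof (intro conjI ballI)
    show "bij_betw (id_minus_zS n \<Gamma> z) (Ksp n \<Gamma>) (Ksp n \<Gamma>)" if "z \<in> ball 0 1" for z
      using that by (intro id_minus_zS_bij) simp
    show "bij_betw (\<lambda>u. u - Aop n \<Gamma> z (\<E> z u)) \<DD> \<DD>" if "\<E> \<in> ?S" "z \<in> ball 0 1" for \<E> z
      using Aop_bij[of z "\<E> z"] schur_classD(1)[OF V that(1), of z] that(2) unfolding spaces by simp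
    show "bij_betw F ?S ?B" by (rule bij_F)
    fix \<E> assume \<E>: "\<E> \<in> ?S"
    show "\<forall>k\<le>2 * n + 1. schur_param UNIV UNIV (F \<E>) k = \<Gamma> k"
      using bij_betwE[OF bij_F] \<E> by blast
    show "\<forall>j. schur_param UNIV UNIV (F \<E>) (2 * n + 2 + j) = schur_param \<DD> \<DD>' \<E> j"
      using ladder_bij(2)[OF choice, of "2 * n + 2" \<E>] \<E> unfolding F[OF \<E>] spaces schur_param_def by simp
  qed
qed

end
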